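(* Let $r\in(1,2]$ and an integer $j\ge1$ be fixed. Then there exist coefficients $a_{jkl}$ ($1\le k\le j$, $0\le l\le 2(j-k)+1$) such that the Cauchy problem for the equation $$\partial_tv+(-1)^{j+1}\partial_x^{2j+1}v+\sum_{k=1}^j\sum_{l=0}^{2(j-k)+1}a_{jkl}\,\big(\partial_x^l|v|^{2k}\big)\big(\partial_x^{2(j-k)+1-l}v\big)=0$$ for complex valued $v=v(x,t)$, $x\in\mathbb R$, with data $v(\cdot,0)=v_0\in\widehat H^r_s(\mathbb R)$ is ill-posed if $-\frac1{r'}<s<\frac{2j-1}{2r'}$, in the following sense: for any $T>0$, the mapping $v_0\mapsto v$ (data upon solution) from $\widehat H^r_s(\mathbb R)$ into any solution space $X_T$ continuously embedded in $C([0,T],\widehat H^r_s(\mathbb R))$ cannot be uniformly continuous on bounded subsets of $\widehat H^r_s(\mathbb R)$.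
   Context: $\frac1r+\frac1{r'}=1$, $\langle\xi\rangle=(1+\xi^2)^{1/2}$, and $\widehat H^r_s(\mathbb R)$ is defined by the norm $\|v_0\|_{\widehat H^r_s(\mathbb R)}=\|\langle\xi\rangle^s\mathcal F_xv_0\|_{L^{r'}_\xi}$, where $\mathcal F_x$ is the Fourier transform in $x$. *)

theory Defs
  imports "HOL-Analysis.Analysis"
begin

definition nth_deriv :: "nat \<Rightarrow> (real \<Rightarrow> complex) \<Rightarrow> real \<Rightarrow> complex" where
  "nth_deriv n = ((\<lambda>f x. vector_derivative f (at x)) ^^ n)"

definition schwartz :: "(real \<Rightarrow> complex) set" where
  "schwartz = {\<phi>. (\<forall>n x. nth_deriv n \<phi> differentiable (at x)) \<and>
                  (\<forall>m n. \<exists>C. \<forall>x. \<bar>x\<bar> ^ m * cmod (nth_deriv n \<phi> x) \<le> C)}"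

definition schwartz_seminorm :: "nat \<Rightarrow> nat \<Rightarrow> (real \<Rightarrow> complex) \<Rightarrow> real" where
  "schwartz_seminorm m n \<phi> = (SUP x. \<bar>x\<bar> ^ m * cmod (nth_deriv n \<phi> x))"

definition schwartz_norm :: "nat \<Rightarrow> (real \<Rightarrow> complex) \<Rightarrow> real" where
  "schwartz_norm N \<phi> = (\<Sum>m\<le>N. \<Sum>n\<le>N. schwartz_seminorm m n \<phi>)"

text \<open>
  A tempered distribution is a continuous complex-linear functional on the Schwartz space.
  To be determined by its values there, it is extended by zero to all other functions.
\<close>

definition tempered :: "((real \<Rightarrow> complex) \<Rightarrow> complex) \<Rightarrow> bool" where
  "tempered u \<longleftrightarrow>
     (\<forall>\<phi>. \<phi> \<notin> schwartz \<longrightarrow> u \<phi> = 0) \<and>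
     (\<forall>\<phi>\<in>schwartz. \<forall>\<psi>\<in>schwartz. u (\<lambda>x. \<phi> x + \<psi> x) = u \<phi> + u \<psi>) \<and>
     (\<forall>c. \<forall>\<phi>\<in>schwartz. u (\<lambda>x. c * \<phi> x) = c * u \<phi>) \<and>
     (\<exists>N C. \<forall>\<phi>\<in>schwartz. cmod (u \<phi>) \<le> C * schwartz_norm N \<phi>)"

lemma schwartz_seminorm_nonneg:
  assumes "\<phi> \<in> schwartz"
  shows "0 \<le> schwartz_seminorm m n \<phi>"
proof -
  obtain C where C: "\<And>x. \<bar>x\<bar> ^ m * cmod (nth_deriv n \<phi> x) \<le> C"
    using assms unfolding schwartz_def by blast
  have "0 \<le> \<bar>0::real\<bar> ^ m * cmod (nth_deriv n \<phi> 0)" by simp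
  also have "\<dots> \<le> schwartz_seminorm m n \<phi>"
    unfolding schwartz_seminorm_def
    by (rule cSUP_upper) (auto intro!: bdd_aboveI2 C)
  finally show ?thesis .
qed

lemma schwartz_norm_nonneg: "\<phi> \<in> schwartz \<Longrightarrow> 0 \<le> schwartz_norm N \<phi>"
  unfolding schwartz_norm_def by (intro sum_nonneg schwartz_seminorm_nonneg)

lemma schwartz_norm_mono:
  assumes "\<phi> \<in> schwartz" "M \<le> N"
  shows "schwartz_norm M \<phi> \<le> schwartz_norm N \<phi>"
proof -
  have "schwartz_norm M \<phi> \<le> (\<Sum>m\<le>M. \<Sum>n\<le>N. schwartz_seminorm m n \<phi>)"
    unfolding schwartz_norm_def using assms
    by (intro sum_mono sum_mono2) (auto intro: schwartz_seminorm_nonneg)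
  also have "\<dots> \<le> schwartz_norm N \<phi>"
    unfolding schwartz_norm_def using assms
    by (intro sum_mono2) (auto intro!: sum_nonneg schwartz_seminorm_nonneg)
  finally show ?thesis .
qed

lemma tempered_zero: "tempered (\<lambda>_. 0)"
  unfolding tempered_def by (auto intro!: exI[of _ "0::real"])

lemma tempered_add:
  assumes "tempered u" "tempered w"
  shows "tempered (\<lambda>\<phi>. u \<phi> + w \<phi>)"
proof -
  obtain M C where C: "\<And>\<phi>. \<phi> \<in> schwartz \<Longrightarrow> cmod (u \<phi>) \<le> C * schwartz_norm M \<phi>"
    using assms(1) unfolding tempered_def by blast
  obtain N D where D: "\<And>\<phi>. \<phi> \<in> schwartz \<Longrightarrow> cmod (w \<phi>) \<le> D * schwartz_norm N \<phi>"
    using assms(2) unfolding tempered_def by blast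
  have "cmod (u \<phi> + w \<phi>) \<le> (\<bar>C\<bar> + \<bar>D\<bar>) * schwartz_norm (max M N) \<phi>" if "\<phi> \<in> schwartz" for \<phi>
  proof -
    have "cmod (u \<phi>) \<le> \<bar>C\<bar> * schwartz_norm M \<phi>"
      using C[OF that] schwartz_norm_nonneg[OF that, of M]
      by (meson abs_ge_self mult_right_mono order_trans)
    also have "\<dots> \<le> \<bar>C\<bar> * schwartz_norm (max M N) \<phi>"
      by (intro mult_left_mono schwartz_norm_mono that) auto
    finally have 1: "cmod (u \<phi>) \<le> \<bar>C\<bar> * schwartz_norm (max M N) \<phi>" .
    have "cmod (w \<phi>) \<le> \<bar>D\<bar> * schwartz_norm N \<phi>"
      using D[OF that] schwartz_norm_nonneg[OF that, of N]
      by (meson abs_ge_self mult_right_mono order_trans)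
    also have "\<dots> \<le> \<bar>D\<bar> * schwartz_norm (max M N) \<phi>"
      by (intro mult_left_mono schwartz_norm_mono that) auto
    finally have 2: "cmod (w \<phi>) \<le> \<bar>D\<bar> * schwartz_norm (max M N) \<phi>" .
    show ?thesis
      using norm_triangle_ineq[of "u \<phi>" "w \<phi>"] 1 2 by (simp add: distrib_right)
  qed
  then have "\<exists>N C. \<forall>\<phi>\<in>schwartz. cmod (u \<phi> + w \<phi>) \<le> C * schwartz_norm N \<phi>" by blast
  then show ?thesis using assms unfolding tempered_def by (simp add: algebra_simps)
qed

lemma tempered_scale:
  assumes "tempered u"
  shows "tempered (\<lambda>\<phi>. c * u \<phi>)"
proof -
  obtain M C where C: "\<And>\<phi>. \<phi> \<in> schwartz \<Longrightarrow> cmod (u \<phi>) \<le> C * schwartz_norm M \<phi>"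
    using assms(1) unfolding tempered_def by blast
  have "\<forall>\<phi>\<in>schwartz. cmod (c * u \<phi>) \<le> (cmod c * C) * schwartz_norm M \<phi>"
    by (auto simp: norm_mult mult.assoc intro!: mult_left_mono C)
  then have "\<exists>N C. \<forall>\<phi>\<in>schwartz. cmod (c * u \<phi>) \<le> C * schwartz_norm N \<phi>" by blast
  then show ?thesis using assms unfolding tempered_def by (simp add: algebra_simps)
qed

typedef tdist = "{u. tempered u}"
  morphisms tdist_app Abs_tdist
  using tempered_zero by blast

lemma tempered_tdist_app [simp]: "tempered (tdist_app u)"
  using tdist_app by blast

instantiation tdist :: real_vector
begin

definition zero_tdist :: tdist where
  "0 = Abs_tdist (\<lambda>_. 0)"

definition plus_tdist :: "tdist \<Rightarrow> tdist \<Rightarrow> tdist" where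
  "u + w = Abs_tdist (\<lambda>\<phi>. tdist_app u \<phi> + tdist_app w \<phi>)"

definition scaleR_tdist :: "real \<Rightarrow> tdist \<Rightarrow> tdist" where
  "c *\<^sub>R u = Abs_tdist (\<lambda>\<phi>. complex_of_real c * tdist_app u \<phi>)"

definition uminus_tdist :: "tdist \<Rightarrow> tdist" where
  "- u = (-1) *\<^sub>R (u :: tdist)"

definition minus_tdist :: "tdist \<Rightarrow> tdist \<Rightarrow> tdist" where
  "u - w = u + - (w :: tdist)"

lemma tdist_app_zero: "tdist_app 0 \<phi> = 0"
  by (simp add: zero_tdist_def Abs_tdist_inverse tempered_zero)

lemma tdist_app_plus: "tdist_app (u + w) \<phi> = tdist_app u \<phi> + tdist_app w \<phi>"
  by (simp add: plus_tdist_def Abs_tdist_inverse tempered_add)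

lemma tdist_app_scaleR: "tdist_app (c *\<^sub>R u) \<phi> = complex_of_real c * tdist_app u \<phi>"
  by (simp add: scaleR_tdist_def Abs_tdist_inverse tempered_scale)

lemma tdist_eqI: "(\<And>\<phi>. tdist_app u \<phi> = tdist_app w \<phi>) \<Longrightarrow> u = w"
  by (metis ext tdist_app_inject)

instance
  by standard
    (auto intro!: tdist_eqI
      simp: tdist_app_zero tdist_app_plus tdist_app_scaleR uminus_tdist_def minus_tdist_def
        algebra_simps)

end

lemma nth_deriv_0 [simp]: "nth_deriv 0 f = f"
  by (simp add: nth_deriv_def)

lemma nth_deriv_Suc: "nth_deriv (Suc n) f = (\<lambda>x. vector_derivative (nth_deriv n f) (at x))"
  by (simp add: nth_deriv_def)

lemma nth_deriv_add:
  assumes "\<phi> \<in> schwartz" "\<psi> \<in> schwartz"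
  shows "nth_deriv n (\<lambda>x. \<phi> x + \<psi> x) = (\<lambda>x. nth_deriv n \<phi> x + nth_deriv n \<psi> x)"
proof (induction n)
  case (Suc n)
  show ?case
    unfolding nth_deriv_Suc Suc
    using assms by (intro ext vector_derivative_add_at) (auto simp: schwartz_def)
qed simp

lemma nth_deriv_cmult:
  assumes "\<phi> \<in> schwartz"
  shows "nth_deriv n (\<lambda>x. c * \<phi> x) = (\<lambda>x. c * nth_deriv n \<phi> x)"
proof (induction n)
  case (Suc n)
  have "vector_derivative (\<lambda>x. c * nth_deriv n \<phi> x) (at x) =
      c * vector_derivative (nth_deriv n \<phi>) (at x)" for x
    using assms
    by (intro vector_derivative_at has_vector_derivative_mult_right)
      (auto simp: schwartz_def vector_derivative_works[symmetric])
  then show ?case unfolding nth_deriv_Suc Suc by simp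
qed simp

lemma schwartz_add:
  assumes "\<phi> \<in> schwartz" "\<psi> \<in> schwartz"
  shows "(\<lambda>x. \<phi> x + \<psi> x) \<in> schwartz"
proof -
  have "\<exists>C. \<forall>x. \<bar>x\<bar> ^ m * cmod (nth_deriv n \<phi> x + nth_deriv n \<psi> x) \<le> C" for m n
  proof -
    obtain C where C: "\<And>x. \<bar>x\<bar> ^ m * cmod (nth_deriv n \<phi> x) \<le> C"
      using assms(1) unfolding schwartz_def by blast
    obtain D where D: "\<And>x. \<bar>x\<bar> ^ m * cmod (nth_deriv n \<psi> x) \<le> D"
      using assms(2) unfolding schwartz_def by blast
    have "\<bar>x\<bar> ^ m * cmod (nth_deriv n \<phi> x + nth_deriv n \<psi> x) \<le> C + D" for x
    proof -
      have "\<bar>x\<bar> ^ m * cmod (nth_deriv n \<phi> x + nth_deriv n \<psi> x)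
          \<le> \<bar>x\<bar> ^ m * (cmod (nth_deriv n \<phi> x) + cmod (nth_deriv n \<psi> x))"
        by (intro mult_left_mono norm_triangle_ineq) simp
      then show ?thesis using C[of x] D[of x] by (simp add: distrib_left)
    qed
    then show ?thesis by blast
  qed
  then show ?thesis
    using assms by (auto simp: schwartz_def nth_deriv_add[OF assms])
qed

lemma schwartz_cmult:
  assumes "\<phi> \<in> schwartz"
  shows "(\<lambda>x. c * \<phi> x) \<in> schwartz"
proof -
  have "\<exists>C. \<forall>x. \<bar>x\<bar> ^ m * cmod (c * nth_deriv n \<phi> x) \<le> C" for m n
  proof -
    obtain C where C: "\<And>x. \<bar>x\<bar> ^ m * cmod (nth_deriv n \<phi> x) \<le> C"
      using assms(1) unfolding schwartz_def by blast
    have "\<bar>x\<bar> ^ m * cmod (c * nth_deriv n \<phi> x) \<le> cmod c * C" for x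
      using mult_left_mono[OF C[of x], of "cmod c"] by (simp add: norm_mult mult_ac)
    then show ?thesis by blast
  qed
  then show ?thesis
    using assms by (auto simp: schwartz_def nth_deriv_cmult[OF assms])
qed

lemma schwartz_continuous: "\<phi> \<in> schwartz \<Longrightarrow> continuous_on UNIV \<phi>"
proof -
  assume "\<phi> \<in> schwartz"
  then have "nth_deriv 0 \<phi> differentiable (at x)" for x
    unfolding schwartz_def by blast
  then show ?thesis
    by (auto intro!: continuous_at_imp_continuous_on differentiable_imp_continuous_within)
qed

lemma integrable_inverse_1_plus_sq: "integrable lborel (\<lambda>x::real. inverse (1 + x\<^sup>2))"
proof -
  have nz: "1 + x\<^sup>2 \<noteq> 0" for x :: real
    by (metis add_pos_nonneg zero_le_power2 zero_less_one less_irrefl)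
  have "set_integrable lborel (einterval (-\<infinity>) \<infinity>) (\<lambda>x. inverse (1 + x\<^sup>2) :: real)"
  proof (rule interval_integral_FTC_nonneg[where F = arctan and A = "- (pi/2)" and B = "pi/2"])
    show "((arctan \<circ> real_of_ereal) \<longlongrightarrow> - (pi/2)) (at_right (- \<infinity>))"
      unfolding ereal_tendsto_simps using tendsto_arctan_at_bot by simp
    show "((arctan \<circ> real_of_ereal) \<longlongrightarrow> pi/2) (at_left \<infinity>)"
      unfolding ereal_tendsto_simps by (rule tendsto_arctan_at_top)
  qed (auto intro!: DERIV_arctan continuous_intros simp: nz)
  moreover have "einterval (-\<infinity>) \<infinity> = UNIV"
    by (auto simp: einterval_def)
  ultimately show ?thesis
    by (simp add: set_integrable_def)
qed

lemma schwartz_integrable: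
  assumes g: "g \<in> schwartz"
  shows "integrable lborel g"
proof -
  obtain C where C: "\<And>x. \<bar>x\<bar> ^ 0 * cmod (nth_deriv 0 g x) \<le> C"
    using g unfolding schwartz_def by blast
  obtain D where D: "\<And>x. \<bar>x\<bar> ^ 2 * cmod (nth_deriv 0 g x) \<le> D"
    using g unfolding schwartz_def by blast
  have b: "cmod (g x) \<le> norm ((C + D) * inverse (1 + x\<^sup>2))" for x
  proof -
    have "(1 + x\<^sup>2) * cmod (g x) \<le> C + D"
      using C[of x] D[of x] by (simp add: algebra_simps)
    then have "cmod (g x) \<le> (C + D) * inverse (1 + x\<^sup>2)"
      by (simp add: field_simps add_pos_nonneg)
    then show ?thesis by simp
  qed
  have "integrable lborel (\<lambda>x. (C + D) * inverse (1 + x\<^sup>2))"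
    by (rule integrable_mult_right) (rule integrable_inverse_1_plus_sq)
  then show ?thesis
    by (rule Bochner_Integration.integrable_bound)
      (use b schwartz_continuous[OF g] in \<open>auto intro: borel_measurable_continuous_onI\<close>)
qed

lemma schwartz_le_norm:
  assumes "\<phi> \<in> schwartz"
  shows "cmod (\<phi> x) \<le> schwartz_norm 0 \<phi>"
proof -
  obtain C where C: "\<And>x. \<bar>x\<bar> ^ 0 * cmod (nth_deriv 0 \<phi> x) \<le> C"
    using assms unfolding schwartz_def by blast
  have "\<bar>x\<bar> ^ 0 * cmod (nth_deriv 0 \<phi> x) \<le> schwartz_seminorm 0 0 \<phi>"
    unfolding schwartz_seminorm_def
    by (rule cSUP_upper) (auto intro!: bdd_aboveI2 C[simplified])
  then show ?thesis by (simp add: schwartz_norm_def)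
qed

lemma integrable_schwartz_mult:
  assumes g: "integrable lborel g" and \<phi>: "\<phi> \<in> schwartz"
  shows "integrable lborel (\<lambda>x. g x * \<phi> x)"
proof (rule Bochner_Integration.integrable_bound)
  show "integrable lborel (\<lambda>x. schwartz_norm 0 \<phi> * cmod (g x))"
    using g by (intro integrable_mult_right integrable_norm)
  show "(\<lambda>x. g x * \<phi> x) \<in> borel_measurable lborel"
    using g schwartz_continuous[OF \<phi>]
    by (intro borel_measurable_times) (auto intro: borel_measurable_continuous_onI)
  show "AE x in lborel. norm (g x * \<phi> x) \<le> norm (schwartz_norm 0 \<phi> * cmod (g x))"
    using schwartz_le_norm[OF \<phi>] schwartz_norm_nonneg[OF \<phi>, of 0]
    by (intro AE_I2) (simp add: norm_mult mult.commute[of "schwartz_norm 0 \<phi>"] mult_left_mono)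
qed

lemma tempered_integral:
  assumes g: "integrable lborel g"
  shows "tempered (\<lambda>\<phi>. if \<phi> \<in> schwartz then (LINT x|lborel. g x * \<phi> x) else 0)"
proof -
  have "cmod (LINT x|lborel. g x * \<phi> x) \<le> (LINT x|lborel. cmod (g x)) * schwartz_norm 0 \<phi>"
    if \<phi>: "\<phi> \<in> schwartz" for \<phi>
  proof -
    have "cmod (LINT x|lborel. g x * \<phi> x) \<le> (LINT x|lborel. cmod (g x) * schwartz_norm 0 \<phi>)"
    proof (rule Bochner_Integration.integral_norm_bound_integral)
      show "integrable lborel (\<lambda>x. g x * \<phi> x)"
        by (rule integrable_schwartz_mult[OF g \<phi>])
      show "integrable lborel (\<lambda>x. cmod (g x) * schwartz_norm 0 \<phi>)"
        using g by (intro integrable_mult_left integrable_norm)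
    qed (auto simp: norm_mult intro!: mult_left_mono schwartz_le_norm[OF \<phi>])
    then show ?thesis by simp
  qed
  then have "\<exists>N C. \<forall>\<phi>\<in>schwartz.
      cmod (if \<phi> \<in> schwartz then (LINT x|lborel. g x * \<phi> x) else 0) \<le> C * schwartz_norm N \<phi>"
    by (intro exI[of _ 0] exI[of _ "LINT x|lborel. cmod (g x)"]) simp
  moreover have "(LINT x|lborel. g x * (c * \<phi> x)) = c * (LINT x|lborel. g x * \<phi> x)" for c \<phi>
    by (subst integral_mult_right_zero[symmetric]) (simp add: mult_ac)
  ultimately show ?thesis
    unfolding tempered_def
    using integrable_schwartz_mult[OF g]
    by (simp add: schwartz_add schwartz_cmult distrib_left)
qed

definition fun_tdist :: "(real \<Rightarrow> complex) \<Rightarrow> tdist" where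
  "fun_tdist g = Abs_tdist (\<lambda>\<phi>. if \<phi> \<in> schwartz then (LINT x|lborel. g x * \<phi> x) else 0)"

lemma tdist_app_fun_tdist:
  assumes "g \<in> schwartz" "\<phi> \<in> schwartz"
  shows "tdist_app (fun_tdist g) \<phi> = (LINT x|lborel. g x * \<phi> x)"
  using assms
  by (simp add: fun_tdist_def Abs_tdist_inverse tempered_integral schwartz_integrable)

definition fourier :: "(real \<Rightarrow> complex) \<Rightarrow> real \<Rightarrow> complex" where
  "fourier f \<xi> = (LINT x|lborel. cis (- (x * \<xi>)) * f x) / complex_of_real (sqrt (2 * pi))"

text \<open>
  The Fourier transform of a tempered distribution \<open>u\<close> is the distribution
  \<open>\<phi> \<mapsto> u (fourier \<phi>)\<close>; here it is required to be given by the function \<open>f\<close>.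
\<close>

definition has_fourier :: "tdist \<Rightarrow> (real \<Rightarrow> complex) \<Rightarrow> bool" where
  "has_fourier u f \<longleftrightarrow> f \<in> borel_measurable lborel \<and>
     (\<forall>\<phi>\<in>schwartz. integrable lborel (\<lambda>\<xi>. f \<xi> * \<phi> \<xi>) \<and>
        tdist_app u (fourier \<phi>) = (LINT \<xi>|lborel. f \<xi> * \<phi> \<xi>))"

definition jap :: "real \<Rightarrow> real" where
  "jap \<xi> = (1 + \<xi>\<^sup>2) powr (1/2)"

definition conj_exp :: "real \<Rightarrow> real" where
  "conj_exp r = r / (r - 1)"

lemma conj_exp: "1 < r \<Longrightarrow> 1 / r + 1 / conj_exp r = 1"
  by (simp add: conj_exp_def field_simps)

definition hat_H :: "real \<Rightarrow> real \<Rightarrow> tdist set" where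
  "hat_H r s = {u. \<exists>f. has_fourier u f \<and>
     integrable lborel (\<lambda>\<xi>. (jap \<xi> powr s * cmod (f \<xi>)) powr conj_exp r)}"

text \<open>The function \<open>f\<close> is determined by \<open>u\<close> up to a null set, so the choice is immaterial.\<close>

definition hat_H_norm :: "real \<Rightarrow> real \<Rightarrow> tdist \<Rightarrow> real" where
  "hat_H_norm r s u =
     (LINT \<xi>|lborel. (jap \<xi> powr s * cmod ((SOME f. has_fourier u f) \<xi>)) powr conj_exp r)
       powr (1 / conj_exp r)"

definition hat_H_bounded :: "real \<Rightarrow> real \<Rightarrow> tdist set \<Rightarrow> bool" where
  "hat_H_bounded r s B \<longleftrightarrow> B \<subseteq> hat_H r s \<and> (\<exists>R. \<forall>u\<in>B. hat_H_norm r s u \<le> R)"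

text \<open>
  Curves on \<open>[0,T]\<close> are extended by zero to all times, so that equality of curves and the
  pointwise vector space operations are those on \<open>[0,T]\<close>.
\<close>

definition C_hat_H :: "real \<Rightarrow> real \<Rightarrow> real \<Rightarrow> (real \<Rightarrow> tdist) set" where
  "C_hat_H T r s = {u. (\<forall>t. t \<notin> {0..T} \<longrightarrow> u t = 0) \<and>
     (\<forall>t\<in>{0..T}. u t \<in> hat_H r s \<and>
        ((\<lambda>\<tau>. hat_H_norm r s (u \<tau> - u t)) \<longlongrightarrow> 0) (at t within {0..T}))}"

definition normed_curve_space :: "(real \<Rightarrow> tdist) set \<Rightarrow> ((real \<Rightarrow> tdist) \<Rightarrow> real) \<Rightarrow> bool" where
  "normed_curve_space X NX \<longleftrightarrow>
     (\<lambda>_. 0) \<in> X \<and>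
     (\<forall>u\<in>X. \<forall>w\<in>X. (\<lambda>t. u t + w t) \<in> X \<and> NX (\<lambda>t. u t + w t) \<le> NX u + NX w) \<and>
     (\<forall>c. \<forall>u\<in>X. (\<lambda>t. c *\<^sub>R u t) \<in> X \<and> NX (\<lambda>t. c *\<^sub>R u t) = \<bar>c\<bar> * NX u) \<and>
     (\<forall>u\<in>X. 0 \<le> NX u \<and> (NX u = 0 \<longleftrightarrow> u = (\<lambda>_. 0)))"

definition embedded_in_C ::
  "real \<Rightarrow> real \<Rightarrow> real \<Rightarrow> (real \<Rightarrow> tdist) set \<Rightarrow> ((real \<Rightarrow> tdist) \<Rightarrow> real) \<Rightarrow> bool" where
  "embedded_in_C T r s X NX \<longleftrightarrow> X \<subseteq> C_hat_H T r s \<and>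
     (\<exists>K. \<forall>u\<in>X. \<forall>t\<in>{0..T}. hat_H_norm r s (u t) \<le> K * NX u)"

definition nonlinearity ::
  "(nat \<Rightarrow> nat \<Rightarrow> real) \<Rightarrow> nat \<Rightarrow> (real \<Rightarrow> complex) \<Rightarrow> real \<Rightarrow> complex" where
  "nonlinearity a j w x =
     (\<Sum>k=1..j. \<Sum>l=0..2*(j-k)+1. complex_of_real (a k l) *
        (nth_deriv l (\<lambda>y. complex_of_real (cmod (w y) ^ (2*k))) x *
         nth_deriv (2*(j-k)+1-l) w x))"

text \<open>
  Classical solutions on \<open>[0,T]\<close>, written \<open>v t x\<close>, that are Schwartz functions of \<open>x\<close>
  uniformly in \<open>t\<close>. Time derivatives at the end points are one-sided.
\<close>

definition schwartz_solution ::
  "(nat \<Rightarrow> nat \<Rightarrow> real) \<Rightarrow> nat \<Rightarrow> real \<Rightarrow> (real \<Rightarrow> real \<Rightarrow> complex) \<Rightarrow> bool" where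
  "schwartz_solution a j T v \<longleftrightarrow>
     (\<forall>t\<in>{0..T}. v t \<in> schwartz) \<and>
     (\<forall>m n. \<exists>C. \<forall>t\<in>{0..T}. \<forall>x. \<bar>x\<bar> ^ m * cmod (nth_deriv n (v t) x) \<le> C) \<and>
     (\<exists>dv. \<forall>t\<in>{0..T}. \<forall>x.
        ((\<lambda>\<tau>. v \<tau> x) has_vector_derivative dv t x) (at t within {0..T}) \<and>
        dv t x + (-1) ^ (j+1) * nth_deriv (2*j+1) (v t) x + nonlinearity a j (v t) x = 0)"

text \<open>
  A data-to-solution map into \<open>X\<close>. For data in \<open>hat_H r s\<close> the nonlinearity has no
  meaning a priori, so the map is only required to attain its data and to agree with
  the classical solution whenever there is one (in particular \<open>X\<close> contains the classical
  solutions, as distribution-valued curves).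
\<close>

definition solution_map ::
  "(nat \<Rightarrow> nat \<Rightarrow> real) \<Rightarrow> nat \<Rightarrow> real \<Rightarrow> real \<Rightarrow> real \<Rightarrow> (real \<Rightarrow> tdist) set \<Rightarrow>
    (tdist \<Rightarrow> real \<Rightarrow> tdist) \<Rightarrow> bool" where
  "solution_map a j T r s X S \<longleftrightarrow>
     (\<forall>v0\<in>hat_H r s. S v0 \<in> X \<and> S v0 0 = v0) \<and>
     (\<forall>v. schwartz_solution a j T v \<longrightarrow>
        (\<forall>t\<in>{0..T}. S (fun_tdist (v 0)) t = fun_tdist (v t)))"

definition uniformly_continuous_into ::
  "real \<Rightarrow> real \<Rightarrow> ((real \<Rightarrow> tdist) \<Rightarrow> real) \<Rightarrow> tdist set \<Rightarrow> (tdist \<Rightarrow> real \<Rightarrow> tdist) \<Rightarrow> bool" where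
  "uniformly_continuous_into r s NX B S \<longleftrightarrow>
     (\<forall>\<epsilon>>0. \<exists>\<delta>>0. \<forall>v0\<in>B. \<forall>w0\<in>B.
        hat_H_norm r s (v0 - w0) < \<delta> \<longrightarrow> NX (\<lambda>t. S v0 t - S w0 t) < \<epsilon>)"

end

theory Submission
  imports Defs "HOL-Computational_Algebra.Polynomial" "HOL-Probability.Levy"
begin

text \<open>
  The coefficients are chosen such that, for every scale \<open>w > 0\<close> and every \<open>M\<close>, the modulated pulse
  \<open>w e\<^bsup>i(wMx + \<theta>t)\<^esup> sech (w (x - c t))\<close> solves the equation, where up to sign
  \<open>c = w\<^bsup>2j\<^esup> Re (1 + iM)\<^bsup>2j+1\<^esup>\<close> and \<open>\<theta> = w\<^bsup>2j+1\<^esup> Im (1 + iM)\<^bsup>2j+1\<^esup>\<close>. Its Fourier transform is a bump of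
  height \<open>1\<close> and width \<open>w\<close> around \<open>N = wM\<close>, so for \<open>w = N\<^bsup>-\<sigma>\<^esup>\<close> with \<open>\<sigma> = s r'\<close> the norm stays bounded as
  \<open>N \<rightarrow> \<infinity>\<close>; here \<open>-1 < \<sigma>\<close> makes \<open>M = N\<^bsup>1+\<sigma>\<^esup>\<close> tend to infinity. Replacing \<open>M\<close> by \<open>M + \<epsilon>\<close> changes
  the datum by \<open>O(\<epsilon>)\<close>. At time \<open>T\<close>, however, the transforms of the two pulses carry a relative phase
  that is linear in \<open>\<xi>/w\<close> with slope of size at least \<open>T \<epsilon> w\<^bsup>2j+1\<^esup> M\<^bsup>2j-1\<^esup> = T \<epsilon> N\<^bsup>2j-1-2\<sigma>\<^esup>\<close>. This is unbounded
  because \<open>\<sigma> < (2j-1)/2\<close>, and then the distance at time \<open>T\<close> stays bounded below, uniformly in \<open>\<epsilon>\<close>.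
\<close>

section \<open>The algebraic identity behind the solitons\<close>

text \<open>One set of real coefficients has to serve every M and every w at once, so the soliton
  equation is settled as an identity between polynomials in p and \<lambda>. The scale drops out
  because a term of index k contributes 2k powers of w through the modulus and 2(j-k)+1 through
  derivatives. Dividing the linear term by the pulse leaves a polynomial of weight 2j+1. A drifting,
  rotating pulse can balance exactly its remainder A + B p modulo 1 - p^2: A gives the frequency, B
  the speed. The rest is a multiple of 1 - p^2 that the nonlinear terms must cancel. Those of index
  k carry the factor (1 - p^2)^k, so k = 1, ..., j are used up one after the other: the coefficients
  of index k match the quotient at p = 1, parity matches it at p = -1, and the next quotient has
  weight lower by two. Coefficients are never computed; A and B are known from p = 1 and p = -1,
  where d/dy vanishes.\<close>

text \<open>
  Polynomials in \<open>p\<close> (outer variable) and \<open>\<lambda>\<close> (inner variable) are read with \<open>p = - tanh y\<close> and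
  \<open>\<lambda> = iM\<close>. Then \<open>sech_sq\<close> is \<open>sech\<^sup>2 y\<close>, \<open>sech_deriv\<close> is \<open>d/dy\<close>, and \<open>carrier_deriv\<close> is the operator
  \<open>F \<mapsto> sech\<^bsup>-1\<^esup> (d/dy + \<lambda>) (F sech)\<close>, so that \<open>(d/dy)\<^sup>n (e\<^bsup>\<lambda>y\<^esup> sech y) = e\<^bsup>\<lambda>y\<^esup> sech y \<sqdot> carrier_poly n\<close>.
\<close>

definition sech_sq :: "complex poly poly" where
  "sech_sq = [:1, 0, -1:]"

definition sech_deriv :: "complex poly poly \<Rightarrow> complex poly poly" where
  "sech_deriv F = - (sech_sq * pderiv F)"

definition carrier_deriv :: "complex poly poly \<Rightarrow> complex poly poly" where
  "carrier_deriv F = [:[:0, 1:], 1:] * F + sech_deriv F"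

definition carrier_poly :: "nat \<Rightarrow> complex poly poly" where
  "carrier_poly n = (carrier_deriv ^^ n) 1"

text \<open>
  The parity condition is what lets a weighted polynomial that vanishes at \<open>p = 1\<close> vanish at
  \<open>p = -1\<close> as well, hence be divisible by \<open>1 - p\<^sup>2\<close>. Weights are integers so that weight \<open>-1\<close> forces
  the zero polynomial, which ends the expansion below.
\<close>

definition weighted :: "int \<Rightarrow> complex poly poly \<Rightarrow> bool" where
  "weighted d F \<longleftrightarrow> (\<forall>i n. coeff (coeff F i) n \<in> \<real> \<and>
     (coeff (coeff F i) n \<noteq> 0 \<longrightarrow> int i + int n \<le> d \<and> even (d + int i + int n)))"

section \<open>Arithmetic of weights\<close>

lemma weightedD:
  assumes "weighted d F" "coeff (coeff F i) n \<noteq> 0"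
  shows "int i + int n \<le> d" "even (d + int i + int n)"
  using assms unfolding weighted_def by auto

lemma weighted_0 [simp]: "weighted d 0"
  by (simp add: weighted_def)

lemma weighted_add: "weighted d F \<Longrightarrow> weighted d H \<Longrightarrow> weighted d (F + H)"
  unfolding weighted_def by (metis (no_types, lifting) Reals_add add_0 coeff_add)

lemma weighted_uminus: "weighted d F \<Longrightarrow> weighted d (- F)"
  unfolding weighted_def by simp

lemma weighted_diff: "weighted d F \<Longrightarrow> weighted d H \<Longrightarrow> weighted d (F - H)"
  using weighted_add[of d F "- H"] weighted_uminus[of d H] by simp

lemma weighted_sum: "(\<And>x. x \<in> I \<Longrightarrow> weighted d (F x)) \<Longrightarrow> weighted d (sum F I)"
  by (induction I rule: infinite_finite_induct) (auto intro: weighted_add)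

lemma weighted_mult:
  assumes "weighted d F" "weighted e H"
  shows "weighted (d + e) (F * H)"
  unfolding weighted_def
proof (intro allI conjI impI)
  fix i n
  have c: "coeff (coeff (F * H) i) n =
      (\<Sum>a\<le>i. \<Sum>b\<le>n. coeff (coeff F a) b * coeff (coeff H (i - a)) (n - b))"
    by (simp add: coeff_mult coeff_sum)
  show "coeff (coeff (F * H) i) n \<in> \<real>"
    unfolding c using assms by (auto simp: weighted_def intro!: sum_in_Reals Reals_mult)
  assume "coeff (coeff (F * H) i) n \<noteq> 0"
  then obtain a where a: "a \<in> {..i}"
    "(\<Sum>b\<le>n. coeff (coeff F a) b * coeff (coeff H (i - a)) (n - b)) \<noteq> 0"
    unfolding c by (rule sum.not_neutral_contains_not_neutral)
  from a(2) obtain b where b: "b \<in> {..n}" "coeff (coeff F a) b * coeff (coeff H (i - a)) (n - b) \<noteq> 0"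
    by (rule sum.not_neutral_contains_not_neutral)
  from b(2) have w: "int a + int b \<le> d" "even (d + int a + int b)"
    "int (i - a) + int (n - b) \<le> e" "even (e + int (i - a) + int (n - b))"
    using weightedD[OF assms(1), of a b] weightedD[OF assms(2), of "i - a" "n - b"] by auto
  have eq: "d + e + int i + int n = (d + int a + int b) + (e + int (i - a) + int (n - b))"
    "int i + int n = (int a + int b) + (int (i - a) + int (n - b))"
    using a b by auto
  show "int i + int n \<le> d + e"
    unfolding eq(2) using w by linarith
  show "even (d + e + int i + int n)"
    unfolding eq(1) using w(2,4) by (rule dvd_add)
qed

lemma weighted_pderiv:
  assumes "weighted d F"
  shows "weighted (d - 1) (pderiv F)"
  unfolding weighted_def
proof (intro allI conjI impI)
  fix i n
  have c: "coeff (coeff (pderiv F) i) n = of_nat (Suc i) * coeff (coeff F (Suc i)) n"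
    by (simp add: coeff_pderiv of_nat_poly flip: of_nat_Suc)
  show "coeff (coeff (pderiv F) i) n \<in> \<real>"
    unfolding c using assms by (auto simp: weighted_def intro!: Reals_mult)
  assume "coeff (coeff (pderiv F) i) n \<noteq> 0"
  then have "coeff (coeff F (Suc i)) n \<noteq> 0"
    unfolding c by auto
  then have "int (Suc i) + int n \<le> d \<and> even (d + int (Suc i) + int n)"
    using assms unfolding weighted_def by blast
  then show "int i + int n \<le> d - 1" "even (d - 1 + int i + int n)"
    by auto
qed

lemma weighted_smult: "weighted d F \<Longrightarrow> c \<in> \<real> \<Longrightarrow> weighted d (smult [:c:] F)"
  unfolding weighted_def by (auto simp: Reals_mult)

lemma weighted_1: "weighted 0 1"
  unfolding weighted_def by (auto simp: coeff_1 split: if_splits)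

lemma weighted_sech_sq: "weighted 2 sech_sq"
  unfolding weighted_def sech_sq_def
  by (auto simp: coeff_pCons coeff_1 split: nat.splits if_splits)

lemma weighted_linear: "weighted 1 [:[:0, 1:], 1:]"
  unfolding weighted_def
  by (auto simp: coeff_pCons coeff_1 split: nat.splits if_splits)

lemma weighted_X: "c \<in> \<real> \<Longrightarrow> weighted 1 [:0, [:c:]:]"
  unfolding weighted_def
  by (auto simp: coeff_pCons coeff_1 split: nat.splits if_splits)

lemma weighted_sech_deriv: "weighted d F \<Longrightarrow> weighted (d + 1) (sech_deriv F)"
  using weighted_uminus[OF weighted_mult[OF weighted_sech_sq weighted_pderiv[of d F]]]
  by (simp add: sech_deriv_def add.commute)

lemma weighted_carrier_deriv: "weighted d F \<Longrightarrow> weighted (d + 1) (carrier_deriv F)"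
  unfolding carrier_deriv_def
  using weighted_mult[OF weighted_linear, of d F] weighted_sech_deriv[of d F]
  by (intro weighted_add) (simp_all add: add.commute[of d] del: mult_pCons_left)

lemma carrier_poly_Suc: "carrier_poly (Suc n) = carrier_deriv (carrier_poly n)"
  by (simp add: carrier_poly_def)

lemma carrier_poly_0: "carrier_poly 0 = 1"
  by (simp add: carrier_poly_def)

lemma weighted_carrier_poly: "weighted (int n) (carrier_poly n)"
  by (induction n)
    (auto simp: carrier_poly_0 carrier_poly_Suc weighted_1 add.commute
      dest: weighted_carrier_deriv)

section \<open>Values at p = 1 and p = -1, and division by 1 - p^2\<close>

lemma poly_sech_sq [simp]: "poly sech_sq 1 = 0" "poly sech_sq (-1) = 0"
  by (simp_all add: sech_sq_def)

lemma poly_sech_deriv [simp]: "poly (sech_deriv F) 1 = 0" "poly (sech_deriv F) (-1) = 0"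
  by (simp_all add: sech_deriv_def)

text \<open>The factor 1 - p^2 kills \<open>sech_deriv\<close> at both points, so each application
  of \<open>carrier_deriv\<close> multiplies by \<lambda> + 1 or \<lambda> - 1. In terms of y these
  are the exponential rates of the pulse as y tends to -\<infinity> and to +\<infinity>.\<close>

lemma poly_carrier_poly:
  "poly (carrier_poly n) 1 = [:1, 1:] ^ n" "poly (carrier_poly n) (-1) = [:-1, 1:] ^ n"
  by (induction n)
    (simp_all add: carrier_poly_0 carrier_poly_Suc carrier_deriv_def pCons_one)

text \<open>No derivative loses the factor sech^(2K), because d/dy sech^(2K) = 2K p sech^(2K). The
  value (2K)^l at p = 1 reflects that for y near -\<infinity> the function sech^(2K) behaves like a
  multiple of exp (2Ky).\<close>

lemma sech_deriv_power:
  "\<exists>Q. (sech_deriv ^^ l) (sech_sq ^ K) = sech_sq ^ K * Q \<and> weighted (int l) Q \<and>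
     poly Q 1 = [:of_nat (2 * K) ^ l:]"
proof (induction l)
  case 0
  show ?case by (rule exI[of _ 1]) (simp add: weighted_1 pCons_one)
next
  case (Suc l)
  then obtain Q where Q: "(sech_deriv ^^ l) (sech_sq ^ K) = sech_sq ^ K * Q"
    "weighted (int l) Q" "poly Q 1 = [:of_nat (2 * K) ^ l:]" by blast
  define Q' where "Q' = [:0, [:of_nat (2 * K):]:] * Q + sech_deriv Q"
  have 1: "sech_sq * pderiv (sech_sq ^ K) = - ([:0, [:of_nat (2 * K):]:] * sech_sq ^ K)"
  proof (cases K)
    case (Suc k)
    have "pderiv sech_sq = [:0, [:-2:]:]"
      by (simp add: sech_sq_def pderiv_pCons numeral_poly)
    then have "sech_sq * pderiv (sech_sq ^ K) = smult (of_nat K) (sech_sq ^ K * [:0, [:-2:]:])"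
      by (simp add: Suc pderiv_power_Suc del: of_nat_Suc power_Suc)
        (simp add: mult_ac)
    also have "\<dots> = smult (- [:of_nat K * 2:]) (pCons 0 (sech_sq ^ K))"
      by (simp add: of_nat_poly mult_ac)
    also have "\<dots> = - ([:0, [:of_nat (2 * K):]:] * sech_sq ^ K)"
      unfolding smult_minus_left by (simp add: mult_ac)
    finally show ?thesis .
  qed simp
  have "(sech_deriv ^^ Suc l) (sech_sq ^ K) =
      - (sech_sq * pderiv (sech_sq ^ K)) * Q + sech_sq ^ K * sech_deriv Q"
    by (simp add: Q sech_deriv_def pderiv_mult algebra_simps)
  also have "\<dots> = sech_sq ^ K * Q'"
    unfolding 1 Q'_def by (simp add: algebra_simps)
  finally have "(sech_deriv ^^ Suc l) (sech_sq ^ K) = sech_sq ^ K * Q'" .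
  moreover have "weighted (int (Suc l)) Q'"
    unfolding Q'_def
    using weighted_mult[OF weighted_X Q(2), of "of_nat (2 * K)"] weighted_sech_deriv[OF Q(2)]
    by (intro weighted_add) (simp_all add: add.commute del: mult_pCons_left)
  moreover have "poly Q' 1 = [:of_nat (2 * K) ^ Suc l:]"
    by (simp add: Q'_def Q)
  ultimately show ?case by blast
qed

lemma weighted_div_sech_sq:
  assumes "weighted d (sech_sq * H)"
  shows "weighted (d - 2) H"
proof (rule ccontr)
  define bad where "bad = (\<lambda>i n. \<not> (coeff (coeff H i) n \<in> \<real> \<and>
     (coeff (coeff H i) n \<noteq> 0 \<longrightarrow> int i + int n \<le> d - 2 \<and> even (d - 2 + int i + int n))))"
  assume "\<not> weighted (d - 2) H"
  then obtain i n where "bad i n"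
    unfolding weighted_def bad_def by blast
  \<comment> \<open>A bad coefficient of \<open>H\<close> propagates to ever higher powers of \<open>p\<close>.\<close>
  have step: "bad (i + 2) n" if "bad i n" for i
  proof (rule ccontr)
    assume nb: "\<not> bad (i + 2) n"
    have c: "coeff (coeff H i) n = coeff (coeff H (i + 2)) n - coeff (coeff (sech_sq * H) (i + 2)) n"
      by (simp add: sech_sq_def)
    have "coeff (coeff (sech_sq * H) (i + 2)) n \<in> \<real> \<and>
       (coeff (coeff (sech_sq * H) (i + 2)) n \<noteq> 0 \<longrightarrow>
         int (i + 2) + int n \<le> d \<and> even (d + int (i + 2) + int n))"
      using assms unfolding weighted_def by blast
    with nb have "\<not> bad i n"
      unfolding bad_def c
      by (cases "coeff (coeff H (i + 2)) n = 0") (auto simp: Reals_diff)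
    with that show False by simp
  qed
  have "bad (i + 2 * k) n" for k
    by (induction k) (use \<open>bad i n\<close> step[of "i + 2 * _"] in \<open>auto simp: algebra_simps\<close>)
  \<comment> \<open>Beyond the degree of \<open>H\<close> every coefficient is 0, and 0 is never
    bad.\<close>
  then have "bad (i + 2 * Suc (degree H)) n" .
  then show False
    unfolding bad_def by (simp add: coeff_eq_0)
qed

lemma sech_sq_dvd:
  assumes "poly F 1 = 0" "poly F (-1) = 0"
  shows "sech_sq dvd F"
proof -
  obtain H where H: "F = [:-1, 1:] * H"
    using assms(1) by (metis dvdE poly_eq_0_iff_dvd)
  have "poly H (-1) = 0"
    using assms(2) unfolding H by (auto simp: one_pCons)
  then obtain H' where H': "H = [:1, 1:] * H'"
    by (metis add.inverse_inverse dvdE poly_eq_0_iff_dvd)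
  have "F = sech_sq * (- H')"
    unfolding H H' sech_sq_def by simp
  then show ?thesis by simp
qed

text \<open>The powers of p that accompany a fixed power n of \<lambda> all have the parity of d +
  n. Replacing p = 1 by p = -1 therefore changes each coefficient in \<lambda> by a single
  sign.\<close>

lemma weighted_poly_minus_one:
  assumes "weighted d F" "poly F 1 = 0"
  shows "poly F (-1) = 0"
proof (rule poly_eqI)
  fix n
  have "coeff (poly F (-1)) n = (\<Sum>i\<le>degree F. coeff (coeff F i) n * (-1) ^ i)"
    by (simp add: poly_altdef coeff_sum flip: of_int_minus)
       (rule sum.cong; simp add: minus_one_power_iff)
  also have "\<dots> = (\<Sum>i\<le>degree F. coeff (coeff F i) n * (if even (d + int n) then 1 else -1))"
  proof (rule sum.cong)
    fix i
    show "coeff (coeff F i) n * (-1) ^ i = coeff (coeff F i) n * (if even (d + int n) then 1 else -1)"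
      using weightedD(2)[OF assms(1), of i n]
      by (cases "coeff (coeff F i) n = 0") (auto simp: minus_one_power_iff)
  qed simp
  also have "\<dots> = coeff (poly F 1) n * (if even (d + int n) then 1 else -1)"
    by (simp add: poly_altdef coeff_sum sum_distrib_right)
  finally show "coeff (poly F (-1)) n = coeff 0 n"
    by (simp add: assms)
qed

text \<open>The powers of 1 + \<lambda> are monic, one for each degree, so leading terms can be
  removed one by one. The exponent is m - l because these powers will be the values at p = 1 of
  \<open>carrier_poly (m - l)\<close>, the derivatives left over when l of them fall on the
  modulus.\<close>

lemma real_poly_expand:
  assumes "\<And>n. coeff h n \<in> \<real>" "\<And>n. n > m \<Longrightarrow> coeff h n = 0"
  shows "\<exists>b :: nat \<Rightarrow> real. h = (\<Sum>l\<le>m. smult (of_real (b l)) ([:1, 1::complex:] ^ (m - l)))"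
  using assms
proof (induction m arbitrary: h)
  case 0
  have "h = [:coeff h 0:]"
    by (rule poly_eqI) (use 0 in \<open>auto simp: coeff_pCons split: nat.splits\<close>)
  moreover obtain c where "coeff h 0 = of_real c"
    using 0 by (metis Reals_cases)
  ultimately have "h = smult (of_real c) 1" by simp
  then show ?case by (intro exI[of _ "\<lambda>_. c"]) simp
next
  case (Suc m)
  obtain c where c: "coeff h (Suc m) = of_real c"
    using Suc.prems by (metis Reals_cases)
  define h' where "h' = h - smult (of_real c) ([:1, 1:] ^ Suc m)"
  have r: "coeff ([:1, 1::complex:] ^ k) n \<in> \<real>" for k n
    by (induction k arbitrary: n) (auto simp: coeff_1 coeff_pCons split: nat.splits intro!: Reals_add)
  have deg: "degree ([:1, 1::complex:] ^ Suc m) = Suc m"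
    by (simp add: degree_power_eq del: power_Suc)
  have lc: "coeff ([:1, 1::complex:] ^ Suc m) (Suc m) = 1"
    using lead_coeff_power[of "[:1, 1::complex:]" "Suc m"] unfolding deg by simp
  have "coeff h' n \<in> \<real>" for n
    unfolding h'_def coeff_diff coeff_smult
    using Suc.prems r by (intro Reals_diff Reals_mult) (auto simp del: power_Suc)
  moreover have "coeff h' n = 0" if "n > m" for n
  proof (cases "n = Suc m")
    case True
    then show ?thesis using lc c by (simp add: h'_def del: power_Suc)
  next
    case False
    then have "n > Suc m" using that by simp
    then have "coeff ([:1, 1::complex:] ^ Suc m) n = 0" "coeff h n = 0"
      using deg Suc.prems by (auto intro!: coeff_eq_0 simp del: power_Suc)
    then show ?thesis by (simp add: h'_def del: power_Suc)
  qed
  ultimately obtain b where b: "h' = (\<Sum>l\<le>m. smult (of_real (b l)) ([:1, 1:] ^ (m - l)))"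
    using Suc.IH by blast
  have "h = smult (of_real c) ([:1, 1:] ^ Suc m) + h'"
    by (simp add: h'_def)
  also have "\<dots> = (\<Sum>l\<le>Suc m. smult (of_real (case l of 0 \<Rightarrow> c | Suc l \<Rightarrow> b l)) ([:1, 1:] ^ (Suc m - l)))"
    unfolding b by (subst sum.atMost_Suc_shift) (simp del: power_Suc)
  finally show ?case by blast
qed

text \<open>The numbers \<open>b l\<close> make both sides agree at p = 1 once
  \<open>sech_sq ^ K\<close> is cancelled. By parity the difference vanishes at p = -1 too, so it
  yields one more factor \<open>sech_sq\<close>. The condition on \<open>K\<close> makes the values
  (2K)^l invertible.\<close>

lemma weighted_expand_step:
  assumes H: "weighted (int m) H" and K: "K \<ge> 1"
  shows "\<exists>(b :: nat \<Rightarrow> real) H'. weighted (int m - 2) H' \<and>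
    sech_sq ^ K * H = (\<Sum>l\<le>m. smult [:of_real (b l):]
      ((sech_deriv ^^ l) (sech_sq ^ K) * carrier_poly (m - l))) + sech_sq ^ Suc K * H'"
proof -
  obtain Q where Q: "(sech_deriv ^^ l) (sech_sq ^ K) = sech_sq ^ K * Q l" "weighted (int l) (Q l)"
     "poly (Q l) 1 = [:of_nat (2 * K) ^ l:]" for l
    using sech_deriv_power[of _ K] by (metis (no_types))
  have h: "coeff (poly H 1) n = (\<Sum>i\<le>degree H. coeff (coeff H i) n)" for n
    by (simp add: poly_altdef coeff_sum)
  have "coeff (poly H 1) n \<in> \<real>" for n
    unfolding h using H by (auto simp: weighted_def)
  moreover have "coeff (poly H 1) n = 0" if "n > m" for n
    unfolding h using weightedD(1)[OF H, of _ n] that by (intro sum.neutral ballI) fastforce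
  ultimately obtain c where c: "poly H 1 = (\<Sum>l\<le>m. smult (of_real (c l)) ([:1, 1::complex:] ^ (m - l)))"
    using real_poly_expand by metis
  \<comment> \<open>At \<open>p = 1\<close> the \<open>l\<close>-th term of the expansion is \<open>b l (2K)\<^sup>l (1 + \<lambda>)\<^bsup>m-l\<^esup>\<close>.\<close>
  define b where "b l = c l / real (2 * K) ^ l" for l
  define R where "R = H - (\<Sum>l\<le>m. smult [:of_real (b l):] (Q l * carrier_poly (m - l)))"
  have wR: "weighted (int m) R"
    unfolding R_def
  proof (intro weighted_diff H weighted_sum weighted_smult)
    fix l assume "l \<in> {..m}"
    then show "weighted (int m) (Q l * carrier_poly (m - l))"
      using weighted_mult[OF Q(2) weighted_carrier_poly, of l "m - l"] by simp
  qed simp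
  have "poly R 1 = 0"
  proof -
    have "of_real (b l) * of_nat (2 * K) ^ l = (of_real (c l) :: complex)" for l
      using K by (simp add: b_def)
    then show ?thesis
      by (simp add: R_def poly_sum Q poly_carrier_poly c mult.commute del: of_nat_mult)
  qed
  then obtain H' where H': "R = sech_sq * H'"
    using sech_sq_dvd weighted_poly_minus_one wR by (metis dvdE)
  have "weighted (int m - 2) H'"
    using wR unfolding H' by (rule weighted_div_sech_sq)
  moreover have "sech_sq ^ K * H = (\<Sum>l\<le>m. smult [:of_real (b l):]
      ((sech_deriv ^^ l) (sech_sq ^ K) * carrier_poly (m - l))) + sech_sq ^ K * R"
    by (simp add: R_def Q right_diff_distrib sum_distrib_left mult.assoc)
  moreover have "sech_sq ^ K * R = sech_sq ^ Suc K * H'"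
    by (simp add: H')
  ultimately have "weighted (int m - 2) H' \<and>
    sech_sq ^ K * H = (\<Sum>l\<le>m. smult [:of_real (b l):]
      ((sech_deriv ^^ l) (sech_sq ^ K) * carrier_poly (m - l))) + sech_sq ^ Suc K * H'"
    by (simp only:)
  then show ?thesis by blast
qed

text \<open>One stage for each k. The quotient loses weight two each time, just as 2(j-k)+1 does, so
  the derivatives allowed in the equation suffice at every stage. At k = j + 1 the weight is -1 and
  nothing is left.\<close>

lemma weighted_expand:
  assumes "weighted (2 * (int j - int k) + 1) H" "1 \<le> k" "k \<le> Suc j"
  shows "\<exists>a :: nat \<Rightarrow> nat \<Rightarrow> real. sech_sq ^ k * H =
    (\<Sum>k=k..j. \<Sum>l=0..2*(j-k)+1. smult [:of_real (a k l):]
      ((sech_deriv ^^ l) (sech_sq ^ k) * carrier_poly (2*(j-k)+1-l)))"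
  using assms(3,1,2)
proof (induction k arbitrary: H rule: inc_induct)
  case base
  have "coeff (coeff H i) n = 0" for i n
    using weightedD(1)[OF base(1), of i n] by fastforce
  then have "H = 0"
    by (intro poly_eqI) simp
  then show ?case by simp
next
  case (step k)
  define m where "m = 2 * (j - k) + 1"
  have m: "int m = 2 * (int j - int k) + 1"
    using step by (simp add: m_def)
  obtain b H' where b: "weighted (int m - 2) H'" "sech_sq ^ k * H = (\<Sum>l\<le>m. smult [:of_real (b l):]
      ((sech_deriv ^^ l) (sech_sq ^ k) * carrier_poly (m - l))) + sech_sq ^ Suc k * H'"
    using weighted_expand_step[of m H k] step.prems m by auto
  have "weighted (2 * (int j - int (Suc k)) + 1) H'"
    using b(1) m by (simp add: algebra_simps)
  then obtain a :: "nat \<Rightarrow> nat \<Rightarrow> real" where a: "sech_sq ^ Suc k * H' =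
    (\<Sum>k=Suc k..j. \<Sum>l=0..2*(j-k)+1. smult [:of_real (a k l):]
      ((sech_deriv ^^ l) (sech_sq ^ k) * carrier_poly (2*(j-k)+1-l)))"
    using step.IH[of H'] by auto
  define a' where "a' = a(k := b)"
  have "(\<Sum>k=k..j. \<Sum>l=0..2*(j-k)+1. smult [:of_real (a' k l):]
      ((sech_deriv ^^ l) (sech_sq ^ k) * carrier_poly (2*(j-k)+1-l))) =
      (\<Sum>l=0..2*(j-k)+1. smult [:of_real (a' k l):]
      ((sech_deriv ^^ l) (sech_sq ^ k) * carrier_poly (2*(j-k)+1-l))) +
     (\<Sum>k=Suc k..j. \<Sum>l=0..2*(j-k)+1. smult [:of_real (a' k l):]
      ((sech_deriv ^^ l) (sech_sq ^ k) * carrier_poly (2*(j-k)+1-l)))"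
    using step.hyps by (intro sum.atLeast_Suc_atMost) simp
  also have "(\<Sum>l=0..2*(j-k)+1. smult [:of_real (a' k l):]
      ((sech_deriv ^^ l) (sech_sq ^ k) * carrier_poly (2*(j-k)+1-l))) =
      (\<Sum>l\<le>m. smult [:of_real (b l):]
      ((sech_deriv ^^ l) (sech_sq ^ k) * carrier_poly (m - l)))"
    by (simp add: a'_def m_def atMost_atLeast0)
  also have "(\<Sum>k=Suc k..j. \<Sum>l=0..2*(j-k)+1. smult [:of_real (a' k l):]
      ((sech_deriv ^^ l) (sech_sq ^ k) * carrier_poly (2*(j-k)+1-l))) = sech_sq ^ Suc k * H'"
    unfolding a by (intro sum.cong refl) (auto simp: a'_def)
  finally show ?case using b(2) by (intro exI[of _ a']) simp
qed

text \<open>Modulo 1 - p^2 an even power of p is 1 and an odd power is p, so \<open>A\<close> and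
  \<open>B\<close> collect the even and the odd coefficients.\<close>

lemma weighted_mod_sech_sq:
  assumes F: "weighted d F"
  shows "\<exists>A B H. F = [:A, B:] + sech_sq * H \<and> weighted (d - 2) H"
proof -
  define A where "A = (\<Sum>i\<in>{i. i \<le> degree F \<and> even i}. coeff F i)"
  define B where "B = (\<Sum>i\<in>{i. i \<le> degree F \<and> odd i}. coeff F i)"
  have spl: "(\<Sum>i\<le>degree F. f i) = (\<Sum>i\<in>{i. i \<le> degree F \<and> even i}. f i) +
      (\<Sum>i\<in>{i. i \<le> degree F \<and> odd i}. f i)" for f :: "nat \<Rightarrow> complex poly"
    by (subst sum.union_disjoint[symmetric]) (auto intro!: sum.cong)
  define R where "R = F - [:A, B:]"
  have "poly R 1 = 0"
    by (simp add: R_def A_def B_def poly_altdef[of F] spl)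
  moreover have "poly R (-1) = 0"
    by (simp add: R_def A_def B_def poly_altdef[of F] spl minus_one_power_iff sum_negf)
  ultimately obtain H where H: "R = sech_sq * H"
    using sech_sq_dvd by (metis dvdE)
  \<comment> \<open>Lowering a power of p by an even number keeps the parity and does not raise the
    weight. Hence the remainder is weighted, and with it the multiple of
    \<open>sech_sq\<close>.\<close>
  have "weighted d [:A, B:]"
    unfolding weighted_def
  proof (intro allI)
    fix i n :: nat
    have FR: "coeff (coeff F i) n \<in> \<real>" for i
      using F by (simp add: weighted_def)
    consider "i = 0" | "i = 1" | "i > 1" by linarith
    then show "coeff (coeff [:A, B:] i) n \<in> \<real> \<and> (coeff (coeff [:A, B:] i) n \<noteq> 0 \<longrightarrow>
        int i + int n \<le> d \<and> even (d + int i + int n))"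
    proof cases
      case 1
      have "\<exists>i. coeff (coeff F i) n \<noteq> 0 \<and> even i" if "coeff A n \<noteq> 0"
        using that unfolding A_def coeff_sum
        by (elim sum.not_neutral_contains_not_neutral) auto
      then have "coeff A n \<noteq> 0 \<Longrightarrow> int n \<le> d \<and> even (d + int n)"
        using F unfolding weighted_def by fastforce
      moreover have "coeff A n \<in> \<real>"
        using FR by (simp add: A_def coeff_sum)
      ultimately show ?thesis using 1 by simp
    next
      case 2
      have "\<exists>i. coeff (coeff F i) n \<noteq> 0 \<and> odd i" if "coeff B n \<noteq> 0"
        using that unfolding B_def coeff_sum
        by (elim sum.not_neutral_contains_not_neutral) auto
      moreover have "1 + int n \<le> d \<and> even (d + 1 + int n)" if "coeff (coeff F i) n \<noteq> 0" "odd i" for i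
      proof -
        have "int i + int n \<le> d" "even (d + int i + int n)"
          using F that unfolding weighted_def by auto
        moreover have "i \<ge> 1" using that(2) by (cases i) auto
        ultimately show ?thesis using that(2) by auto
      qed
      moreover have "coeff B n \<in> \<real>"
        using FR by (simp add: B_def coeff_sum)
      ultimately show ?thesis using 2 by auto
    next
      case 3
      then have "coeff [:A, B:] i = 0" by (auto simp: coeff_pCons split: nat.splits)
      then show ?thesis by simp
    qed
  qed
  then have "weighted d (sech_sq * H)"
    using weighted_diff[OF F] unfolding H[symmetric] R_def by (simp only:)
  then have "weighted (d - 2) H"
    by (rule weighted_div_sech_sq)
  moreover have "F = [:A, B:] + sech_sq * H"
    using H unfolding R_def by (simp add: algebra_simps)
  ultimately show ?thesis by blast
qed

text \<open>The quotient of \<open>carrier_poly (2*j+1)\<close> by \<open>sech_sq\<close> has weight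
  2j - 1 = 2(j-1) + 1, which is what the nonlinear terms from k = 1 on can represent. The remainder
  is fixed by its values at p = 1 and p = -1.\<close>

theorem carrier_identity:
  "\<exists>(a :: nat \<Rightarrow> nat \<Rightarrow> real) A B.
    smult [:(-1) ^ (j+1):] (carrier_poly (2*j+1)) +
    (\<Sum>k=1..j. \<Sum>l=0..2*(j-k)+1. smult [:of_real (a k l):]
      ((sech_deriv ^^ l) (sech_sq ^ k) * carrier_poly (2*(j-k)+1-l))) =
    smult [:(-1) ^ (j+1):] [:A, B:] \<and> A + B = [:1, 1:] ^ (2*j+1) \<and> A - B = [:-1, 1:] ^ (2*j+1)"
proof -
  obtain A B H where *: "carrier_poly (2*j+1) = [:A, B:] + sech_sq * H"
    "weighted (int (2*j+1) - 2) H"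
    using weighted_mod_sech_sq[OF weighted_carrier_poly] by blast
  define H' where "H' = smult [:- ((-1) ^ (j+1)):] H"
  have "weighted (2 * (int j - int 1) + 1) H'"
    unfolding H'_def using weighted_smult[OF *(2), of "- ((-1) ^ (j+1))"] by simp
  then obtain a :: "nat \<Rightarrow> nat \<Rightarrow> real" where a: "sech_sq ^ 1 * H' =
    (\<Sum>k=1..j. \<Sum>l=0..2*(j-k)+1. smult [:of_real (a k l):]
      ((sech_deriv ^^ l) (sech_sq ^ k) * carrier_poly (2*(j-k)+1-l)))"
    using weighted_expand[of j 1 H'] by auto
  have "poly (carrier_poly (2*j+1)) 1 = A + B"
    unfolding * by simp
  moreover have "poly (carrier_poly (2*j+1)) (-1) = A - B"
    unfolding * by simp
  ultimately have "A + B = [:1, 1:] ^ (2*j+1)" "A - B = [:-1, 1:] ^ (2*j+1)"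
    using poly_carrier_poly[of "2*j+1"] by metis+
  moreover have "smult [:(-1) ^ (j+1):] (carrier_poly (2*j+1)) + sech_sq ^ 1 * H' =
      smult [:(-1) ^ (j+1):] [:A, B:]"
  proof -
    have "H' = - smult [:(-1) ^ (j+1):] H"
      unfolding H'_def using smult_minus_left[of "[:(-1) ^ (j+1):]" H] by simp
    then show ?thesis
      unfolding * smult_add_right by (simp del: power_Suc)
  qed
  ultimately show ?thesis
    unfolding a by blast
qed

section \<open>Solitons\<close>

definition carrier_eval :: "complex poly poly \<Rightarrow> complex \<Rightarrow> real \<Rightarrow> complex" where
  "carrier_eval F z p = poly (poly F [:of_real p:]) z"

lemma carrier_eval_simps [simp]:
  "carrier_eval (F + H) z p = carrier_eval F z p + carrier_eval H z p"
  "carrier_eval (F - H) z p = carrier_eval F z p - carrier_eval H z p"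
  "carrier_eval (- F) z p = - carrier_eval F z p"
  "carrier_eval (F * H) z p = carrier_eval F z p * carrier_eval H z p"
  "carrier_eval (F ^ n) z p = carrier_eval F z p ^ n"
  "carrier_eval 1 z p = 1"
  "carrier_eval 0 z p = 0"
  "carrier_eval (pCons A F) z p = poly A z + of_real p * carrier_eval F z p"
  "carrier_eval (smult A F) z p = poly A z * carrier_eval F z p"
  by (simp_all add: carrier_eval_def)

lemma carrier_eval_sum [simp]: "carrier_eval (sum F I) z p = (\<Sum>x\<in>I. carrier_eval (F x) z p)"
  by (simp add: carrier_eval_def poly_sum)

lemma carrier_eval_has_vector_derivative:
  assumes h: "(h has_real_derivative h') (at t within S)"
  shows "((\<lambda>t. carrier_eval F z (h t)) has_vector_derivative
    of_real h' * carrier_eval (pderiv F) z (h t)) (at t within S)"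
proof (induction F)
  case (pCons A F)
  have "((\<lambda>t. of_real (h t) * carrier_eval F z (h t)) has_vector_derivative
     of_real (h t) * (of_real h' * carrier_eval (pderiv F) z (h t)) +
       of_real h' * carrier_eval F z (h t)) (at t within S)"
    by (intro has_vector_derivative_mult has_vector_derivative_of_real h pCons.IH)
  then have "((\<lambda>t. poly A z + of_real (h t) * carrier_eval F z (h t)) has_vector_derivative
     0 + (of_real (h t) * (of_real h' * carrier_eval (pderiv F) z (h t)) +
       of_real h' * carrier_eval F z (h t))) (at t within S)"
    by (intro has_vector_derivative_add has_vector_derivative_const)
  then show ?case by (simp add: pderiv_pCons algebra_simps)
qed simp

lemma carrier_eval_bounded: "\<exists>C. \<forall>p. \<bar>p\<bar> \<le> 1 \<longrightarrow> cmod (carrier_eval F z p) \<le> C"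
proof (induction F)
  case (pCons A F)
  then obtain C where C: "\<And>p. \<bar>p\<bar> \<le> 1 \<Longrightarrow> cmod (carrier_eval F z p) \<le> C" by blast
  have "cmod (carrier_eval (pCons A F) z p) \<le> cmod (poly A z) + C" if "\<bar>p\<bar> \<le> 1" for p
  proof -
    have "cmod (of_real p * carrier_eval F z p) \<le> 1 * C"
      unfolding norm_mult using that C[OF that] by (intro mult_mono) auto
    then show ?thesis
      using norm_triangle_ineq[of "poly A z" "of_real p * carrier_eval F z p"] by simp
  qed
  then show ?case by blast
qed auto

lemma abs_tanh_le_1: "\<bar>tanh (x::real)\<bar> \<le> 1"
  using tanh_real_lt_1[of x] tanh_real_gt_neg1[of x] by linarith

lemma DERIV_inverse_cosh:
  assumes "(h has_real_derivative h') (at t within S)"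
  shows "((\<lambda>t. inverse (cosh (h t))) has_real_derivative - h' * tanh (h t) * inverse (cosh (h t)))
    (at t within S)"
  by (rule derivative_eq_intros assms refl cosh_real_nonzero)+ (simp add: tanh_def field_simps)

lemma carrier_eval_sech_sq: "carrier_eval sech_sq z (- tanh y) = of_real (inverse (cosh y) ^ 2)"
proof -
  have "1 - tanh y ^ 2 = cosh y ^ 2 / cosh y ^ 2 - sinh y ^ 2 / cosh y ^ 2"
    by (simp add: tanh_def power_divide)
  also have "\<dots> = inverse (cosh y) ^ 2"
    unfolding diff_divide_distrib[symmetric] by (simp add: cosh_square_eq inverse_eq_divide power_divide)
  finally have "1 - tanh y ^ 2 = inverse (cosh y) ^ 2" .
  moreover have "carrier_eval sech_sq z (- tanh y) = of_real (1 - tanh y ^ 2)"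
    by (simp add: sech_sq_def power2_eq_square)
  ultimately show ?thesis by metis
qed

lemma has_vector_derivative_carrier_eval_tanh:
  assumes "(h has_real_derivative h') (at t within S)"
  shows "((\<lambda>t. carrier_eval F z (- tanh (h t))) has_vector_derivative
    of_real h' * carrier_eval (sech_deriv F) z (- tanh (h t))) (at t within S)"
proof -
  have "((\<lambda>t. - tanh (h t)) has_real_derivative - ((1 - tanh (h t) ^ 2) * h')) (at t within S)"
    by (rule derivative_eq_intros assms refl cosh_real_nonzero)+
  from carrier_eval_has_vector_derivative[OF this, of F z] show ?thesis
    by (simp add: sech_deriv_def sech_sq_def power2_eq_square algebra_simps)
qed

lemma has_vector_derivative_cis:
  assumes "(h has_real_derivative h') (at t within S)"
  shows "((\<lambda>t. cis (h t)) has_vector_derivative \<i> * of_real h' * cis (h t)) (at t within S)"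
  using has_derivative_cis[OF assms[unfolded has_field_derivative_def]]
  by (simp add: has_vector_derivative_def scaleR_conv_of_real mult_ac)

text \<open>The parameter \<open>w\<close> is both amplitude and inverse width, \<open>M\<close> is
  the carrier frequency in units of \<open>w\<close>, \<open>b\<close> a phase and \<open>c\<close>
  the centre of the envelope. Moving \<open>c\<close> does not move the carrier.\<close>

definition soliton :: "real \<Rightarrow> real \<Rightarrow> real \<Rightarrow> real \<Rightarrow> real \<Rightarrow> complex" where
  "soliton w M b c x = of_real w * cis (w * M * x + b) * of_real (inverse (cosh (w * (x - c))))"

lemma carrier_soliton_has_vector_derivative:
  defines "E \<equiv> \<lambda>M c w F x. carrier_eval F (\<i> * of_real M) (- tanh (w * (x - c)))"
  shows "((\<lambda>x. of_real w ^ l * soliton w M b c x * E M c w (carrier_poly l) x) has_vector_derivative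
     of_real w ^ Suc l * soliton w M b c x * E M c w (carrier_poly (Suc l)) x) (at x)"
proof -
  have 1: "((\<lambda>x. w * (x - c)) has_real_derivative w) (at x)"
    "((\<lambda>x. w * M * x + b) has_real_derivative w * M) (at x)"
    by (auto intro!: derivative_eq_intros)
  have "((\<lambda>x. of_real w ^ l * (of_real w * cis (w * M * x + b) *
      of_real (inverse (cosh (w * (x - c))))) * E M c w (carrier_poly l) x) has_vector_derivative
    of_real w ^ l * (of_real w * cis (w * M * x + b) * of_real (inverse (cosh (w * (x - c))))) *
      (of_real w * E M c w (sech_deriv (carrier_poly l)) x) +
    of_real w ^ l * (of_real w * cis (w * M * x + b) *
       of_real (- w * tanh (w * (x - c)) * inverse (cosh (w * (x - c)))) +
       of_real w * (\<i> * of_real (w * M) * cis (w * M * x + b)) *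
       of_real (inverse (cosh (w * (x - c))))) * E M c w (carrier_poly l) x) (at x)"
    unfolding E_def
    by (intro has_vector_derivative_mult has_vector_derivative_mult_right
        has_vector_derivative_cis has_vector_derivative_of_real DERIV_inverse_cosh
        has_vector_derivative_carrier_eval_tanh 1)
  then show ?thesis
    unfolding soliton_def
    by (rule has_vector_derivative_eq_rhs)
      (simp add: carrier_poly_Suc carrier_deriv_def E_def algebra_simps)
qed

lemma nth_deriv_soliton:
  "nth_deriv l (soliton w M b c) = (\<lambda>x. of_real w ^ l * soliton w M b c x *
     carrier_eval (carrier_poly l) (\<i> * of_real M) (- tanh (w * (x - c))))"
proof (induction l)
  case 0
  show ?case by (simp add: carrier_poly_0)
next
  case (Suc l)
  show ?case
    unfolding nth_deriv_Suc Suc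
    by (intro ext vector_derivative_at carrier_soliton_has_vector_derivative)
qed

lemma nth_deriv_soliton_differentiable: "nth_deriv l (soliton w M b c) differentiable (at x)"
  unfolding nth_deriv_soliton
  by (rule differentiableI_vector) (rule carrier_soliton_has_vector_derivative)

lemma power_le_fact_exp:
  fixes x :: real assumes "0 \<le> x" shows "x ^ m \<le> fact m * exp x"
proof -
  have "inverse (fact m) * x ^ m \<le> (\<Sum>n. inverse (fact n) * x ^ n)"
    using sum_le_suminf[OF summable_exp[of x], of "{m}"] assms by auto
  also have "\<dots> = exp x" by (simp add: exp_def divide_inverse scaleR_conv_of_real)
  finally show ?thesis by (simp add: field_simps)
qed

lemma inverse_cosh_le: "inverse (cosh (y::real)) \<le> 2 * exp (- \<bar>y\<bar>)"
proof -
  have "exp \<bar>y\<bar> \<le> 2 * cosh y"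
    by (cases "y \<ge> 0") (auto simp: cosh_def)
  then have "exp \<bar>y\<bar> * inverse (cosh y) \<le> 2"
    by (simp add: field_simps)
  then show ?thesis by (simp add: exp_minus field_simps)
qed

text \<open>Over a bounded time interval the centre of a pulse stays bounded while its phase may be
  anything; the bound is uniform in just this sense, as \<open>schwartz_solution\<close>
  requires.\<close>

lemma soliton_schwartz_uniform:
  assumes w: "0 < w"
  shows "\<exists>C. \<forall>b c. \<bar>c\<bar> \<le> R \<longrightarrow> (\<forall>x. \<bar>x\<bar> ^ m * cmod (nth_deriv n (soliton w M b c) x) \<le> C)"
proof -
  obtain D where D: "\<And>p. \<bar>p\<bar> \<le> 1 \<Longrightarrow> cmod (carrier_eval (carrier_poly n) (\<i> * of_real M) p) \<le> D"
    using carrier_eval_bounded by blast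
  have D0: "0 \<le> D" using order_trans[OF norm_ge_zero D[of 0]] by simp
  \<comment> \<open>With y = w (x - c), the power of x costs at most fact m / w^m times exp (|y| +
    wR), and exp |y| is cancelled by the decay of sech y. \<open>D\<close> bounds the polynomial
    factor, since tanh takes values in [-1, 1].\<close>
  define C where "C = fact m / w ^ m * exp (w * R) * w ^ Suc n * 2 * D"
  have "\<bar>x\<bar> ^ m * cmod (nth_deriv n (soliton w M b c) x) \<le> C" if c: "\<bar>c\<bar> \<le> R" for b c x
  proof -
    define y where "y = w * (x - c)"
    have "w * \<bar>x\<bar> \<le> \<bar>y\<bar> + w * R"
    proof -
      have "\<bar>y\<bar> = w * \<bar>x - c\<bar>" using w by (simp add: y_def abs_mult)
      moreover have "\<bar>x\<bar> \<le> \<bar>x - c\<bar> + R" using c by linarith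
      then have "w * \<bar>x\<bar> \<le> w * (\<bar>x - c\<bar> + R)" using w by (intro mult_left_mono) auto
      ultimately show ?thesis by (simp add: distrib_left)
    qed
    then have "(w * \<bar>x\<bar>) ^ m \<le> fact m * exp (\<bar>y\<bar> + w * R)"
      using w by (intro order_trans[OF power_le_fact_exp]) auto
    then have 1: "\<bar>x\<bar> ^ m \<le> fact m / w ^ m * (exp \<bar>y\<bar> * exp (w * R))"
      using w by (simp add: power_mult_distrib field_simps exp_add)
    have "cmod (nth_deriv n (soliton w M b c) x) =
      w ^ Suc n * (inverse (cosh y) * cmod (carrier_eval (carrier_poly n) (\<i> * of_real M) (- tanh y)))"
      using w unfolding nth_deriv_soliton soliton_def
      by (simp add: norm_mult norm_power norm_inverse y_def abs_mult)
    also have "\<dots> \<le> w ^ Suc n * ((2 * exp (- \<bar>y\<bar>)) * D)"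
      using w D0 abs_tanh_le_1[of y]
      by (intro mult_left_mono mult_mono inverse_cosh_le D) auto
    finally have 2: "cmod (nth_deriv n (soliton w M b c) x) \<le> w ^ Suc n * ((2 * exp (- \<bar>y\<bar>)) * D)" .
    have "\<bar>x\<bar> ^ m * cmod (nth_deriv n (soliton w M b c) x) \<le>
       (fact m / w ^ m * (exp \<bar>y\<bar> * exp (w * R))) * (w ^ Suc n * ((2 * exp (- \<bar>y\<bar>)) * D))"
      using w D0 by (intro mult_mono 1 2) auto
    also have "\<dots> = C"
      by (simp add: C_def exp_minus field_simps)
    finally show ?thesis .
  qed
  then show ?thesis by blast
qed

lemma soliton_schwartz:
  assumes "0 < w" shows "soliton w M b c \<in> schwartz"
proof -
  have "\<exists>C. \<forall>x. \<bar>x\<bar> ^ m * cmod (nth_deriv n (soliton w M b c) x) \<le> C" for m n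
    using soliton_schwartz_uniform[OF assms, of "\<bar>c\<bar>" m n M] by blast
  then show ?thesis
    using nth_deriv_soliton_differentiable unfolding schwartz_def by simp
qed

text \<open>The polynomial on the right is constant in \<lambda>, so \<open>z\<close> is arbitrary;
  it will be set to the value needed for the product with \<open>carrier_poly\<close>.\<close>

lemma nth_deriv_sech_power:
  "nth_deriv l (\<lambda>y. complex_of_real (A * inverse (cosh (w * (y - c))) ^ (2*k))) =
     (\<lambda>x. of_real A * of_real w ^ l *
        carrier_eval ((sech_deriv ^^ l) (sech_sq ^ k)) z (- tanh (w * (x - c))))"
proof (induction l)
  case 0
  show ?case by (simp add: carrier_eval_sech_sq power_mult)
next
  case (Suc l)
  have 1: "((\<lambda>x. w * (x - c)) has_real_derivative w) (at x)" for x
    by (auto intro!: derivative_eq_intros)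
  have "((\<lambda>x. of_real A * of_real w ^ l *
        carrier_eval ((sech_deriv ^^ l) (sech_sq ^ k)) z (- tanh (w * (x - c)))) has_vector_derivative
      of_real A * of_real w ^ l * (of_real w * 
        carrier_eval (sech_deriv ((sech_deriv ^^ l) (sech_sq ^ k))) z (- tanh (w * (x - c))))) (at x)" for x
    by (intro has_vector_derivative_mult_right has_vector_derivative_carrier_eval_tanh 1)
  then show ?case
    unfolding nth_deriv_Suc Suc by (intro ext vector_derivative_at) (simp add: mult_ac)
qed

text \<open>Each term carries 2k + l + (2(j-k)+1-l) = 2j+1 powers of \<open>w\<close> besides the
  pulse itself. This homogeneity lets one polynomial identity serve all scales.\<close>

lemma nonlinearity_soliton:
  assumes "0 < w"
  shows "nonlinearity a j (soliton w M b c) x = of_real w ^ (2*j+1) * soliton w M b c x *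
    carrier_eval (\<Sum>k=1..j. \<Sum>l=0..2*(j-k)+1. smult [:of_real (a k l):]
      ((sech_deriv ^^ l) (sech_sq ^ k) * carrier_poly (2*(j-k)+1-l))) (\<i> * of_real M)
      (- tanh (w * (x - c)))"
proof -
  have 1: "cmod (soliton w M b c y) ^ (2*k) = w ^ (2*k) * inverse (cosh (w * (y - c))) ^ (2*k)" for k y
    using assms by (simp add: soliton_def norm_mult norm_inverse power_mult_distrib)
  have 2: "complex_of_real w ^ (2*k) * of_real w ^ l * of_real w ^ (2*(j-k)+1-l) = of_real w ^ (2*j+1)"
    if "k \<in> {1..j}" "l \<in> {0..2*(j-k)+1}" for k l
  proof -
    have "2*k + l + (2*(j-k)+1-l) = 2*j+1" using that by auto
    then show ?thesis by (metis power_add)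
  qed
  show ?thesis
    unfolding nonlinearity_def 1 carrier_eval_sum sum_distrib_left
      nth_deriv_sech_power[where z = "\<i> * of_real M"] nth_deriv_soliton
    using 2 by (intro sum.cong refl) (simp add: mult_ac flip: 2)
qed

text \<open>For \<lambda> = iM one has \<lambda> - 1 = - cnj (1 + \<lambda>), and the power 2j+1 is
  odd. So A + B = Z and A - B = - cnj Z with Z = (1 + iM)^(2j+1), which splits Z into its imaginary
  and real part.\<close>

lemma carrier_identity_eval:
  "\<exists>a :: nat \<Rightarrow> nat \<Rightarrow> real. \<forall>M p.
    (-1) ^ (j+1) * carrier_eval (carrier_poly (2*j+1)) (\<i> * of_real M) p +
    carrier_eval (\<Sum>k=1..j. \<Sum>l=0..2*(j-k)+1. smult [:of_real (a k l):]
      ((sech_deriv ^^ l) (sech_sq ^ k) * carrier_poly (2*(j-k)+1-l))) (\<i> * of_real M) p =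
    (-1) ^ (j+1) * (\<i> * of_real (Im (Complex 1 M ^ (2*j+1))) + of_real p * of_real (Re (Complex 1 M ^ (2*j+1))))"
proof -
  obtain a :: "nat \<Rightarrow> nat \<Rightarrow> real" and A B where
    1: "smult [:(-1) ^ (j+1):] (carrier_poly (2*j+1)) +
    (\<Sum>k=1..j. \<Sum>l=0..2*(j-k)+1. smult [:of_real (a k l):]
      ((sech_deriv ^^ l) (sech_sq ^ k) * carrier_poly (2*(j-k)+1-l))) =
    smult [:(-1) ^ (j+1):] [:A, B:]"
    and 2: "A + B = [:1, 1:] ^ (2*j+1)" "A - B = [:-1, 1:] ^ (2*j+1)"
    using carrier_identity[of j] by blast
  have "poly A (\<i> * of_real M) = \<i> * of_real (Im (Complex 1 M ^ (2*j+1))) \<and>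
     poly B (\<i> * of_real M) = of_real (Re (Complex 1 M ^ (2*j+1)))" for M
  proof -
    let ?z = "Complex 1 M ^ (2*j+1)"
    have "poly (A + B) (\<i> * of_real M) = ?z"
      unfolding 2 by (simp add: Complex_eq algebra_simps)
    moreover have "poly (A - B) (\<i> * of_real M) = - cnj ?z"
    proof -
      have "\<i> * of_real M - 1 = - cnj (Complex 1 M)"
        by (simp add: complex_eq_iff)
      moreover have "poly (A - B) (\<i> * of_real M) = (\<i> * of_real M - 1) ^ (2*j+1)"
        unfolding 2 by (simp add: algebra_simps)
      moreover have "(- cnj (Complex 1 M)) ^ (2*j+1) = - cnj ?z"
        by (subst power_minus_odd) simp_all
      ultimately show ?thesis by simp
    qed
    ultimately have "poly A (\<i> * of_real M) + poly B (\<i> * of_real M) = ?z"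
      "poly A (\<i> * of_real M) - poly B (\<i> * of_real M) = - cnj ?z"
      by simp_all
    moreover have "u = \<i> * of_real (Im z) \<and> v = of_real (Re z)" if "u + v = z" "u - v = - cnj z" for u v z
      using that unfolding complex_eq_iff by simp
    ultimately show ?thesis by blast
  qed
  then have "carrier_eval (smult [:(-1) ^ (j+1):] [:A, B:]) (\<i> * of_real M) p = (-1) ^ (j+1) *
      (\<i> * of_real (Im (Complex 1 M ^ (2*j+1))) + of_real p * of_real (Re (Complex 1 M ^ (2*j+1))))" for M p
    by (simp only: carrier_eval_simps poly_pCons poly_0 mult_zero_right add_0_right)
  then show ?thesis
    unfolding 1[symmetric] by (intro exI[of _ a]) simp
qed

text \<open>Frequency and speed are read off from A + B p: the time derivative of a moving pulse
  divided by the pulse is i times the frequency plus w times the speed times tanh, and p is minus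
  that tanh.\<close>

definition soliton_freq :: "nat \<Rightarrow> real \<Rightarrow> real \<Rightarrow> real" where
  "soliton_freq j w M = - ((-1) ^ (j+1)) * w ^ (2*j+1) * Im (Complex 1 M ^ (2*j+1))"

definition soliton_speed :: "nat \<Rightarrow> real \<Rightarrow> real \<Rightarrow> real" where
  "soliton_speed j w M = (-1) ^ (j+1) * w ^ (2*j) * Re (Complex 1 M ^ (2*j+1))"

lemma soliton_solves:
  "\<exists>a :: nat \<Rightarrow> nat \<Rightarrow> real. \<forall>T w M. 0 < w \<longrightarrow>
     schwartz_solution a j T (\<lambda>t. soliton w M (soliton_freq j w M * t) (soliton_speed j w M * t))"
proof -
  obtain a :: "nat \<Rightarrow> nat \<Rightarrow> real" where a: "\<And>M p.
    (-1) ^ (j+1) * carrier_eval (carrier_poly (2*j+1)) (\<i> * of_real M) p +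
    carrier_eval (\<Sum>k=1..j. \<Sum>l=0..2*(j-k)+1. smult [:of_real (a k l):]
      ((sech_deriv ^^ l) (sech_sq ^ k) * carrier_poly (2*(j-k)+1-l))) (\<i> * of_real M) p =
    (-1) ^ (j+1) * (\<i> * of_real (Im (Complex 1 M ^ (2*j+1))) + of_real p * of_real (Re (Complex 1 M ^ (2*j+1))))"
    using carrier_identity_eval[of j] by blast
  have "schwartz_solution a j T (\<lambda>t. soliton w M (soliton_freq j w M * t) (soliton_speed j w M * t))"
    if w: "0 < w" for T w M
    unfolding schwartz_solution_def
  proof (intro conjI ballI allI)
    let ?f = "soliton_freq j w M" and ?c = "soliton_speed j w M"
    let ?v = "\<lambda>t. soliton w M (?f * t) (?c * t)"
    show "?v t \<in> schwartz" for t
      using w by (rule soliton_schwartz)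
    show "\<exists>C. \<forall>t\<in>{0..T}. \<forall>x. \<bar>x\<bar> ^ m * cmod (nth_deriv n (?v t) x) \<le> C" for m n
    proof -
      have "\<bar>?c * t\<bar> \<le> \<bar>?c\<bar> * T" if "t \<in> {0..T}" for t
        using that by (auto simp: abs_mult intro!: mult_left_mono)
      then show ?thesis
        using soliton_schwartz_uniform[OF w, of "\<bar>?c\<bar> * T" m n M] by blast
    qed
    define dv where "dv t x = ?v t x * (\<i> * of_real ?f + of_real (w * ?c * tanh (w * (x - ?c * t))))" for t x
    show "\<exists>dv. \<forall>t\<in>{0..T}. \<forall>x. ((\<lambda>\<tau>. ?v \<tau> x) has_vector_derivative dv t x) (at t within {0..T}) \<and>
        dv t x + (-1) ^ (j+1) * nth_deriv (2*j+1) (?v t) x + nonlinearity a j (?v t) x = 0"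
    proof (intro exI[of _ dv] ballI allI conjI)
      fix t x
      have 1: "((\<lambda>t. w * (x - ?c * t)) has_real_derivative - w * ?c) (at t within {0..T})"
        "((\<lambda>t. w * M * x + ?f * t) has_real_derivative ?f) (at t within {0..T})"
        by (auto intro!: derivative_eq_intros)
      have "((\<lambda>t. of_real w * cis (w * M * x + ?f * t) * of_real (inverse (cosh (w * (x - ?c * t)))))
         has_vector_derivative
         of_real w * cis (w * M * x + ?f * t) *
           of_real (- (- w * ?c) * tanh (w * (x - ?c * t)) * inverse (cosh (w * (x - ?c * t)))) +
         of_real w * (\<i> * of_real ?f * cis (w * M * x + ?f * t)) *
           of_real (inverse (cosh (w * (x - ?c * t))))) (at t within {0..T})"
        by (intro has_vector_derivative_mult has_vector_derivative_mult_right
          has_vector_derivative_cis has_vector_derivative_of_real DERIV_inverse_cosh 1)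
      then show "((\<lambda>\<tau>. ?v \<tau> x) has_vector_derivative dv t x) (at t within {0..T})"
        unfolding soliton_def
        by (rule has_vector_derivative_eq_rhs) (simp add: dv_def soliton_def algebra_simps)
      let ?p = "- tanh (w * (x - ?c * t))"
      have "(-1) ^ (j+1) * nth_deriv (2*j+1) (?v t) x + nonlinearity a j (?v t) x =
         of_real w ^ (2*j+1) * ?v t x * ((-1) ^ (j+1) *
         (\<i> * of_real (Im (Complex 1 M ^ (2*j+1))) + of_real ?p * of_real (Re (Complex 1 M ^ (2*j+1)))))"
        unfolding nonlinearity_soliton[OF w] nth_deriv_soliton a[symmetric]
        by (simp only: distrib_left mult_ac)
      also have "\<dots> = - dv t x"
        by (simp add: dv_def soliton_freq_def[of j w M] soliton_speed_def[of j w M] algebra_simps del: power_Suc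
            flip: power_Suc)
      finally have "dv t x + ((-1) ^ (j+1) * nth_deriv (2*j+1) (?v t) x + nonlinearity a j (?v t) x) = 0"
        by simp
      then show "dv t x + (-1) ^ (j+1) * nth_deriv (2*j+1) (?v t) x + nonlinearity a j (?v t) x = 0"
        by (simp only: add.assoc)
    qed
  qed
  then show ?thesis by blast
qed

text \<open>In the substitution x = c + y/w the Jacobian 1/w cancels the amplitude w, so the bump
  has the same height at every scale. The displacement c survives only as a phase linear in \<xi> -
  wM; different speeds thus show up as a phase difference that oscillates in \<xi>.\<close>

lemma fourier_soliton:
  assumes w: "0 < w"
  shows "fourier (soliton w M b c) \<xi> = cis (b - c * (\<xi> - w * M)) * fourier (soliton 1 0 0 0) (\<xi> / w - M)"
proof -
  have "(LINT x|lborel. cis (- (x * \<xi>)) * soliton w M b c x) =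
     \<bar>1 / w\<bar> *\<^sub>R (LINT y|lborel. cis (- ((c + 1 / w * y) * \<xi>)) * soliton w M b c (c + 1 / w * y))"
    using w by (intro lborel_integral_real_affine) simp
  also have "(LINT y|lborel. cis (- ((c + 1 / w * y) * \<xi>)) * soliton w M b c (c + 1 / w * y)) =
     (LINT y|lborel. (of_real w * cis (b - c * (\<xi> - w * M))) *
       (cis (- (y * (\<xi> / w - M))) * soliton 1 0 0 0 y))"
  proof (intro Bochner_Integration.integral_cong refl)
    fix y
    have "cis (- ((c + 1 / w * y) * \<xi>)) * cis (w * M * (c + 1 / w * y) + b) =
       cis (b - c * (\<xi> - w * M)) * cis (- (y * (\<xi> / w - M)))"
    proof -
      have "- ((c + 1 / w * y) * \<xi>) + (w * M * (c + 1 / w * y) + b) =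
          (b - c * (\<xi> - w * M)) + - (y * (\<xi> / w - M))"
        using w by (simp add: field_simps)
      then show ?thesis unfolding cis_mult by (simp only:)
    qed
    then show "cis (- ((c + 1 / w * y) * \<xi>)) * soliton w M b c (c + 1 / w * y) =
       (of_real w * cis (b - c * (\<xi> - w * M))) * (cis (- (y * (\<xi> / w - M))) * soliton 1 0 0 0 y)"
      using w by (simp add: soliton_def mult_ac) 
  qed
  finally show ?thesis
    unfolding fourier_def integral_mult_right_zero using w by (simp add: scaleR_conv_of_real)
qed

section \<open>Fourier transform on the Schwartz space\<close>

lemma nth_deriv_nth_deriv: "nth_deriv n (nth_deriv k f) = nth_deriv (n + k) f"
  by (simp add: nth_deriv_def funpow_add)

lemma schwartz_nth_deriv: "\<phi> \<in> schwartz \<Longrightarrow> nth_deriv k \<phi> \<in> schwartz"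
  unfolding schwartz_def by (simp add: nth_deriv_nth_deriv)

lemma schwartz_bound:
  assumes "\<phi> \<in> schwartz" obtains C where "\<And>x. \<bar>x\<bar> ^ m * cmod (nth_deriv n \<phi> x) \<le> C"
  using assms unfolding schwartz_def by blast

lemma schwartz_has_vector_derivative:
  "\<phi> \<in> schwartz \<Longrightarrow> (nth_deriv n \<phi> has_vector_derivative nth_deriv (Suc n) \<phi> x) (at x)"
  by (auto simp: schwartz_def nth_deriv_Suc vector_derivative_works[symmetric])

text \<open>This is the induction step of the Leibniz rule for x \<phi>. At n = 0 the truncated
  \<open>n - 1\<close> does no harm, as its factor is 0.\<close>

lemma times_x_has_vector_derivative:
  assumes "\<phi> \<in> schwartz"
  shows "((\<lambda>x. of_real x * nth_deriv n \<phi> x + of_nat n * nth_deriv (n - 1) \<phi> x) has_vector_derivative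
      of_real x * nth_deriv (Suc n) \<phi> x + of_nat (Suc n) * nth_deriv n \<phi> x) (at x)"
proof -
  have "((\<lambda>x. of_real x * nth_deriv n \<phi> x + of_nat n * nth_deriv (n - 1) \<phi> x) has_vector_derivative
      (of_real x * nth_deriv (Suc n) \<phi> x + of_real 1 * nth_deriv n \<phi> x) +
       of_nat n * nth_deriv (Suc (n - 1)) \<phi> x) (at x)"
    by (intro has_vector_derivative_add has_vector_derivative_mult has_vector_derivative_mult_right
        has_vector_derivative_of_real schwartz_has_vector_derivative assms DERIV_ident)
  then show ?thesis
    by (rule has_vector_derivative_eq_rhs) (cases n; simp add: algebra_simps)
qed

lemma nth_deriv_times_x:
  assumes "\<phi> \<in> schwartz"
  shows "nth_deriv n (\<lambda>x. of_real x * \<phi> x) =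
    (\<lambda>x. of_real x * nth_deriv n \<phi> x + of_nat n * nth_deriv (n - 1) \<phi> x)"
proof (induction n)
  case (Suc n)
  have "nth_deriv (Suc n) (\<lambda>x. of_real x * \<phi> x) x =
      of_real x * nth_deriv (Suc n) \<phi> x + of_nat (Suc n) * nth_deriv n \<phi> x" for x
    unfolding nth_deriv_Suc[of n "\<lambda>x. of_real x * \<phi> x"] Suc
    by (rule vector_derivative_at[OF times_x_has_vector_derivative[OF assms]])
  then show ?case by (simp add: fun_eq_iff)
qed simp

lemma schwartz_times_x:
  assumes "\<phi> \<in> schwartz"
  shows "(\<lambda>x. of_real x * \<phi> x) \<in> schwartz"
proof -
  have "\<exists>C. \<forall>x. \<bar>x\<bar> ^ m * cmod (of_real x * nth_deriv n \<phi> x + of_nat n * nth_deriv (n - 1) \<phi> x) \<le> C"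
    for m n
  proof -
    obtain C where C: "\<And>x. \<bar>x\<bar> ^ Suc m * cmod (nth_deriv n \<phi> x) \<le> C"
      using schwartz_bound[OF assms, of "Suc m" n] by blast
    obtain D where D: "\<And>x. \<bar>x\<bar> ^ m * cmod (nth_deriv (n - 1) \<phi> x) \<le> D"
      using schwartz_bound[OF assms, of m "n - 1"] by blast
    have "\<bar>x\<bar> ^ m * cmod (of_real x * nth_deriv n \<phi> x + of_nat n * nth_deriv (n - 1) \<phi> x) \<le> C + real n * D" for x
    proof -
      have "\<bar>x\<bar> ^ m * cmod (of_real x * nth_deriv n \<phi> x + of_nat n * nth_deriv (n - 1) \<phi> x) \<le>
        \<bar>x\<bar> ^ m * (cmod (of_real x * nth_deriv n \<phi> x) + cmod (of_nat n * nth_deriv (n - 1) \<phi> x))"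
        by (intro mult_left_mono norm_triangle_ineq) simp
      also have "\<dots> = \<bar>x\<bar> ^ Suc m * cmod (nth_deriv n \<phi> x) + real n * (\<bar>x\<bar> ^ m * cmod (nth_deriv (n - 1) \<phi> x))"
        by (simp add: norm_mult algebra_simps)
      also have "\<dots> \<le> C + real n * D"
        by (intro add_mono C mult_left_mono D) simp
      finally show ?thesis .
    qed
    then show ?thesis by blast
  qed
  moreover have "nth_deriv n (\<lambda>x. of_real x * \<phi> x) differentiable (at x)" for n x
    unfolding nth_deriv_times_x[OF assms]
    by (rule differentiableI_vector[OF times_x_has_vector_derivative[OF assms]])
  ultimately show ?thesis
    unfolding schwartz_def by (simp add: nth_deriv_times_x[OF assms])
qed

section \<open>Differentiability and decay of Fourier transforms\<close>

lemma cis_borel_measurable [measurable]: "cis \<in> borel_measurable borel"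
  by (intro borel_measurable_continuous_onI continuous_intros)

lemma integrable_cis_mult:
  assumes "integrable lborel f" "g \<in> borel_measurable lborel"
  shows "integrable lborel (\<lambda>x. cis (g x) * f x)"
proof (rule Bochner_Integration.integrable_bound[OF assms(1)])
  have [measurable]: "f \<in> borel_measurable lborel"
    using assms by auto
  note [measurable] = assms(2)
  show "(\<lambda>x. cis (g x) * f x) \<in> borel_measurable lborel"
    by measurable
qed (simp add: norm_mult)

lemma integrable_fourier_kernel:
  "integrable lborel f \<Longrightarrow> integrable lborel (\<lambda>x. cis (- (x * \<xi>)) * f x)"
  by (rule integrable_cis_mult) auto

lemma cmod_fourier_le:
  assumes "integrable lborel f"
  shows "cmod (fourier f \<xi>) \<le> (LINT x|lborel. cmod (f x)) / sqrt (2 * pi)"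
proof -
  have "cmod (LINT x|lborel. cis (- (x * \<xi>)) * f x) \<le> (LINT x|lborel. cmod (cis (- (x * \<xi>)) * f x))"
    by (rule integral_norm_bound)
  then show ?thesis
    by (simp add: fourier_def norm_divide norm_mult divide_right_mono)
qed

lemma cis_quadratic_bound: "cmod (cis u - 1 - \<i> * of_real u) \<le> u\<^sup>2"
proof -
  have "cmod (cis u - 1 - \<i> * of_real u) \<le> \<bar>u\<bar> ^ 2 / 2"
    using iexp_approx1[of u 1] by (simp add: cis_conv_exp numeral_2_eq_2 diff_diff_eq)
  also have "\<dots> \<le> u\<^sup>2" by simp
  finally show ?thesis .
qed

text \<open>Differentiation under the integral rests on the quadratic Taylor remainder of
  \<open>cis\<close>: the error is at most K |\<eta> - \<xi>|^2, where K is the second absolute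
  moment of \<phi>.\<close>

lemma fourier_has_vector_derivative:
  assumes \<phi>: "\<phi> \<in> schwartz"
  shows "(fourier \<phi> has_vector_derivative fourier (\<lambda>x. - \<i> * (of_real x * \<phi> x)) \<xi>) (at \<xi>)"
  unfolding has_vector_derivative_def has_derivative_at_alt
proof (intro conjI allI impI)
  define K where "K = (LINT x|lborel. cmod (of_real x * (of_real x * \<phi> x)))"
  let ?D = "fourier (\<lambda>x. - \<i> * (of_real x * \<phi> x)) \<xi>"
  have i0: "integrable lborel \<phi>" and i1: "integrable lborel (\<lambda>x. - \<i> * (of_real x * \<phi> x))"
    and i2: "integrable lborel (\<lambda>x. of_real x * (of_real x * \<phi> x))"
    using \<phi> by (intro schwartz_integrable schwartz_cmult schwartz_times_x; assumption)+
  have K0: "0 \<le> K" unfolding K_def by simp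
  have main: "cmod (fourier \<phi> \<eta> - fourier \<phi> \<xi> - (\<eta> - \<xi>) *\<^sub>R ?D) \<le> K * \<bar>\<eta> - \<xi>\<bar>\<^sup>2" for \<eta>
  proof -
    let ?R = "\<lambda>x. cis (- (x * \<eta>)) * \<phi> x - cis (- (x * \<xi>)) * \<phi> x -
         of_real (\<eta> - \<xi>) * (cis (- (x * \<xi>)) * (- \<i> * (of_real x * \<phi> x)))"
    have i: "integrable lborel (\<lambda>x. cis (- (x * \<eta>)) * \<phi> x - cis (- (x * \<xi>)) * \<phi> x)"
      "integrable lborel (\<lambda>x. of_real (\<eta> - \<xi>) * (cis (- (x * \<xi>)) * (- \<i> * (of_real x * \<phi> x))))"
      by (intro Bochner_Integration.integrable_diff integrable_mult_right integrable_fourier_kernel i0 i1)+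
    have eq: "fourier \<phi> \<eta> - fourier \<phi> \<xi> - (\<eta> - \<xi>) *\<^sub>R ?D =
       (LINT x|lborel. ?R x) / of_real (sqrt (2 * pi))"
      unfolding fourier_def scaleR_conv_of_real
        Bochner_Integration.integral_diff[OF i]
        Bochner_Integration.integral_diff[OF integrable_fourier_kernel[OF i0] integrable_fourier_kernel[OF i0]]
        integral_mult_right_zero
      by (simp add: diff_divide_distrib add_divide_distrib)
    have "cmod (LINT x|lborel. ?R x) / sqrt (2 * pi) \<le> cmod (LINT x|lborel. ?R x) / 1"
    proof (rule divide_left_mono)
      show "1 \<le> sqrt (2 * pi)"
        using pi_ge_two by simp
    qed auto
    moreover have "cmod (LINT x|lborel. ?R x) \<le> (LINT x|lborel. \<bar>\<eta> - \<xi>\<bar>\<^sup>2 * cmod (of_real x * (of_real x * \<phi> x)))"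
    proof (rule Bochner_Integration.integral_norm_bound_integral)
      show "integrable lborel ?R"
        by (intro Bochner_Integration.integrable_diff integrable_mult_right integrable_fourier_kernel i0 i1)
      show "integrable lborel (\<lambda>x. \<bar>\<eta> - \<xi>\<bar>\<^sup>2 * cmod (of_real x * (of_real x * \<phi> x)))"
        by (intro integrable_mult_right integrable_norm i2)
      fix x
      define u where "u = - (x * (\<eta> - \<xi>))"
      have "cis (- (x * \<eta>)) = cis (- (x * \<xi>)) * cis u"
        by (simp add: cis_mult u_def algebra_simps)
      then have "?R x = cis (- (x * \<xi>)) * ((cis u - 1 - \<i> * of_real u) * \<phi> x)"
        by (simp add: u_def algebra_simps)
      then have "cmod (?R x) = cmod (cis u - 1 - \<i> * of_real u) * cmod (\<phi> x)"
        by (simp add: norm_mult)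
      also have "\<dots> \<le> u\<^sup>2 * cmod (\<phi> x)"
        by (intro mult_right_mono cis_quadratic_bound) simp
      also have "\<dots> = \<bar>\<eta> - \<xi>\<bar>\<^sup>2 * cmod (of_real x * (of_real x * \<phi> x))"
        by (simp add: u_def norm_mult power_mult_distrib power2_eq_square)
      finally show "cmod (?R x) \<le> \<bar>\<eta> - \<xi>\<bar>\<^sup>2 * cmod (of_real x * (of_real x * \<phi> x))" .
    qed
    ultimately show ?thesis
      unfolding eq norm_divide by (simp add: K_def mult.commute)
  qed
  show "bounded_linear (\<lambda>t. t *\<^sub>R ?D)"
    by (rule bounded_linear_scaleR_left)
  fix e :: real assume e: "0 < e"
  show "\<exists>d>0. \<forall>\<eta>. norm (\<eta> - \<xi>) < d \<longrightarrow>
      norm (fourier \<phi> \<eta> - fourier \<phi> \<xi> - (\<eta> - \<xi>) *\<^sub>R ?D) \<le> e * norm (\<eta> - \<xi>)"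
  proof (intro exI[of _ "e / (K + 1)"] conjI allI impI)
    show "0 < e / (K + 1)" using e K0 by simp
    fix \<eta> assume "norm (\<eta> - \<xi>) < e / (K + 1)"
    then have "(K + 1) * \<bar>\<eta> - \<xi>\<bar> \<le> e" using K0 by (simp add: field_simps)
    then have "K * \<bar>\<eta> - \<xi>\<bar> \<le> e" by (simp add: distrib_right)
    then have "K * \<bar>\<eta> - \<xi>\<bar> * \<bar>\<eta> - \<xi>\<bar> \<le> e * \<bar>\<eta> - \<xi>\<bar>"
      by (intro mult_right_mono) auto
    then show "norm (fourier \<phi> \<eta> - fourier \<phi> \<xi> - (\<eta> - \<xi>) *\<^sub>R ?D) \<le> e * norm (\<eta> - \<xi>)"
      using main[of \<eta>] by (simp add: power2_eq_square mult.assoc)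
  qed
qed

lemma schwartz_tendsto_0:
  assumes "\<phi> \<in> schwartz"
  shows "(\<phi> \<longlongrightarrow> 0) at_top" "(\<phi> \<longlongrightarrow> 0) at_bot"
proof -
  obtain C where C: "\<And>x. \<bar>x\<bar> ^ 1 * cmod (nth_deriv 0 \<phi> x) \<le> C"
    using schwartz_bound[OF assms, of 1 0] by blast
  have b: "cmod (\<phi> x) \<le> C * inverse \<bar>x\<bar>" if "x \<noteq> 0" for x
    using C[of x] that by (simp add: field_simps)
  have "((\<lambda>x. C * inverse \<bar>x\<bar>) \<longlongrightarrow> 0) at_top"
    by (intro tendsto_mult_right_zero tendsto_inverse_0_at_top filterlim_abs_real)
  then show "(\<phi> \<longlongrightarrow> 0) at_top"
    by (rule Lim_null_comparison[OF eventually_mono[OF eventually_gt_at_top[of 0] b], rotated]) simp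
  have "((\<lambda>x. C * inverse \<bar>x\<bar>) \<longlongrightarrow> 0) at_bot"
    by (intro tendsto_mult_right_zero tendsto_inverse_0_at_top
        filterlim_at_top_mono[OF filterlim_uminus_at_top_at_bot]) (auto intro!: always_eventually)
  then show "(\<phi> \<longlongrightarrow> 0) at_bot"
    by (rule Lim_null_comparison[OF eventually_mono[OF eventually_gt_at_bot[of 0] b], rotated]) simp
qed

lemma integral_derivative_eq_0:
  fixes F :: "real \<Rightarrow> complex"
  assumes F: "\<And>x. (F has_vector_derivative f x) (at x)" and f: "continuous_on UNIV f"
    "integrable lborel f" and lim: "(F \<longlongrightarrow> 0) at_top" "(F \<longlongrightarrow> 0) at_bot"
  shows "(LINT x|lborel. f x) = 0"
proof -
  have "einterval (-\<infinity>) \<infinity> = (UNIV :: real set)"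
    by (auto simp: einterval_def)
  moreover have "(LBINT x=-\<infinity>..\<infinity>. f x) = 0 - 0"
  proof (rule interval_integral_FTC_integrable[where F = F])
    show "((F \<circ> real_of_ereal) \<longlongrightarrow> 0) (at_right (-\<infinity>))"
      unfolding ereal_tendsto_simps by (rule lim)
    show "((F \<circ> real_of_ereal) \<longlongrightarrow> 0) (at_left \<infinity>)"
      unfolding ereal_tendsto_simps by (rule lim)
    show "isCont f x" for x
      using f(1) by (simp add: continuous_on_eq_continuous_at)
    show "set_integrable lborel (einterval (-\<infinity>) \<infinity>) f"
      using f(2) calculation by (simp add: set_integrable_def)
  qed (use F in auto)
  ultimately show ?thesis
    by (simp add: interval_lebesgue_integral_def set_lebesgue_integral_def)
qed

lemma fourier_deriv:
  assumes \<phi>: "\<phi> \<in> schwartz"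
  shows "fourier (nth_deriv 1 \<phi>) \<xi> = \<i> * of_real \<xi> * fourier \<phi> \<xi>"
proof -
  let ?f = "\<lambda>x. cis (- (x * \<xi>)) * nth_deriv 1 \<phi> x + \<i> * of_real (- \<xi>) * (cis (- (x * \<xi>)) * \<phi> x)"
  have i: "integrable lborel (nth_deriv 1 \<phi>)" "integrable lborel \<phi>"
    using \<phi> by (intro schwartz_integrable schwartz_nth_deriv; assumption)+
  have "(LINT x|lborel. ?f x) = 0"
  proof (rule integral_derivative_eq_0)
    have n: "((\<lambda>x. cis (- (x * \<xi>)) * \<phi> x) \<longlongrightarrow> 0) F" if "(\<phi> \<longlongrightarrow> 0) F" for F
      by (rule tendsto_norm_zero_cancel) (simp add: norm_mult tendsto_norm_zero[OF that])
    show "((\<lambda>x. cis (- (x * \<xi>)) * \<phi> x) \<longlongrightarrow> 0) at_top" "((\<lambda>x. cis (- (x * \<xi>)) * \<phi> x) \<longlongrightarrow> 0) at_bot"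
      by (intro n schwartz_tendsto_0[OF \<phi>])+
    show "integrable lborel ?f"
      by (intro Bochner_Integration.integrable_add integrable_mult_right integrable_fourier_kernel i)
    show "continuous_on UNIV ?f"
      using schwartz_continuous[OF \<phi>] schwartz_continuous[OF schwartz_nth_deriv[OF \<phi>, of 1]]
      by (intro continuous_intros)
    fix x
    have 1: "((\<lambda>x. - (x * \<xi>)) has_real_derivative - \<xi>) (at x)"
      by (auto intro!: derivative_eq_intros)
    have "(nth_deriv 0 \<phi> has_vector_derivative nth_deriv (Suc 0) \<phi> x) (at x)"
      using \<phi> by (rule schwartz_has_vector_derivative)
    then have "((\<lambda>x. cis (- (x * \<xi>)) * \<phi> x) has_vector_derivative
       cis (- (x * \<xi>)) * nth_deriv 1 \<phi> x + \<i> * of_real (- \<xi>) * cis (- (x * \<xi>)) * \<phi> x) (at x)"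
      by (intro has_vector_derivative_mult has_vector_derivative_cis 1) simp
    then show "((\<lambda>x. cis (- (x * \<xi>)) * \<phi> x) has_vector_derivative ?f x) (at x)"
      by (simp only: mult.assoc)
  qed
  then have "(LINT x|lborel. cis (- (x * \<xi>)) * nth_deriv 1 \<phi> x) =
      \<i> * of_real \<xi> * (LINT x|lborel. cis (- (x * \<xi>)) * \<phi> x)"
    by (subst (asm) Bochner_Integration.integral_add)
      (auto intro!: integrable_mult_right integrable_fourier_kernel i simp del: One_nat_def)
  then show ?thesis unfolding fourier_def by simp
qed

lemma fourier_nth_deriv:
  assumes "\<phi> \<in> schwartz"
  shows "fourier (nth_deriv m \<phi>) \<xi> = (\<i> * of_real \<xi>) ^ m * fourier \<phi> \<xi>"
proof (induction m)
  case (Suc m)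
  have "nth_deriv (Suc m) \<phi> = nth_deriv 1 (nth_deriv m \<phi>)"
    by (simp add: nth_deriv_nth_deriv)
  then show ?case
    using fourier_deriv[OF schwartz_nth_deriv[OF assms], of m] Suc by simp
qed simp

text \<open>The existence of some Schwartz \<psi> is all that the induction has to carry, because
  decay of \<open>fourier \<psi>\<close> follows for any Schwartz function.\<close>

lemma nth_deriv_fourier:
  assumes "\<phi> \<in> schwartz"
  shows "\<exists>\<psi>\<in>schwartz. nth_deriv n (fourier \<phi>) = fourier \<psi>"
proof (induction n)
  case (Suc n)
  then obtain \<psi> where \<psi>: "\<psi> \<in> schwartz" "nth_deriv n (fourier \<phi>) = fourier \<psi>" by blast
  have "nth_deriv (Suc n) (fourier \<phi>) = fourier (\<lambda>x. - \<i> * (of_real x * \<psi> x))"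
    unfolding nth_deriv_Suc \<psi>(2)
    by (intro ext vector_derivative_at fourier_has_vector_derivative \<psi>)
  then show ?case
    using schwartz_cmult[OF schwartz_times_x[OF \<psi>(1)]] by blast
qed (use assms in auto)

lemma fourier_schwartz:
  assumes "\<phi> \<in> schwartz"
  shows "fourier \<phi> \<in> schwartz"
proof -
  have "nth_deriv n (fourier \<phi>) differentiable (at x)" for n x
  proof -
    obtain \<psi> where "\<psi> \<in> schwartz" "nth_deriv n (fourier \<phi>) = fourier \<psi>"
      using nth_deriv_fourier[OF assms] by blast
    then show ?thesis
      using fourier_has_vector_derivative differentiableI_vector by metis
  qed
  moreover have "\<exists>C. \<forall>x. \<bar>x\<bar> ^ m * cmod (nth_deriv n (fourier \<phi>) x) \<le> C" for m n
  proof -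
    obtain \<psi> where \<psi>: "\<psi> \<in> schwartz" "nth_deriv n (fourier \<phi>) = fourier \<psi>"
      using nth_deriv_fourier[OF assms] by blast
    \<comment> \<open>A factor x^m is, up to modulus one, m derivatives of \<psi>, whose transform
      is bounded by an L1 norm.\<close>
    have "\<bar>x\<bar> ^ m * cmod (fourier \<psi> x) = cmod (fourier (nth_deriv m \<psi>) x)" for x
      unfolding fourier_nth_deriv[OF \<psi>(1)] by (simp add: norm_mult norm_power)
    then show ?thesis
      unfolding \<psi>(2) using cmod_fourier_le[OF schwartz_integrable[OF schwartz_nth_deriv[OF \<psi>(1), of m]]]
      by auto
  qed
  ultimately show ?thesis
    unfolding schwartz_def by simp
qed

text \<open>Fubini, with a kernel that is symmetric in x and \<xi>. This reconciles the transform of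
  a function with the transform by duality in \<open>has_fourier\<close>.\<close>

lemma integral_fourier_swap:
  assumes g: "g \<in> schwartz" and \<phi>: "\<phi> \<in> schwartz"
  shows "(LINT x|lborel. g x * fourier \<phi> x) = (LINT \<xi>|lborel. fourier g \<xi> * \<phi> \<xi>)"
proof -
  have [measurable]: "g \<in> borel_measurable borel" "\<phi> \<in> borel_measurable borel"
    using schwartz_continuous[OF g] schwartz_continuous[OF \<phi>]
    by (auto intro: borel_measurable_continuous_onI)
  have int: "integrable (lborel \<Otimes>\<^sub>M lborel) (case_prod (\<lambda>x \<xi>. cis (- (x * \<xi>)) * g x * \<phi> \<xi>))"
  proof (rule lborel_pair.Fubini_integrable)
    show "case_prod (\<lambda>x \<xi>. cis (- (x * \<xi>)) * g x * \<phi> \<xi>) \<in> borel_measurable (lborel \<Otimes>\<^sub>M lborel)"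
      by measurable
    show "integrable lborel (\<lambda>x. LINT \<xi>|lborel. norm (case (x, \<xi>) of (x, \<xi>) \<Rightarrow> cis (- (x * \<xi>)) * g x * \<phi> \<xi>))"
      using schwartz_integrable[OF g] by (simp add: norm_mult)
    show "AE x in lborel. integrable lborel (\<lambda>\<xi>. case (x, \<xi>) of (x, \<xi>) \<Rightarrow> cis (- (x * \<xi>)) * g x * \<phi> \<xi>)"
    proof (rule AE_I2)
      fix x
      have "integrable lborel (\<lambda>\<xi>. g x * (cis (- (x * \<xi>)) * \<phi> \<xi>))"
        by (intro integrable_mult_right integrable_cis_mult schwartz_integrable \<phi>) auto
      then show "integrable lborel (\<lambda>\<xi>. case (x, \<xi>) of (x, \<xi>) \<Rightarrow> cis (- (x * \<xi>)) * g x * \<phi> \<xi>)"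
        by (simp add: mult_ac)
    qed
  qed
  have "(LINT x|lborel. g x * (LINT \<xi>|lborel. cis (- (x * \<xi>)) * \<phi> \<xi>)) =
     (LINT x|lborel. LINT \<xi>|lborel. cis (- (x * \<xi>)) * g x * \<phi> \<xi>)"
    by (intro Bochner_Integration.integral_cong refl)
      (simp add: mult_ac flip: integral_mult_right_zero)
  also have "\<dots> = (LINT \<xi>|lborel. LINT x|lborel. cis (- (x * \<xi>)) * g x * \<phi> \<xi>)"
    by (rule lborel_pair.Fubini_integral[OF int, symmetric])
  also have "\<dots> = (LINT \<xi>|lborel. (LINT x|lborel. cis (- (\<xi> * x)) * g x) * \<phi> \<xi>)"
    by (simp add: mult.commute)
  finally have *: "(LINT x|lborel. g x * (LINT \<xi>|lborel. cis (- (x * \<xi>)) * \<phi> \<xi>)) =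
     (LINT \<xi>|lborel. (LINT x|lborel. cis (- (x * \<xi>)) * g x) * \<phi> \<xi>)"
    by (simp add: mult.commute)
  have "(LINT x|lborel. g x * fourier \<phi> x) =
     (LINT x|lborel. g x * (LINT \<xi>|lborel. cis (- (x * \<xi>)) * \<phi> \<xi>)) / of_real (sqrt (2 * pi))"
    by (simp only: fourier_def times_divide_eq_right integral_divide_zero mult.commute[of x for x :: real])
  also have "\<dots> = (LINT \<xi>|lborel. fourier g \<xi> * \<phi> \<xi>)"
    by (simp only: fourier_def times_divide_eq_left integral_divide_zero *)
  finally show ?thesis .
qed

lemma has_fourier_fun_tdist:
  assumes "g \<in> schwartz"
  shows "has_fourier (fun_tdist g) (fourier g)"
  unfolding has_fourier_def
proof (intro conjI ballI)
  have F: "fourier g \<in> schwartz" by (rule fourier_schwartz[OF assms])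
  show "fourier g \<in> borel_measurable lborel"
    using schwartz_continuous[OF F] by (auto intro: borel_measurable_continuous_onI)
  fix \<phi> :: "real \<Rightarrow> complex" assume \<phi>: "\<phi> \<in> schwartz"
  show "integrable lborel (\<lambda>\<xi>. fourier g \<xi> * \<phi> \<xi>)"
    by (rule integrable_schwartz_mult[OF schwartz_integrable[OF F] \<phi>])
  show "tdist_app (fun_tdist g) (fourier \<phi>) = (LINT \<xi>|lborel. fourier g \<xi> * \<phi> \<xi>)"
    by (simp add: tdist_app_fun_tdist assms fourier_schwartz \<phi> integral_fourier_swap)
qed

section \<open>Uniqueness of the transform of a distribution\<close>

lemma tdist_app_minus: "tdist_app (u - w) \<phi> = tdist_app u \<phi> - tdist_app w \<phi>"
  unfolding minus_tdist_def uminus_tdist_def tdist_app_plus tdist_app_scaleR by simp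

lemma has_fourier_diff:
  assumes "has_fourier u f" "has_fourier w g"
  shows "has_fourier (u - w) (\<lambda>\<xi>. f \<xi> - g \<xi>)"
  using assms unfolding has_fourier_def tdist_app_minus
  by (auto simp: left_diff_distrib intro!: borel_measurable_diff)

text \<open>
  The positive and the negative part of \<open>k\<close>, normalised to probability densities, have the same
  characteristic function.
\<close>

lemma real_fourier_zero_imp_AE_zero:
  fixes k :: "real \<Rightarrow> real"
  assumes k: "integrable lborel k" and z: "\<And>t. (LINT x|lborel. cis (t * x) * of_real (k x)) = 0"
  shows "AE x in lborel. k x = 0"
proof -
  define p where "p = (\<lambda>x. max (k x) 0)"
  define n where "n = (\<lambda>x. max (- k x) 0)"
  have k_meas [measurable]: "k \<in> borel_measurable borel"
    using k by auto
  have meas [measurable]: "p \<in> borel_measurable borel" "n \<in> borel_measurable borel"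
    unfolding p_def n_def by measurable
  have ip: "integrable lborel p" and i_n: "integrable lborel n"
    unfolding p_def n_def using k by auto
  have pn: "k x = p x - n x" "0 \<le> p x" "0 \<le> n x" for x
    by (auto simp: p_def n_def)
  have eq: "(LINT x|lborel. cis (t * x) * of_real (p x)) = (LINT x|lborel. cis (t * x) * of_real (n x))" for t
  proof -
    have "(LINT x|lborel. cis (t * x) * of_real (p x)) - (LINT x|lborel. cis (t * x) * of_real (n x)) =
       (LINT x|lborel. cis (t * x) * of_real (p x) - cis (t * x) * of_real (n x))"
      using ip i_n by (intro Bochner_Integration.integral_diff[symmetric] integrable_cis_mult integrable_of_real) auto
    also have "\<dots> = 0"
      using z[of t] by (simp add: pn right_diff_distrib)
    finally show ?thesis by simp
  qed
  \<comment> \<open>The hypothesis at t = 0 says that both parts have the same mass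
    \<open>c\<close>, so one normalisation fits both.\<close>
  define c where "c = (LINT x|lborel. p x)"
  have "of_real c = (LINT x|lborel. cis (0 * x) * complex_of_real (p x))"
    by (simp add: c_def)
  also have "\<dots> = of_real (LINT x|lborel. n x)"
    unfolding eq by simp
  finally have cn: "c = (LINT x|lborel. n x)"
    by simp
  have c0: "0 \<le> c" unfolding c_def by (simp add: pn)
  show ?thesis
  proof (cases "c = 0")
    case True
    then have "AE x in lborel. p x = 0" "AE x in lborel. n x = 0"
      using integral_nonneg_eq_0_iff_AE[OF ip] integral_nonneg_eq_0_iff_AE[OF i_n] cn
      by (auto simp: c_def pn)
    then show ?thesis by eventually_elim (simp add: pn)
  next
    case False
    with c0 have c: "c > 0" by simp
    have rd: "real_distribution (density lborel (\<lambda>x. ennreal (f x / c)))"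
      if f: "f \<in> borel_measurable borel" "integrable lborel f" "\<And>x. 0 \<le> f x" "c = (LINT x|lborel. f x)" for f
    proof -
      note [measurable] = f(1)
      have "emeasure (density lborel (\<lambda>x. ennreal (f x / c))) UNIV = (\<integral>\<^sup>+ x. ennreal (f x / c) \<partial>lborel)"
        by (simp add: emeasure_density)
      also have "\<dots> = ennreal (LINT x|lborel. f x / c)"
        using f c by (intro nn_integral_eq_integral) auto
      also have "\<dots> = 1"
        using c f(4) by simp
      finally have "prob_space (density lborel (\<lambda>x. ennreal (f x / c)))"
        by (intro prob_spaceI) simp
      then show ?thesis
        unfolding real_distribution_def real_distribution_axioms_def by simp
    qed
    have ch: "char (density lborel (\<lambda>x. ennreal (f x / c))) t = (LINT x|lborel. cis (t * x) * of_real (f x)) / of_real c"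
      if [measurable]: "f \<in> borel_measurable borel" and f: "\<And>x. 0 \<le> f x" for f t
    proof -
      have "char (density lborel (\<lambda>x. ennreal (f x / c))) t = (LINT x|lborel. (f x / c) *\<^sub>R iexp (t * x))"
        unfolding char_def using f c by (intro integral_density) auto
      also have "\<dots> = (LINT x|lborel. cis (t * x) * of_real (f x) / of_real c)"
        by (intro Bochner_Integration.integral_cong refl) (simp add: scaleR_conv_of_real cis_conv_exp)
      finally show ?thesis by simp
    qed
    have "density lborel (\<lambda>x. ennreal (p x / c)) = density lborel (\<lambda>x. ennreal (n x / c))"
      proof (rule Levy_uniqueness)
      show "real_distribution (density lborel (\<lambda>x. ennreal (p x / c)))"
        by (rule rd[OF meas(1) ip pn(2) c_def])
      show "real_distribution (density lborel (\<lambda>x. ennreal (n x / c)))"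
        by (rule rd[OF meas(2) i_n pn(3) cn])
      show "char (density lborel (\<lambda>x. ennreal (p x / c))) = char (density lborel (\<lambda>x. ennreal (n x / c)))"
        unfolding ch[OF meas(1) pn(2), abs_def] ch[OF meas(2) pn(3), abs_def] eq ..
    qed
    then have "AE x in lborel. ennreal (p x / c) = ennreal (n x / c)"
      by (intro sigma_finite_measure.density_unique[OF lborel.sigma_finite_measure_axioms]) auto
    then show ?thesis
      by eventually_elim (use c pn in \<open>auto simp: ennreal_inj\<close>)
  qed
qed

text \<open>Since t ranges over all reals, the hypothesis passes to the conjugate of
  \<open>k\<close> by t \<mapsto> -t, and hence to real and imaginary part.\<close>

lemma fourier_zero_imp_AE_zero:
  fixes k :: "real \<Rightarrow> complex"
  assumes k: "integrable lborel k" and z: "\<And>t. (LINT x|lborel. cis (t * x) * k x) = 0"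
  shows "AE x in lborel. k x = 0"
proof -
  have cz: "(LINT x|lborel. cis (t * x) * cnj (k x)) = 0" for t
  proof -
    have "(LINT x|lborel. cis (t * x) * cnj (k x)) = (LINT x|lborel. cnj (cis (- t * x) * k x))"
      by (intro Bochner_Integration.integral_cong refl) (simp add: cis_cnj)
    also have "\<dots> = cnj (LINT x|lborel. cis (- t * x) * k x)"
      by (rule Bochner_Integration.integral_cnj)
    finally show ?thesis unfolding z by simp
  qed
  have ic: "integrable lborel (\<lambda>x. cnj (k x))"
    using k by simp
  have i: "integrable lborel (\<lambda>x. cis (t * x) * k x)" "integrable lborel (\<lambda>x. cis (t * x) * cnj (k x))" for t
    using k ic by (auto intro!: integrable_cis_mult)
  have "AE x in lborel. Re (k x) = 0"
  proof (rule real_fourier_zero_imp_AE_zero)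
    fix t
    have eq: "cis (t * x) * of_real (Re (k x)) = (cis (t * x) * k x + cis (t * x) * cnj (k x)) / 2" for x
      unfolding distrib_left[symmetric] complex_add_cnj by simp
    then show "(LINT x|lborel. cis (t * x) * of_real (Re (k x))) = 0"
      by (simp add: eq Bochner_Integration.integral_add[OF i] z cz)
  qed (use k in auto)
  moreover have "AE x in lborel. Im (k x) = 0"
  proof (rule real_fourier_zero_imp_AE_zero)
    fix t
    have eq: "cis (t * x) * of_real (Im (k x)) = (cis (t * x) * k x - cis (t * x) * cnj (k x)) / (2 * \<i>)" for x
      unfolding right_diff_distrib[symmetric] complex_diff_cnj by (simp add: complex_eq_iff)
    then show "(LINT x|lborel. cis (t * x) * of_real (Im (k x))) = 0"
      by (simp add: eq Bochner_Integration.integral_diff[OF i] z cz)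
  qed (use k in auto)
  ultimately show ?thesis
    by eventually_elim (simp add: complex_eq_iff)
qed

text \<open>The representing functions need not be integrable, but their products with sech are, and
  sech has no zeros. Testing with the modulated functions \<open>soliton 1 t 0 0\<close> computes
  the Fourier transform of (f - g) sech.\<close>

lemma has_fourier_unique:
  assumes "has_fourier u f" "has_fourier u g"
  shows "AE x in lborel. f x = g x"
proof -
  define k where "k x = (f x - g x) * soliton 1 0 0 0 x" for x
  have S: "soliton 1 t 0 0 \<in> schwartz" for t
    by (rule soliton_schwartz) simp
  have cs: "soliton 1 t 0 0 x = cis (t * x) * soliton 1 0 0 0 x" for t x
    by (simp add: soliton_def)
  have i: "integrable lborel (\<lambda>x. f x * soliton 1 t 0 0 x)" "integrable lborel (\<lambda>x. g x * soliton 1 t 0 0 x)" for t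
    using assms S unfolding has_fourier_def by blast+
  have e: "(LINT x|lborel. f x * soliton 1 t 0 0 x) = (LINT x|lborel. g x * soliton 1 t 0 0 x)" for t
    using assms S unfolding has_fourier_def by metis
  have "AE x in lborel. k x = 0"
  proof (rule fourier_zero_imp_AE_zero)
    show "integrable lborel k"
      unfolding k_def left_diff_distrib using i by (intro Bochner_Integration.integrable_diff)
    fix t
    have "(LINT x|lborel. cis (t * x) * k x) = (LINT x|lborel. f x * soliton 1 t 0 0 x - g x * soliton 1 t 0 0 x)"
      by (intro Bochner_Integration.integral_cong refl) (simp add: k_def cs[of t] algebra_simps)
    also have "\<dots> = 0"
      using i e by simp
    finally show "(LINT x|lborel. cis (t * x) * k x) = 0" .
  qed
  then show ?thesis
    by eventually_elim (simp add: k_def soliton_def)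
qed

text \<open>This removes the choice operator: from here on norms are computed with explicit
  transforms.\<close>

lemma hat_H_norm_eq:
  assumes "has_fourier u f"
  shows "hat_H_norm r s u =
    (LINT \<xi>|lborel. (jap \<xi> powr s * cmod (f \<xi>)) powr conj_exp r) powr (1 / conj_exp r)"
proof -
  define g where "g = (SOME f. has_fourier u f)"
  have g: "has_fourier u g"
    unfolding g_def using someI[of "has_fourier u" f] assms by simp
  have [measurable]: "f \<in> borel_measurable borel" "g \<in> borel_measurable borel"
    using assms g unfolding has_fourier_def by auto
  have [measurable]: "jap \<in> borel_measurable borel"
    unfolding jap_def[abs_def] by measurable
  have "(LINT \<xi>|lborel. (jap \<xi> powr s * cmod (g \<xi>)) powr conj_exp r) =
     (LINT \<xi>|lborel. (jap \<xi> powr s * cmod (f \<xi>)) powr conj_exp r)"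
  proof (rule integral_cong_AE)
    show "AE \<xi> in lborel. (jap \<xi> powr s * cmod (g \<xi>)) powr conj_exp r =
        (jap \<xi> powr s * cmod (f \<xi>)) powr conj_exp r"
      using has_fourier_unique[OF g assms] by eventually_elim simp
  qed measurable
  then show ?thesis
    unfolding hat_H_norm_def g_def by simp
qed

section \<open>Weighted norms of bumps\<close>

lemma jap_ge: "\<bar>x\<bar> \<le> jap x" "1 \<le> jap x"
  and jap_le: "jap x \<le> 1 + \<bar>x\<bar>"
proof -
  have j: "jap x = sqrt (1 + x\<^sup>2)"
    by (simp add: jap_def powr_half_sqrt)
  show "\<bar>x\<bar> \<le> jap x" "1 \<le> jap x"
    unfolding j by (auto intro!: real_le_rsqrt)
  show "jap x \<le> 1 + \<bar>x\<bar>"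
    unfolding j by (rule real_le_lsqrt) (auto simp: power2_eq_square algebra_simps abs_mult_self_eq)
qed

lemma jap_measurable [measurable]: "jap \<in> borel_measurable borel"
  unfolding jap_def[abs_def] by measurable

text \<open>On a bump of width N^(-\<sigma>) around N the weight is of size N^\<sigma>. Away from
  the bump it may exceed this by a power of the rescaled distance, which the decay of the bump
  absorbs.\<close>

lemma jap_powr_le:
  assumes "-1 < \<sigma>"
  shows "\<exists>C K. 0 < C \<and> 0 \<le> K \<and> (\<forall>N \<xi>. 1 \<le> N \<longrightarrow>
    jap \<xi> powr \<sigma> \<le> C * N powr \<sigma> * (1 + \<bar>(\<xi> - N) / N powr - \<sigma>\<bar>) powr K)"
proof (cases "0 \<le> \<sigma>")
  case True
  have "jap \<xi> powr \<sigma> \<le> 2 powr \<sigma> * N powr \<sigma> * (1 + \<bar>(\<xi> - N) / N powr - \<sigma>\<bar>) powr \<sigma>"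
    if N: "1 \<le> N" for N \<xi>
  proof -
    \<comment> \<open>For \<sigma> \<ge> 0 the width is at most 1, so rescaling only enlarges
      distances.\<close>
    have "N powr - \<sigma> \<le> 1"
      using N True by (simp add: powr_minus field_simps ge_one_powr_ge_zero)
    then have "\<bar>\<xi> - N\<bar> * N powr - \<sigma> \<le> \<bar>\<xi> - N\<bar>"
      by (intro mult_right_le_one_le) auto
    then have D: "\<bar>\<xi> - N\<bar> \<le> \<bar>(\<xi> - N) / N powr - \<sigma>\<bar>"
      using N by (simp add: field_simps abs_divide)
    have "jap \<xi> \<le> 1 + N + \<bar>\<xi> - N\<bar>"
      using jap_le[of \<xi>] N by linarith
    moreover have "\<bar>\<xi> - N\<bar> \<le> N * \<bar>\<xi> - N\<bar>"
      using N by (simp add: mult_left_le_one_le mult_le_cancel_right1)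
    ultimately have "jap \<xi> \<le> 2 * N * (1 + \<bar>\<xi> - N\<bar>)"
      using N by (simp add: algebra_simps)
    also have "\<dots> \<le> 2 * N * (1 + \<bar>(\<xi> - N) / N powr - \<sigma>\<bar>)"
      using N D by (intro mult_left_mono) auto
    finally have "jap \<xi> powr \<sigma> \<le> (2 * N * (1 + \<bar>(\<xi> - N) / N powr - \<sigma>\<bar>)) powr \<sigma>"
      using True jap_ge(2)[of \<xi>] by (intro powr_mono2) auto
    then show ?thesis using N by (simp add: powr_mult)
  qed
  then show ?thesis using True by (intro exI[of _ "2 powr \<sigma>"] exI[of _ \<sigma>]) auto
next
  case False
  \<comment> \<open>Frequencies below \<open>N/2\<close> are at rescaled distance at least \<open>N\<^bsup>1+\<sigma>\<^esup>/2\<close>, so this power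
    compensates the missing factor \<open>N\<^bsup>\<sigma>\<^esup>\<close>.\<close>
  define K where "K = - \<sigma> / (1 + \<sigma>)"
  have K: "0 \<le> K" using False assms by (simp add: K_def divide_nonpos_pos)
  have "jap \<xi> powr \<sigma> \<le> (2 powr - \<sigma> + 2 powr K) * N powr \<sigma> * (1 + \<bar>(\<xi> - N) / N powr - \<sigma>\<bar>) powr K"
    if N: "1 \<le> N" for N \<xi>
  proof -
    define D where "D = \<bar>(\<xi> - N) / N powr - \<sigma>\<bar>"
    have D1: "1 \<le> (1 + D) powr K"
      using K by (intro ge_one_powr_ge_zero) (auto simp: D_def)
    show ?thesis unfolding D_def[symmetric]
    proof (cases "N / 2 \<le> \<bar>\<xi>\<bar>")
      case True
      have "jap \<xi> powr \<sigma> \<le> (N / 2) powr \<sigma>"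
        using False N True jap_ge(1)[of \<xi>] by (intro powr_mono2') auto
      also have "\<dots> = 2 powr - \<sigma> * N powr \<sigma> * 1"
        using N by (simp add: powr_divide powr_minus field_simps)
      also have "\<dots> \<le> (2 powr - \<sigma> + 2 powr K) * N powr \<sigma> * (1 + D) powr K"
        using D1 by (intro mult_mono) auto
      finally show "jap \<xi> powr \<sigma> \<le> (2 powr - \<sigma> + 2 powr K) * N powr \<sigma> * (1 + D) powr K" .
    next
      case small: False
      have "N / 2 \<le> \<bar>\<xi> - N\<bar>" using small N by linarith
      then have "N / 2 / N powr - \<sigma> \<le> \<bar>\<xi> - N\<bar> / N powr - \<sigma>"
        by (intro divide_right_mono) auto
      moreover have "N / 2 / N powr - \<sigma> = N powr (1 + \<sigma>) / 2"
        using N by (simp add: powr_minus powr_add field_simps)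
      ultimately have "N powr (1 + \<sigma>) \<le> 2 * (1 + D)"
        by (simp add: D_def abs_divide)
      then have "(N powr (1 + \<sigma>)) powr K \<le> (2 * (1 + D)) powr K"
        using K by (intro powr_mono2) auto
      moreover have "(N powr (1 + \<sigma>)) powr K = N powr - \<sigma>"
        using assms by (simp add: powr_powr K_def)
      ultimately have "N powr - \<sigma> \<le> 2 powr K * (1 + D) powr K"
        by (subst (asm) powr_mult) (simp_all add: D_def)
      then have "1 \<le> 2 powr K * N powr \<sigma> * (1 + D) powr K"
        using N by (simp add: powr_minus field_simps)
      also have "\<dots> \<le> (2 powr - \<sigma> + 2 powr K) * N powr \<sigma> * (1 + D) powr K"
        by (intro mult_right_mono) auto
      finally have "1 \<le> (2 powr - \<sigma> + 2 powr K) * N powr \<sigma> * (1 + D) powr K" .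
      moreover have "jap \<xi> powr \<sigma> \<le> 1"
        using powr_mono[of \<sigma> 0 "jap \<xi>"] False jap_ge(2)[of \<xi>] by simp
      ultimately show "jap \<xi> powr \<sigma> \<le> (2 powr - \<sigma> + 2 powr K) * N powr \<sigma> * (1 + D) powr K"
        by linarith
    qed
  qed
  moreover have "0 < 2 powr - \<sigma> + 2 powr K" by (simp add: add_pos_pos)
  ultimately show ?thesis using K by blast
qed

text \<open>In this range \<open>jap \<xi>\<close> lies between N/2 and 4N; the sign of \<sigma>
  decides which of the two bounds counts.\<close>

lemma jap_powr_ge:
  "\<exists>c>0. \<forall>N \<xi>. 1 \<le> N \<longrightarrow> \<bar>\<xi> - N\<bar> \<le> N / 2 \<longrightarrow> c * N powr \<sigma> \<le> jap \<xi> powr \<sigma>"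
proof (cases "0 \<le> \<sigma>")
  case True
  have "2 powr - \<sigma> * N powr \<sigma> \<le> jap \<xi> powr \<sigma>" if "1 \<le> N" "\<bar>\<xi> - N\<bar> \<le> N / 2" for N \<xi>
  proof -
    have "(N / 2) powr \<sigma> \<le> jap \<xi> powr \<sigma>"
      using that True jap_ge(1)[of \<xi>] by (intro powr_mono2) linarith+
    then show ?thesis using that by (simp add: powr_divide powr_minus field_simps)
  qed
  then show ?thesis by (intro exI[of _ "2 powr - \<sigma>"]) auto
next
  case False
  have "4 powr \<sigma> * N powr \<sigma> \<le> jap \<xi> powr \<sigma>" if "1 \<le> N" "\<bar>\<xi> - N\<bar> \<le> N / 2" for N \<xi>
  proof -
    have "(4 * N) powr \<sigma> \<le> jap \<xi> powr \<sigma>"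
      using that False jap_le[of \<xi>] jap_ge(2)[of \<xi>] by (intro powr_mono2') linarith+
    then show ?thesis using that by (simp add: powr_mult)
  qed
  then show ?thesis by (intro exI[of _ "4 powr \<sigma>"]) auto
qed

lemma schwartz_decay:
  assumes "\<phi> \<in> schwartz"
  shows "\<exists>B>0. \<forall>x. cmod (nth_deriv n \<phi> x) \<le> B * (1 + \<bar>x\<bar>) powr - k"
proof -
  define m where "m = nat \<lceil>k\<rceil>"
  obtain C where C: "\<And>x. \<bar>x\<bar> ^ m * cmod (nth_deriv n \<phi> x) \<le> C"
    using schwartz_bound[OF assms, of m n] by blast
  obtain D where D: "\<And>x. \<bar>x\<bar> ^ 0 * cmod (nth_deriv n \<phi> x) \<le> D"
    using schwartz_bound[OF assms, of 0 n] by blast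
  have CD: "0 \<le> C" "0 \<le> D"
    using order_trans[OF _ C[of 0]] order_trans[OF _ D[of 0]] by auto
  have "cmod (nth_deriv n \<phi> x) \<le> (2 ^ m * (C + D) + 1) * (1 + \<bar>x\<bar>) powr - k" for x
  proof -
    have "(1 + \<bar>x\<bar>) powr k \<le> (1 + \<bar>x\<bar>) powr real m"
      by (intro powr_mono) (auto simp: m_def intro: real_nat_ceiling_ge)
    also have "\<dots> = (1 + \<bar>x\<bar>) ^ m"
      by (simp add: powr_realpow)
    also have "\<dots> \<le> (2 * max 1 \<bar>x\<bar>) ^ m"
      by (intro power_mono) auto
    also have "\<dots> \<le> 2 ^ m * (1 + \<bar>x\<bar> ^ m)"
      by (auto simp: power_mult_distrib max_def)
    finally have "(1 + \<bar>x\<bar>) powr k * cmod (nth_deriv n \<phi> x) \<le> 2 ^ m * (1 + \<bar>x\<bar> ^ m) * cmod (nth_deriv n \<phi> x)"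
      by (intro mult_right_mono) auto
    also have "\<dots> = 2 ^ m * (\<bar>x\<bar> ^ m * cmod (nth_deriv n \<phi> x) + \<bar>x\<bar> ^ 0 * cmod (nth_deriv n \<phi> x))"
      by (simp add: algebra_simps)
    also have "\<dots> \<le> 2 ^ m * (C + D)"
      by (intro mult_left_mono add_mono C D) auto
    finally have "(1 + \<bar>x\<bar>) powr k * cmod (nth_deriv n \<phi> x) \<le> 2 ^ m * (C + D) + 1" by simp
    moreover have "0 < (1 + \<bar>x\<bar>) powr k" by simp
    ultimately show ?thesis
      unfolding powr_minus by (simp add: field_simps)
  qed
  moreover have "0 < 2 ^ m * (C + D) + 1" using CD by (simp add: add_nonneg_pos)
  ultimately show ?thesis by blast
qed

lemma one_add_abs_shift:
  fixes x y k :: real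
  assumes "\<bar>x - y\<bar> \<le> 1" "0 \<le> k"
  shows "(1 + \<bar>y\<bar>) powr - k \<le> 2 powr k * (1 + \<bar>x\<bar>) powr - k"
proof -
  have "(1 + \<bar>x\<bar>) powr k \<le> (2 * (1 + \<bar>y\<bar>)) powr k"
    using assms by (intro powr_mono2) auto
  then have "(1 + \<bar>x\<bar>) powr k \<le> 2 powr k * (1 + \<bar>y\<bar>) powr k"
    by (subst (asm) powr_mult) simp_all
  moreover have "0 < (1 + \<bar>x\<bar>) powr k" "0 < (1 + \<bar>y\<bar>) powr k" by simp_all
  ultimately show ?thesis
    unfolding powr_minus by (simp add: field_simps)
qed

text \<open>By the mean value theorem the difference is \<epsilon> times a derivative taken within
  distance 1 of x, where the decay rate changes by at most the factor 2^k.\<close>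

lemma schwartz_shift_decay:
  assumes \<phi>: "\<phi> \<in> schwartz" and k: "0 \<le> k"
  shows "\<exists>B>0. \<forall>\<epsilon>\<in>{0..1}. \<forall>x. cmod (\<phi> (x - \<epsilon>)) \<le> B * (1 + \<bar>x\<bar>) powr - k \<and>
    cmod (\<phi> x - \<phi> (x - \<epsilon>)) \<le> \<epsilon> * B * (1 + \<bar>x\<bar>) powr - k"
proof -
  obtain B0 where B0: "0 < B0" "\<And>x. cmod (nth_deriv 0 \<phi> x) \<le> B0 * (1 + \<bar>x\<bar>) powr - k"
    using schwartz_decay[OF \<phi>] by blast
  obtain B1 where B1: "0 < B1" "\<And>x. cmod (nth_deriv (Suc 0) \<phi> x) \<le> B1 * (1 + \<bar>x\<bar>) powr - k"
    using schwartz_decay[OF \<phi>] by blast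
  define B where "B = (B0 + B1) * 2 powr k"
  have bound: "b * (1 + \<bar>y\<bar>) powr - k \<le> B * (1 + \<bar>x\<bar>) powr - k"
    if "\<bar>x - y\<bar> \<le> 1" "0 \<le> b" "b \<le> B0 + B1" for b x y
  proof -
    have "b * (1 + \<bar>y\<bar>) powr - k \<le> (B0 + B1) * (2 powr k * (1 + \<bar>x\<bar>) powr - k)"
      using that B0(1) B1(1) by (intro mult_mono one_add_abs_shift k) auto
    then show ?thesis by (simp add: B_def mult.assoc)
  qed
  have "cmod (\<phi> (x - \<epsilon>)) \<le> B * (1 + \<bar>x\<bar>) powr - k \<and>
    cmod (\<phi> x - \<phi> (x - \<epsilon>)) \<le> \<epsilon> * B * (1 + \<bar>x\<bar>) powr - k" if e: "\<epsilon> \<in> {0..1}" for \<epsilon> x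
  proof
    show "cmod (\<phi> (x - \<epsilon>)) \<le> B * (1 + \<bar>x\<bar>) powr - k"
      using B0(2)[of "x - \<epsilon>"] bound[of x "x - \<epsilon>" B0] B0(1) B1(1) e by simp
    show "cmod (\<phi> x - \<phi> (x - \<epsilon>)) \<le> \<epsilon> * B * (1 + \<bar>x\<bar>) powr - k"
    proof (cases "\<epsilon> = 0")
      case False
      then have "x - \<epsilon> < x" using e by simp
      then have "\<exists>z\<in>{x - \<epsilon><..<x}. norm (\<phi> x - \<phi> (x - \<epsilon>)) \<le>
          norm ((x - (x - \<epsilon>)) *\<^sub>R nth_deriv (Suc 0) \<phi> z)"
        using schwartz_has_vector_derivative[OF \<phi>, of 0]
        by (intro mvt_general continuous_on_subset[OF schwartz_continuous[OF \<phi>]])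
          (auto simp: has_vector_derivative_def)
      then obtain z where z: "z \<in> {x - \<epsilon><..<x}"
        "norm (\<phi> x - \<phi> (x - \<epsilon>)) \<le> norm ((x - (x - \<epsilon>)) *\<^sub>R nth_deriv (Suc 0) \<phi> z)"
        by blast
      have "norm (nth_deriv (Suc 0) \<phi> z) \<le> B * (1 + \<bar>x\<bar>) powr - k"
        using B1(2)[of z] bound[of x z B1] B0(1) B1(1) e z(1) by simp
      then have "\<epsilon> * norm (nth_deriv (Suc 0) \<phi> z) \<le> \<epsilon> * (B * (1 + \<bar>x\<bar>) powr - k)"
        using e by (intro mult_left_mono) auto
      then show ?thesis using z(2) e by simp
    qed simp
  qed
  moreover have "0 < B" using B0 B1 by (simp add: B_def)
  ultimately show ?thesis by blast
qed

text \<open>The size N^\<sigma> of the weight cancels the Jacobian N^(-\<sigma>) of the rescaling,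
  so \<open>A\<close> is independent of \<open>N\<close>.\<close>

lemma weighted_integral_le:
  assumes "-1 < \<sigma>" "0 < q"
  shows "\<exists>A>0. \<exists>k\<ge>0. \<forall>N f B. 1 \<le> N \<longrightarrow> 0 \<le> B \<longrightarrow> f \<in> borel_measurable borel \<longrightarrow>
    (\<forall>\<xi>. cmod (f \<xi>) \<le> B * (1 + \<bar>(\<xi> - N) / N powr - \<sigma>\<bar>) powr - k) \<longrightarrow>
    integrable lborel (\<lambda>\<xi>. jap \<xi> powr \<sigma> * cmod (f \<xi>) powr q) \<and>
    (LINT \<xi>|lborel. jap \<xi> powr \<sigma> * cmod (f \<xi>) powr q) \<le> A * B powr q"
proof -
  obtain C K where CK: "0 < C" "0 \<le> K" "\<And>N \<xi>. 1 \<le> N \<Longrightarrow>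
    jap \<xi> powr \<sigma> \<le> C * N powr \<sigma> * (1 + \<bar>(\<xi> - N) / N powr - \<sigma>\<bar>) powr K"
    using jap_powr_le[OF assms(1)] by blast
  \<comment> \<open>After raising to the power q and paying the loss K of the weight, decay of order
    2 remains, which is integrable.\<close>
  define k where "k = (K + 2) / q"
  define L where "L = (LINT x|lborel. inverse (1 + x\<^sup>2 :: real))"
  have L0: "0 \<le> L" unfolding L_def by (intro integral_nonneg_AE) (simp add: add_nonneg_nonneg)
  have "integrable lborel (\<lambda>\<xi>. jap \<xi> powr \<sigma> * cmod (f \<xi>) powr q) \<and>
    (LINT \<xi>|lborel. jap \<xi> powr \<sigma> * cmod (f \<xi>) powr q) \<le> (C * L + 1) * B powr q"
    if N: "1 \<le> N" and B: "0 \<le> B" and [measurable]: "f \<in> borel_measurable borel" and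
      f: "\<And>\<xi>. cmod (f \<xi>) \<le> B * (1 + \<bar>(\<xi> - N) / N powr - \<sigma>\<bar>) powr - k" for N f B
  proof -
    define w where "w = N powr - \<sigma>"
    have w: "0 < w" "N powr \<sigma> * w = 1" using N by (auto simp: w_def powr_minus)
    define h where "h = (\<lambda>\<xi>. C * N powr \<sigma> * B powr q * inverse (1 + ((\<xi> - N) / w)\<^sup>2))"
    have le: "jap \<xi> powr \<sigma> * cmod (f \<xi>) powr q \<le> h \<xi>" for \<xi>
    proof -
      define D where "D = \<bar>(\<xi> - N) / w\<bar>"
      have D0: "0 \<le> D" by (simp add: D_def)
      have "cmod (f \<xi>) powr q \<le> (B * (1 + D) powr - k) powr q"
        using f[of \<xi>] assms by (intro powr_mono2) (auto simp: D_def w_def)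
      also have "\<dots> = B powr q * (1 + D) powr - (K + 2)"
        using assms B D0 by (simp add: powr_mult powr_powr k_def)
      finally have "jap \<xi> powr \<sigma> * cmod (f \<xi>) powr q \<le>
          (C * N powr \<sigma> * (1 + D) powr K) * (B powr q * (1 + D) powr - (K + 2))"
        using CK(3)[OF N, of \<xi>] CK(1) by (intro mult_mono) (auto simp: D_def w_def)
      also have "\<dots> = C * N powr \<sigma> * B powr q * ((1 + D) powr K * (1 + D) powr - (K + 2))"
        by (simp add: mult_ac)
      also have "(1 + D) powr K * (1 + D) powr - (K + 2) = inverse ((1 + D)\<^sup>2)"
        using D0 by (simp add: powr_add[symmetric] powr_minus)
      also have "C * N powr \<sigma> * B powr q * inverse ((1 + D)\<^sup>2) \<le> C * N powr \<sigma> * B powr q * inverse (1 + D\<^sup>2)"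
        using CK(1) D0 by (intro mult_left_mono le_imp_inverse_le) (auto simp: power2_eq_square algebra_simps add_pos_nonneg)
      also have "\<dots> = h \<xi>" by (simp only: h_def D_def power2_abs)
      finally show ?thesis .
    qed
    have sub: "(\<lambda>x. h (N + w * x)) = (\<lambda>x. C * N powr \<sigma> * B powr q * inverse (1 + x\<^sup>2))"
      using w by (simp add: h_def)
    have ih: "integrable lborel h"
      using lborel_integrable_real_affine_iff[of w h N] w(1) integrable_inverse_1_plus_sq
      unfolding sub by simp
    have int: "integrable lborel (\<lambda>\<xi>. jap \<xi> powr \<sigma> * cmod (f \<xi>) powr q)"
      by (rule Bochner_Integration.integrable_bound[OF ih])
        (use le in \<open>auto intro!: AE_I2 order_trans[OF le abs_ge_self]\<close>)
    have "(LINT \<xi>|lborel. jap \<xi> powr \<sigma> * cmod (f \<xi>) powr q) \<le> (LINT \<xi>|lborel. h \<xi>)"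
      using int ih le by (intro integral_mono) auto
    also have "\<dots> = \<bar>w\<bar> *\<^sub>R (LINT x|lborel. h (N + w * x))"
      using w by (intro lborel_integral_real_affine) simp
    also have "\<dots> = (N powr \<sigma> * w) * (C * B powr q * L)"
      unfolding sub using w(1) by (simp add: L_def mult_ac)
    also have "\<dots> \<le> (C * L + 1) * B powr q"
      unfolding w(2) by (simp add: algebra_simps)
    finally show ?thesis using int by blast
  qed
  moreover have "0 < C * L + 1" using CK(1) L0 by (simp add: add_nonneg_pos)
  moreover have "0 \<le> k" using CK(2) assms(2) by (simp add: k_def)
  ultimately show ?thesis by blast
qed

text \<open>A linear minorant of the q-th power turns a pointwise bound by 1 - cos into one that can
  be integrated in closed form.\<close>

lemma powr_ge_linear:
  fixes t :: real assumes "0 \<le> t" "0 < b" "1 \<le> q"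
  shows "b powr (q - 1) * (t - b) \<le> t powr q"
proof (cases "t \<le> b")
  case True
  then have "b powr (q - 1) * (t - b) \<le> 0" by (simp add: mult_nonneg_nonpos)
  then show ?thesis by (smt (verit) powr_ge_zero)
next
  case False
  have "b powr (q - 1) * (t - b) \<le> t powr (q - 1) * t"
    using assms False by (intro mult_mono powr_mono2) auto
  also have "\<dots> = t powr q"
    using assms False by (simp add: powr_diff)
  finally show ?thesis .
qed

lemma cmod_cis_diff_ge: "1 - cos (x - y) \<le> cmod (cis x - cis y)"
proof -
  have "cis x - cis y = cis y * (cis (x - y) - 1)"
    by (simp add: algebra_simps cis_mult)
  then have "cmod (cis x - cis y) = cmod (cis (x - y) - 1)"
    by (simp add: norm_mult)
  moreover have "\<bar>Re (cis (x - y) - 1)\<bar> \<le> cmod (cis (x - y) - 1)"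
    by (rule abs_Re_le_cmod)
  ultimately show ?thesis by simp
qed

text \<open>The mean part contributes a\<delta>, and the oscillating part at most 2a/|\<kappa>|,
  which the bound on \<kappa> makes at most a\<delta>/2. The phase \<beta> is arbitrary. The
  subtracted a/2 is room for later errors.\<close>

lemma integral_one_minus_cos_ge:
  fixes a \<beta> \<kappa> \<delta> :: real
  assumes "0 < \<delta>" "0 < a" "4 / \<delta> \<le> \<bar>\<kappa>\<bar>"
  shows "integrable lborel (\<lambda>z. (a * (1 - cos (\<beta> - \<kappa> * z)) - a / 2) * indicator {-\<delta>..\<delta>} z)"
    "a * \<delta> / 2 \<le> (LINT z|lborel. (a * (1 - cos (\<beta> - \<kappa> * z)) - a / 2) * indicator {-\<delta>..\<delta>} z)"
proof -
  have k0: "\<kappa> \<noteq> 0" using assms by (auto simp: field_simps)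
  define F where "F z = a / 2 * z + a / \<kappa> * sin (\<beta> - \<kappa> * z)" for z
  have F: "(F has_real_derivative (a * (1 - cos (\<beta> - \<kappa> * z)) - a / 2)) (at z)" for z
    unfolding F_def by (rule derivative_eq_intros refl)+ (use k0 in \<open>simp add: field_simps\<close>)
  have c: "isCont (\<lambda>z. a * (1 - cos (\<beta> - \<kappa> * z)) - a / 2) z" for z
    by (intro continuous_intros)
  have "has_bochner_integral lborel
      (\<lambda>z. (a * (1 - cos (\<beta> - \<kappa> * z)) - a / 2) * indicator {-\<delta>..\<delta>} z) (F \<delta> - F (-\<delta>))"
    using assms F c by (intro has_bochner_integral_FTC_Icc_real) auto
  then have i: "integrable lborel (\<lambda>z. (a * (1 - cos (\<beta> - \<kappa> * z)) - a / 2) * indicator {-\<delta>..\<delta>} z)"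
    "(LINT z|lborel. (a * (1 - cos (\<beta> - \<kappa> * z)) - a / 2) * indicator {-\<delta>..\<delta>} z) = F \<delta> - F (-\<delta>)"
    by (auto simp: has_bochner_integral_iff)
  show "integrable lborel (\<lambda>z. (a * (1 - cos (\<beta> - \<kappa> * z)) - a / 2) * indicator {-\<delta>..\<delta>} z)"
    by (rule i)
  define S where "S = sin (\<beta> - \<kappa> * \<delta>) - sin (\<beta> + \<kappa> * \<delta>)"
  have S: "\<bar>S\<bar> \<le> 2"
    unfolding S_def using abs_sin_le_one[of "\<beta> - \<kappa> * \<delta>"] abs_sin_le_one[of "\<beta> + \<kappa> * \<delta>"] by linarith
  have "F \<delta> - F (-\<delta>) = a * \<delta> + a / \<kappa> * S"
    by (simp add: F_def S_def algebra_simps)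
  have "\<bar>a / \<kappa> * S\<bar> \<le> a * \<delta> / 2"
  proof -
    have "2 / \<bar>\<kappa>\<bar> \<le> \<delta> / 2"
      using assms k0 by (simp add: field_simps)
    have "\<bar>a / \<kappa> * S\<bar> = a * (\<bar>S\<bar> / \<bar>\<kappa>\<bar>)"
      using assms by (simp add: abs_mult abs_divide)
    also have "\<dots> \<le> a * (2 / \<bar>\<kappa>\<bar>)"
      using S assms by (intro mult_left_mono divide_right_mono) auto
    also have "\<dots> \<le> a * (\<delta> / 2)"
      using assms \<open>2 / \<bar>\<kappa>\<bar> \<le> \<delta> / 2\<close> by (intro mult_left_mono) auto
    finally show ?thesis by simp
  qed
  show "a * \<delta> / 2 \<le> (LINT z|lborel. (a * (1 - cos (\<beta> - \<kappa> * z)) - a / 2) * indicator {-\<delta>..\<delta>} z)"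
  proof -
    have "y / 2 \<le> y + x" if "\<bar>x\<bar> \<le> y / 2" for x y :: real
      using that by linarith
    with \<open>\<bar>a / \<kappa> * S\<bar> \<le> a * \<delta> / 2\<close> \<open>F \<delta> - F (- \<delta>) = a * \<delta> + a / \<kappa> * S\<close>
    show ?thesis unfolding i by (simp only:)
  qed
qed

section \<open>Divergence of two solitons\<close>

lemma abs_Im_power_ge:
  assumes "1 \<le> j"
  shows "\<exists>M0>0. \<forall>x\<ge>M0. x ^ (2*j-1) \<le> \<bar>Im (Complex 1 x ^ (2*j))\<bar>"
proof -
  \<comment> \<open>\<open>(1 + ix)\<^bsup>2j\<^esup> = (ix)\<^bsup>2j\<^esup> (1 - i/x)\<^bsup>2j\<^esup>\<close>, and \<open>Im (1 - ih)\<^bsup>2j\<^esup>\<close> has derivative \<open>-2j\<close> at \<open>h = 0\<close>.\<close>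
  define \<phi> where "\<phi> h = Im ((1 - \<i> * of_real h) ^ (2*j))" for h :: real
  have "((\<lambda>h::real. (1 - \<i> * of_real h) ^ (2*j)) has_vector_derivative - \<i> * of_nat (2*j)) (at 0)"
  proof -
    have "((\<lambda>z. (1 - \<i> * z) ^ (2*j)) has_field_derivative - \<i> * of_nat (2*j)) (at (of_real 0))"
      by (rule derivative_eq_intros refl)+ simp
    from has_vector_derivative_real_field[OF this] show ?thesis by simp
  qed
  then have "(\<phi> has_real_derivative Im (- \<i> * of_nat (2*j))) (at 0)"
    unfolding \<phi>_def[abs_def] has_real_derivative_iff_has_vector_derivative
    by (rule bounded_linear.has_vector_derivative[OF bounded_linear_Im])
  then have "((\<lambda>h. (\<phi> (0 + h) - \<phi> 0) / h) \<longlongrightarrow> - real (2*j)) (at 0)"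
    by (simp add: DERIV_def)
  then have "((\<lambda>h. \<phi> h / h) \<longlongrightarrow> - real (2*j)) (at_right 0)"
    by (auto simp: \<phi>_def intro: tendsto_within_subset)
  then have "\<forall>\<^sub>F h in at_right 0. \<phi> h / h < -1"
    using assms by (intro order_tendstoD) auto
  then have "\<forall>\<^sub>F x in at_top. \<phi> (inverse x) / inverse x < -1"
    using filterlim_iff[THEN iffD1, OF filterlim_inverse_at_right_top] by blast
  then obtain X where X: "\<And>x. x \<ge> X \<Longrightarrow> \<phi> (inverse x) / inverse x < -1"
    unfolding eventually_at_top_linorder by blast
  have "x ^ (2*j-1) \<le> \<bar>Im (Complex 1 x ^ (2*j))\<bar>" if "max X 1 \<le> x" for x
  proof -
    have x: "x \<ge> 1" "x \<ge> X" using that by auto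
    have "Complex 1 x = (\<i> * of_real x) * (1 - \<i> * of_real (inverse x))"
      using x by (simp add: complex_eq_iff power2_eq_square)
    then have "Complex 1 x ^ (2*j) = (\<i> * of_real x) ^ (2*j) * (1 - \<i> * of_real (inverse x)) ^ (2*j)"
      by (simp only: power_mult_distrib)
    also have "(\<i> * of_real x) ^ (2*j) = of_real ((-1) ^ j * x ^ (2*j))"
      unfolding power_mult_distrib by (simp add: power_mult)
    finally have "Complex 1 x ^ (2*j) = of_real ((-1) ^ j * x ^ (2*j)) * (1 - \<i> * of_real (inverse x)) ^ (2*j)" .
    then have "Im (Complex 1 x ^ (2*j)) = (-1) ^ j * x ^ (2*j) * \<phi> (inverse x)"
      unfolding \<phi>_def by (simp only: Im_complex_of_real Re_complex_of_real times_complex.sel)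
    then have "\<bar>Im (Complex 1 x ^ (2*j))\<bar> = x ^ (2*j) * \<bar>\<phi> (inverse x)\<bar>"
      using x by (simp add: abs_mult)
    moreover have "x ^ (2*j) = x ^ (2*j-1) * x"
      using assms by (metis One_nat_def Suc_pred mult.commute mult_pos_pos pos2 power_Suc less_le_trans zero_less_one)
    moreover have "1 \<le> x * \<bar>\<phi> (inverse x)\<bar>"
    proof -
      have "x * \<phi> (inverse x) < -1"
        using X[OF x(2)] by (simp add: divide_inverse mult.commute)
      then have "1 \<le> \<bar>x * \<phi> (inverse x)\<bar>" by linarith
      then show ?thesis using x(1) by (simp add: abs_mult)
    qed
    ultimately show ?thesis
      using x(1) by (simp add: mult.assoc mult_le_cancel_left1)
  qed
  then show ?thesis by (intro exI[of _ "max X 1"]) auto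
qed

text \<open>Mean value theorem: the derivative of Re (1 + ix)^(2j+1) is -(2j+1) Im (1 + ix)^(2j).
  The threshold holds for all \<epsilon>, because the intermediate point lies to the right of
  M.\<close>

lemma Re_power_increment_ge:
  assumes "1 \<le> j"
  shows "\<exists>M0>0. \<forall>M\<ge>M0. \<forall>\<epsilon>>0. \<epsilon> * M ^ (2*j-1) \<le>
    \<bar>Re (Complex 1 M ^ (2*j+1)) - Re (Complex 1 (M + \<epsilon>) ^ (2*j+1))\<bar>"
proof -
  obtain M0 where M0: "0 < M0" "\<And>x. x \<ge> M0 \<Longrightarrow> x ^ (2*j-1) \<le> \<bar>Im (Complex 1 x ^ (2*j))\<bar>"
    using abs_Im_power_ge[OF assms] by blast
  have d: "((\<lambda>x. Re (Complex 1 x ^ (2*j+1))) has_real_derivative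
      - (real (2*j+1) * Im (Complex 1 x ^ (2*j)))) (at x)" for x
  proof -
    have "((\<lambda>z. (1 + \<i> * z) ^ (2*j+1)) has_field_derivative
        of_nat (2*j+1) * (1 + \<i> * of_real x) ^ (2*j) * \<i>) (at (of_real x))"
      by (rule derivative_eq_intros refl)+ simp
    from has_vector_derivative_real_field[OF this]
    have "((\<lambda>x. Complex 1 x ^ (2*j+1)) has_vector_derivative of_nat (2*j+1) * Complex 1 x ^ (2*j) * \<i>) (at x)"
      by (simp add: Complex_eq)
    from bounded_linear.has_vector_derivative[OF bounded_linear_Re this]
    show ?thesis
      unfolding has_real_derivative_iff_has_vector_derivative by simp
  qed
  have "\<epsilon> * M ^ (2*j-1) \<le> \<bar>Re (Complex 1 M ^ (2*j+1)) - Re (Complex 1 (M + \<epsilon>) ^ (2*j+1))\<bar>"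
    if M: "M \<ge> M0" and e: "\<epsilon> > 0" for M \<epsilon>
  proof -
    obtain z where z: "M < z" "Re (Complex 1 (M + \<epsilon>) ^ (2*j+1)) - Re (Complex 1 M ^ (2*j+1)) =
        (M + \<epsilon> - M) * - (real (2*j+1) * Im (Complex 1 z ^ (2*j)))"
      using MVT2[of M "M + \<epsilon>" _ "\<lambda>x. - (real (2*j+1) * Im (Complex 1 x ^ (2*j)))", OF _ d] e by auto
    have "M ^ (2*j-1) \<le> z ^ (2*j-1)"
      using z M M0(1) by (intro power_mono) auto
    also have "\<dots> \<le> \<bar>Im (Complex 1 z ^ (2*j))\<bar>"
      using M0(2) z M by simp
    also have "\<dots> \<le> real (2*j+1) * \<bar>Im (Complex 1 z ^ (2*j))\<bar>"
      by (simp add: mult_le_cancel_right1)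
    finally have "\<epsilon> * M ^ (2*j-1) \<le> \<epsilon> * (real (2*j+1) * \<bar>Im (Complex 1 z ^ (2*j))\<bar>)"
      using e by (intro mult_left_mono) auto
    also have "\<dots> = \<bar>Re (Complex 1 (M + \<epsilon>) ^ (2*j+1)) - Re (Complex 1 M ^ (2*j+1))\<bar>"
      unfolding z(2) using e by (simp add: abs_mult del: of_nat_add)
    finally show ?thesis by (simp add: abs_minus_commute)
  qed
  then show ?thesis using M0(1) by blast
qed

text \<open>Near z = 0 the profile \<open>G\<close> is bounded away from 0 and hardly changes under
  the shift by \<epsilon>, so a fast relative phase keeps the two bumps apart. The order of the
  quantifiers matters: \<eta> is fixed before \<epsilon>.\<close>

lemma weighted_integral_ge:
  assumes G: "G \<in> schwartz" "G 0 \<noteq> 0" and \<sigma>: "-1 < \<sigma>" and q: "1 \<le> q"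
  shows "\<exists>\<eta>>0. \<exists>\<delta>>0. \<exists>\<epsilon>0>0. \<exists>N0\<ge>1. \<forall>N\<ge>N0. \<forall>\<epsilon>\<in>{0..\<epsilon>0}. \<forall>f \<alpha>1 \<alpha>2 \<beta> \<kappa>.
    integrable lborel (\<lambda>\<xi>. jap \<xi> powr \<sigma> * cmod (f \<xi>) powr q) \<longrightarrow>
    (\<forall>z. f (N + N powr - \<sigma> * z) = cis (\<alpha>1 z) * G z - cis (\<alpha>2 z) * G (z - \<epsilon>)) \<longrightarrow>
    (\<forall>z. \<alpha>1 z - \<alpha>2 z = \<beta> - \<kappa> * z) \<longrightarrow> 4 / \<delta> \<le> \<bar>\<kappa>\<bar> \<longrightarrow>
    \<eta> \<le> (LINT \<xi>|lborel. jap \<xi> powr \<sigma> * cmod (f \<xi>) powr q)"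
proof -
  define a where "a = cmod (G 0) / 2"
  have a: "0 < a" using G(2) by (simp add: a_def)
  have "isCont G 0"
    using schwartz_continuous[OF G(1)] by (simp add: continuous_on_eq_continuous_at)
  then obtain d where d: "0 < d" "\<And>z. \<bar>z\<bar> < d \<Longrightarrow> cmod (G z - G 0) < a"
    using a unfolding continuous_at_eps_delta by (auto simp: dist_norm)
  \<comment> \<open>The bound by d/2 keeps |G| above \<open>a\<close>; the bound by 1, together with
    N^(-\<sigma>) \<le> N/2, keeps the frequencies where the weight is comparable to
    N^\<sigma>.\<close>
  define \<delta> where "\<delta> = min 1 (d / 2)"
  have \<delta>: "0 < \<delta>" "\<delta> \<le> 1" "\<delta> < d" using d(1) by (auto simp: \<delta>_def)
  have Ga: "a \<le> cmod (G z)" if "\<bar>z\<bar> \<le> \<delta>" for z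
  proof -
    have "cmod (G 0) - cmod (G z) \<le> cmod (G z - G 0)"
      by (metis norm_minus_commute norm_triangle_ineq2)
    moreover have "cmod (G z - G 0) < a" using that \<delta> by (intro d) simp
    ultimately show ?thesis by (simp add: a_def)
  qed
  obtain B where B: "0 < B" "\<And>\<epsilon> z. \<epsilon> \<in> {0..1} \<Longrightarrow> cmod (G z - G (z - \<epsilon>)) \<le> \<epsilon> * B * (1 + \<bar>z\<bar>) powr - 0"
    using schwartz_shift_decay[OF G(1), of 0] by auto
  define \<epsilon>0 where "\<epsilon>0 = min 1 (a / (4 * B))"
  have \<epsilon>0: "0 < \<epsilon>0" using a B by (simp add: \<epsilon>0_def)
  obtain c where c: "0 < c" "\<And>N \<xi>. 1 \<le> N \<Longrightarrow> \<bar>\<xi> - N\<bar> \<le> N / 2 \<Longrightarrow> c * N powr \<sigma> \<le> jap \<xi> powr \<sigma>"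
    using jap_powr_ge[of \<sigma>] by blast
  \<comment> \<open>N^(1+\<sigma>) \<ge> 2 is the condition N^(-\<sigma>) \<le> N/2.\<close>
  define N0 :: real where "N0 = 2 powr (1 / (1 + \<sigma>))"
  have N0: "1 \<le> N0" using \<sigma> by (simp add: N0_def ge_one_powr_ge_zero)
  \<comment> \<open>The allowance a/2 is split in two: a/4 for the change from G z to G (z -
    \<epsilon>), guaranteed by \<epsilon>0, and a/4 for the shift \<open>b\<close> in
    \<open>powr_ge_linear\<close>.\<close>
  define b where "b = a / 4"
  have b: "0 < b" using a by (simp add: b_def)
  define \<eta> where "\<eta> = c * b powr (q - 1) * (a * \<delta> / 2)"
  have \<eta>: "0 < \<eta>" using a b c \<delta> by (simp add: \<eta>_def)
  have main: "\<eta> \<le> (LINT \<xi>|lborel. jap \<xi> powr \<sigma> * cmod (f \<xi>) powr q)"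
    if N: "N0 \<le> N" and \<epsilon>: "\<epsilon> \<in> {0..\<epsilon>0}"
      and int: "integrable lborel (\<lambda>\<xi>. jap \<xi> powr \<sigma> * cmod (f \<xi>) powr q)"
      and f: "\<And>z. f (N + N powr - \<sigma> * z) = cis (\<alpha>1 z) * G z - cis (\<alpha>2 z) * G (z - \<epsilon>)"
      and \<alpha>: "\<And>z. \<alpha>1 z - \<alpha>2 z = \<beta> - \<kappa> * z" and \<kappa>: "4 / \<delta> \<le> \<bar>\<kappa>\<bar>" for N \<epsilon> f \<alpha>1 \<alpha>2 \<beta> \<kappa>
  proof -
    define w where "w = N powr - \<sigma>"
    have N1: "1 \<le> N" using N N0 by linarith
    then have w: "0 < w" "N powr \<sigma> * w = 1" by (auto simp: w_def powr_minus)
    define F where "F = (\<lambda>\<xi>. jap \<xi> powr \<sigma> * cmod (f \<xi>) powr q)"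
    define g where "g z = (a * (1 - cos (\<beta> - \<kappa> * z)) - a / 2) * indicator {-\<delta>..\<delta>} z" for z
    have g: "integrable lborel g" "a * \<delta> / 2 \<le> (LINT z|lborel. g z)"
      unfolding g_def using integral_one_minus_cos_ge[OF \<delta>(1) a \<kappa>] by blast+
    have w2: "w \<le> N / 2"
    proof -
      have "2 = N0 powr (1 + \<sigma>)" using \<sigma> by (simp add: N0_def powr_powr)
      also have "\<dots> \<le> N powr (1 + \<sigma>)" using N N0 \<sigma> by (intro powr_mono2) auto
      also have "\<dots> = N * N powr \<sigma>" using N1 by (simp add: powr_add)
      finally have "2 * w \<le> N * N powr \<sigma> * w" using w(1) by (intro mult_right_mono) auto
      then show ?thesis using w(2) by (simp add: mult.assoc)
    qed
    have le: "c * N powr \<sigma> * b powr (q - 1) * g z \<le> F (N + w * z)" for z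
    proof (cases "z \<in> {-\<delta>..\<delta>}")
      case False
      then show ?thesis by (simp add: g_def F_def)
    next
      case True
      then have z: "\<bar>z\<bar> \<le> \<delta>" by auto
      have "w * \<bar>z\<bar> \<le> w * 1" using z \<delta> w(1) by (intro mult_left_mono) auto
      moreover have "\<bar>N + w * z - N\<bar> = w * \<bar>z\<bar>" using w(1) by (simp add: abs_mult)
      ultimately have "\<bar>N + w * z - N\<bar> \<le> N / 2" using w2 by linarith
      then have j: "c * N powr \<sigma> \<le> jap (N + w * z) powr \<sigma>" by (rule c(2)[OF N1])
      have "f (N + w * z) = (cis (\<alpha>1 z) - cis (\<alpha>2 z)) * G z + cis (\<alpha>2 z) * (G z - G (z - \<epsilon>))"
        unfolding w_def f by (simp add: algebra_simps)
      then have "cmod ((cis (\<alpha>1 z) - cis (\<alpha>2 z)) * G z) \<le>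
          cmod (f (N + w * z)) + cmod (cis (\<alpha>2 z) * (G z - G (z - \<epsilon>)))"
        by (metis add_diff_cancel_right' norm_triangle_ineq4)
      then have "cmod (cis (\<alpha>1 z) - cis (\<alpha>2 z)) * cmod (G z) \<le> cmod (f (N + w * z)) + cmod (G z - G (z - \<epsilon>))"
        by (simp add: norm_mult)
      moreover have "cmod (G z - G (z - \<epsilon>)) \<le> a / 4"
      proof -
        have "cmod (G z - G (z - \<epsilon>)) \<le> \<epsilon> * B"
        proof -
          have "1 + \<bar>z\<bar> \<noteq> 0" by linarith
          then show ?thesis using B(2)[of \<epsilon> z] \<epsilon> by (simp add: \<epsilon>0_def)
        qed
        also have "\<dots> \<le> a / (4 * B) * B"
          using \<epsilon> B(1) by (intro mult_right_mono) (auto simp: \<epsilon>0_def)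
        finally show ?thesis using B(1) by simp
      qed
      moreover have "(1 - cos (\<beta> - \<kappa> * z)) * a \<le> cmod (cis (\<alpha>1 z) - cis (\<alpha>2 z)) * cmod (G z)"
        using cmod_cis_diff_ge[of "\<alpha>1 z" "\<alpha>2 z"] Ga[OF z] a unfolding \<alpha> by (intro mult_mono) auto
      ultimately have "a * (1 - cos (\<beta> - \<kappa> * z)) - a / 2 \<le> cmod (f (N + w * z)) - b"
        unfolding b_def by (simp add: mult.commute)
      then have "g z \<le> cmod (f (N + w * z)) - b"
        using True by (simp add: g_def)
      then have "b powr (q - 1) * g z \<le> b powr (q - 1) * (cmod (f (N + w * z)) - b)"
        by (intro mult_left_mono) auto
      also have "\<dots> \<le> cmod (f (N + w * z)) powr q"
        by (rule powr_ge_linear) (use b q in auto)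
      finally have "c * N powr \<sigma> * (b powr (q - 1) * g z) \<le> c * N powr \<sigma> * cmod (f (N + w * z)) powr q"
        using c(1) by (intro mult_left_mono) auto
      also have "\<dots> \<le> F (N + w * z)"
        unfolding F_def by (intro mult_right_mono j) auto
      finally show ?thesis by (simp add: mult.assoc)
    qed
    have "\<eta> \<le> c * b powr (q - 1) * (LINT z|lborel. g z)"
      unfolding \<eta>_def using c(1) g(2) by (intro mult_left_mono) auto
    also have "\<dots> = (N powr \<sigma> * w) * (c * b powr (q - 1) * (LINT z|lborel. g z))"
      unfolding w(2) by simp
    also have "\<dots> = w * (LINT z|lborel. c * N powr \<sigma> * b powr (q - 1) * g z)"
      unfolding integral_mult_right_zero by (simp only: mult_ac)
    also have "\<dots> \<le> w * (LINT z|lborel. F (N + w * z))"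
    proof (rule mult_left_mono[OF integral_mono])
      show "integrable lborel (\<lambda>z. F (N + w * z))"
        using int w(1) by (intro lborel_integrable_real_affine) (auto simp: F_def)
    qed (use g le w in auto)
    also have "\<dots> = (LINT \<xi>|lborel. F \<xi>)"
      using lborel_integral_real_affine[of w F N] w(1) by simp
    finally show ?thesis unfolding F_def .
  qed
  show ?thesis
  proof (rule exI[of _ \<eta>], rule conjI[OF \<eta>], rule exI[of _ \<delta>], rule conjI[OF \<delta>(1)],
      rule exI[of _ \<epsilon>0], rule conjI[OF \<epsilon>0], rule exI[of _ N0], rule conjI[OF N0],
      intro allI ballI impI)
    fix N \<epsilon> f \<alpha>1 \<alpha>2 \<beta> \<kappa>
    assume "N0 \<le> N" "\<epsilon> \<in> {0..\<epsilon>0}"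
      "integrable lborel (\<lambda>\<xi>. jap \<xi> powr \<sigma> * cmod (f \<xi>) powr q)"
      "\<forall>z. f (N + N powr - \<sigma> * z) = cis (\<alpha>1 z) * G z - cis (\<alpha>2 z) * G (z - \<epsilon>)"
      "\<forall>z. \<alpha>1 z - \<alpha>2 z = \<beta> - \<kappa> * z" "4 / \<delta> \<le> \<bar>\<kappa>\<bar>"
    then show "\<eta> \<le> (LINT \<xi>|lborel. jap \<xi> powr \<sigma> * cmod (f \<xi>) powr q)"
      using main[of N \<epsilon> f \<alpha>1 \<alpha>2 \<beta> \<kappa>] by blast
  qed
qed

lemma fourier_sech_0: "fourier (soliton 1 0 0 0) 0 \<noteq> 0"
proof
  assume "fourier (soliton 1 0 0 0) 0 = 0"
  then have "(LINT x|lborel. soliton 1 0 0 0 x) = 0"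
    by (simp add: fourier_def)
  moreover have s: "soliton 1 0 0 0 = (\<lambda>x. of_real (inverse (cosh x)))"
    by (auto simp: soliton_def)
  ultimately have 0: "(LINT x|lborel. inverse (cosh x) :: real) = 0"
    by (simp del: of_real_inverse)
  have "integrable lborel (\<lambda>x. Re (soliton 1 0 0 0 x))"
    by (intro integrable_Re schwartz_integrable soliton_schwartz) simp
  then have "integrable lborel (\<lambda>x::real. inverse (cosh x))"
    unfolding s by (simp del: of_real_inverse)
  from integral_nonneg_eq_0_iff_AE[OF this] 0 have "AE x::real in lborel. inverse (cosh x) = 0"
    by simp
  then have "AE x::real in lborel. False"
    by simp
  then have "emeasure lborel (UNIV :: real set) = 0"
    by (simp add: AE_iff_measurable[OF _ refl])
  then show False by simp
qed

lemma powr_unbounded: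
  assumes "0 < p" shows "\<exists>N1\<ge>1. \<forall>N\<ge>N1. (X::real) \<le> N powr p"
proof (intro exI[of _ "max X 1 powr (1 / p)"] conjI allI impI)
  show "1 \<le> max X 1 powr (1 / p)" using assms by (intro ge_one_powr_ge_zero) auto
  fix N assume N: "max X 1 powr (1 / p) \<le> N"
  have "X \<le> (max X 1 powr (1 / p)) powr p" using assms by (simp add: powr_powr)
  also have "\<dots> \<le> N powr p" using assms N by (intro powr_mono2) auto
  finally show "X \<le> N powr p" .
qed

text \<open>The scale \<open>w = N\<^bsup>-\<sigma>\<^esup>\<close> gives all pulses norm of order one.\<close>

definition pulse :: "nat \<Rightarrow> real \<Rightarrow> real \<Rightarrow> real \<Rightarrow> real \<Rightarrow> real \<Rightarrow> complex" where
  "pulse j \<sigma> N \<epsilon> t = (let w = N powr - \<sigma>; M = N / w + \<epsilon> in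
     soliton w M (soliton_freq j w M * t) (soliton_speed j w M * t))"

text \<open>For every \<epsilon> the variable z measures frequency from N in units of w, so that
  phases can be subtracted; the pulse itself is centred at z = \<epsilon>.\<close>

definition pulse_phase :: "nat \<Rightarrow> real \<Rightarrow> real \<Rightarrow> real \<Rightarrow> real \<Rightarrow> real \<Rightarrow> real" where
  "pulse_phase j \<sigma> N \<epsilon> t z = (let w = N powr - \<sigma>; M = N / w + \<epsilon> in
     soliton_freq j w M * t - soliton_speed j w M * t * (w * (z - \<epsilon>)))"

lemma pulse_schwartz: "0 < N \<Longrightarrow> pulse j \<sigma> N \<epsilon> t \<in> schwartz"
  unfolding pulse_def Let_def by (rule soliton_schwartz) simp

lemma fourier_pulse:
  assumes "0 < N"
  shows "fourier (pulse j \<sigma> N \<epsilon> t) \<xi> = cis (pulse_phase j \<sigma> N \<epsilon> t ((\<xi> - N) / N powr - \<sigma>)) *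
     fourier (soliton 1 0 0 0) ((\<xi> - N) / N powr - \<sigma> - \<epsilon>)"
proof -
  define w where "w = N powr - \<sigma>"
  have w: "0 < w" using assms by (simp add: w_def)
  have 1: "\<xi> - w * (N / w + \<epsilon>) = w * ((\<xi> - N) / w - \<epsilon>)" "\<xi> / w - (N / w + \<epsilon>) = (\<xi> - N) / w - \<epsilon>"
    using w by (simp_all add: field_simps)
  show ?thesis
    unfolding pulse_def pulse_phase_def Let_def w_def[symmetric] fourier_soliton[OF w] 1 ..
qed

lemma fourier_pulse_0: "0 < N \<Longrightarrow> fourier (pulse j \<sigma> N \<epsilon> 0) \<xi> =
     fourier (soliton 1 0 0 0) ((\<xi> - N) / N powr - \<sigma> - \<epsilon>)"
  by (simp add: fourier_pulse pulse_phase_def)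

text \<open>The slope \<kappa> is T w times the difference of the speeds. \<open>N1\<close> makes M
  large enough for \<open>Re_power_increment_ge\<close>, \<open>N2\<close> makes T \<epsilon> N^p
  exceed \<open>X\<close>, and p > 0 is the upper bound on \<sigma>. The threshold may depend on
  \<epsilon>.\<close>

lemma pulse_phase_diff:
  assumes j: "1 \<le> j" and \<sigma>: "-1 < \<sigma>" "\<sigma> < (2 * real j - 1) / 2" and T: "0 < T"
  shows "0 < \<epsilon> \<Longrightarrow> \<exists>N1\<ge>1. \<forall>N\<ge>N1. \<exists>\<beta> \<kappa>. X \<le> \<bar>\<kappa>\<bar> \<and>
    (\<forall>z. pulse_phase j \<sigma> N 0 T z - pulse_phase j \<sigma> N \<epsilon> T z = \<beta> - \<kappa> * z)"
proof -
  assume \<epsilon>: "0 < \<epsilon>"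
  obtain M0 where M0: "\<And>M \<epsilon>. M0 \<le> M \<Longrightarrow> 0 < \<epsilon> \<Longrightarrow> \<epsilon> * M ^ (2*j-1) \<le>
    \<bar>Re (Complex 1 M ^ (2*j+1)) - Re (Complex 1 (M + \<epsilon>) ^ (2*j+1))\<bar>"
    using Re_power_increment_ge[OF j] by blast
  define p where "p = 2 * real j - 1 - 2 * \<sigma>"
  have p: "0 < p" using \<sigma> by (simp add: p_def)
  obtain N1 where N1: "1 \<le> N1" "\<And>N. N1 \<le> N \<Longrightarrow> M0 \<le> N powr (1 + \<sigma>)"
    using powr_unbounded[of "1 + \<sigma>" M0] \<sigma> by auto
  obtain N2 where N2: "1 \<le> N2" "\<And>N. N2 \<le> N \<Longrightarrow> X / (T * \<epsilon>) \<le> N powr p"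
    using powr_unbounded[OF p, of "X / (T * \<epsilon>)"] by auto
  have "\<exists>\<beta> \<kappa>. X \<le> \<bar>\<kappa>\<bar> \<and> (\<forall>z. pulse_phase j \<sigma> N 0 T z - pulse_phase j \<sigma> N \<epsilon> T z = \<beta> - \<kappa> * z)"
    if N: "max N1 N2 \<le> N" for N
  proof -
    have N0: "1 \<le> N" using N N1 by linarith
    define w where "w = N powr - \<sigma>"
    define M where "M = N / w"
    define \<kappa> where "\<kappa> = T * w * (soliton_speed j w M - soliton_speed j w (M + \<epsilon>))"
    define \<beta> where "\<beta> = soliton_freq j w M * T - soliton_freq j w (M + \<epsilon>) * T - soliton_speed j w (M + \<epsilon>) * T * (w * \<epsilon>)"
    have w: "0 < w" using N0 by (simp add: w_def)
    have M: "M = N powr (1 + \<sigma>)"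
      using N0 by (simp add: M_def w_def powr_minus powr_add field_simps)
    have "pulse_phase j \<sigma> N 0 T z - pulse_phase j \<sigma> N \<epsilon> T z = \<beta> - \<kappa> * z" for z
      unfolding pulse_phase_def Let_def w_def[symmetric] M_def[symmetric] \<beta>_def \<kappa>_def
      by (simp add: algebra_simps)
    moreover have "X \<le> \<bar>\<kappa>\<bar>"
    proof -
      have "X \<le> T * \<epsilon> * N powr p"
        using N2(2)[of N] N T \<epsilon> by (simp add: field_simps)
      also have "N powr p = w ^ (2*j+1) * M ^ (2*j-1)"
      proof -
        have pw: "(N powr x) ^ n = N powr (x * real n)" for x n
        proof -
          have "(N powr x) ^ n = (N powr x) powr real n"
            using N0 by (simp add: powr_realpow)
          then show ?thesis by (simp only: powr_powr)
        qed
        have "w ^ (2*j+1) * M ^ (2*j-1) = N powr (- \<sigma> * real (2*j+1) + (1 + \<sigma>) * real (2*j-1))"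
          unfolding M w_def pw powr_add[of N "- \<sigma> * real (2*j+1)"] ..
        also have "- \<sigma> * real (2*j+1) + (1 + \<sigma>) * real (2*j-1) = p"
          using j by (simp add: p_def of_nat_diff algebra_simps)
        finally show ?thesis by simp
      qed
      also have "T * \<epsilon> * (w ^ (2*j+1) * M ^ (2*j-1)) = T * w ^ (2*j+1) * (\<epsilon> * M ^ (2*j-1))"
        by (simp only: mult_ac)
      also have "\<dots> \<le> T * w ^ (2*j+1) * \<bar>Re (Complex 1 M ^ (2*j+1)) - Re (Complex 1 (M + \<epsilon>) ^ (2*j+1))\<bar>"
        using M0[of M \<epsilon>] N1(2)[of N] N \<epsilon> T w by (intro mult_left_mono) (auto simp: M)
      also have "\<dots> = \<bar>\<kappa>\<bar>"
      proof -
        have "\<kappa> = T * w ^ (2*j+1) * (-1) ^ (j+1) * (Re (Complex 1 M ^ (2*j+1)) - Re (Complex 1 (M + \<epsilon>) ^ (2*j+1)))"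
          unfolding \<kappa>_def soliton_speed_def right_diff_distrib by (simp only: power_add power_one_right mult_ac)
        then show ?thesis
          using T w by (simp only: abs_mult power_abs abs_minus_cancel abs_one power_one abs_of_pos zero_less_power mult_1_right)
      qed
      finally show ?thesis .
    qed
    ultimately show ?thesis by blast
  qed
  then show ?thesis using N1(1) by (intro exI[of _ "max N1 N2"]) auto
qed

section \<open>Failure of uniform continuity\<close>

lemma hat_H_weight: "(jap \<xi> powr s * cmod y) powr q = jap \<xi> powr (s * q) * cmod y powr q"
  by (simp add: powr_mult powr_powr)

theorem proposition1:
  fixes r :: real and j :: nat
  assumes "1 < r" "r \<le> 2" "1 \<le> j"
  shows "\<exists>a :: nat \<Rightarrow> nat \<Rightarrow> real. \<forall>s :: real.
    - (1 / conj_exp r) < s \<longrightarrow> s < (2 * real j - 1) / (2 * conj_exp r) \<longrightarrow>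
    (\<forall>T::real. 0 < T \<longrightarrow> (\<forall>X NX S.
       normed_curve_space X NX \<longrightarrow> embedded_in_C T r s X NX \<longrightarrow>
       solution_map a j T r s X S \<longrightarrow>
       \<not> (\<forall>B. hat_H_bounded r s B \<longrightarrow> uniformly_continuous_into r s NX B S)))"
proof -
  obtain a :: "nat \<Rightarrow> nat \<Rightarrow> real" where a: "\<And>T w M. 0 < w \<Longrightarrow>
     schwartz_solution a j T (\<lambda>t. soliton w M (soliton_freq j w M * t) (soliton_speed j w M * t))"
    using soliton_solves[of j] by blast
  show ?thesis
  proof (rule exI[of _ a], intro allI impI notI)
    fix s T :: real and X NX S
    assume s: "- (1 / conj_exp r) < s" "s < (2 * real j - 1) / (2 * conj_exp r)" and T: "0 < T"
      and X: "normed_curve_space X NX" and emb: "embedded_in_C T r s X NX"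
      and S: "solution_map a j T r s X S"
      and uc: "\<forall>B. hat_H_bounded r s B \<longrightarrow> uniformly_continuous_into r s NX B S"
    define q where "q = conj_exp r"
    define \<sigma> where "\<sigma> = s * q"
    have q: "1 \<le> q" using assms by (simp add: q_def conj_exp_def)
    have \<sigma>: "-1 < \<sigma>" "\<sigma> < (2 * real j - 1) / 2"
      using s q unfolding q_def[symmetric] \<sigma>_def by (simp_all add: field_simps)
    define G where "G = fourier (soliton 1 0 0 0)"
    have G: "G \<in> schwartz" "G 0 \<noteq> 0"
      unfolding G_def by (intro fourier_schwartz soliton_schwartz zero_less_one fourier_sech_0)+
    define V where "V = pulse j \<sigma>"
    have V: "V N \<epsilon> t \<in> schwartz" if "1 \<le> N" for N \<epsilon> t
      unfolding V_def using that by (intro pulse_schwartz) simp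
    have sol: "schwartz_solution a j T (V N \<epsilon>)" if "1 \<le> N" for N \<epsilon>
      unfolding V_def pulse_def[abs_def] Let_def using that by (intro a) simp
    have hf: "has_fourier (fun_tdist (V N \<epsilon> t)) (fourier (V N \<epsilon> t))" if "1 \<le> N" for N \<epsilon> t
      by (intro has_fourier_fun_tdist V that)
    have hfd: "has_fourier (fun_tdist (V N 0 t) - fun_tdist (V N \<epsilon> t))
        (\<lambda>\<xi>. fourier (V N 0 t) \<xi> - fourier (V N \<epsilon> t) \<xi>)" if "1 \<le> N" for N \<epsilon> t
      by (intro has_fourier_diff hf that)
    have norm: "hat_H_norm r s u = (LINT \<xi>|lborel. jap \<xi> powr \<sigma> * cmod (f \<xi>) powr q) powr (1 / q)"
      if "has_fourier u f" for u f
      unfolding hat_H_norm_eq[OF that] hat_H_weight q_def \<sigma>_def ..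
    have meas: "fourier (V N \<epsilon> t) \<in> borel_measurable borel" if "1 \<le> N" for N \<epsilon> t
      using fourier_schwartz[OF V[OF that]]
      by (intro borel_measurable_continuous_onI schwartz_continuous)
    obtain A k where A: "0 < A" "0 \<le> k" and Ak: "\<And>N f B. 1 \<le> N \<Longrightarrow> 0 \<le> B \<Longrightarrow> f \<in> borel_measurable borel \<Longrightarrow>
      (\<And>\<xi>. cmod (f \<xi>) \<le> B * (1 + \<bar>(\<xi> - N) / N powr - \<sigma>\<bar>) powr - k) \<Longrightarrow>
      integrable lborel (\<lambda>\<xi>. jap \<xi> powr \<sigma> * cmod (f \<xi>) powr q) \<and>
      (LINT \<xi>|lborel. jap \<xi> powr \<sigma> * cmod (f \<xi>) powr q) \<le> A * B powr q"
      using weighted_integral_le[OF \<sigma>(1), of q] q by (smt (verit))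
    obtain B where B: "0 < B" "\<And>\<epsilon> x. \<epsilon> \<in> {0..1} \<Longrightarrow> cmod (G (x - \<epsilon>)) \<le> B * (1 + \<bar>x\<bar>) powr - k"
      "\<And>\<epsilon> x. \<epsilon> \<in> {0..1} \<Longrightarrow> cmod (G x - G (x - \<epsilon>)) \<le> \<epsilon> * B * (1 + \<bar>x\<bar>) powr - k"
      using schwartz_shift_decay[OF G(1) A(2)] by blast
    have Vb: "cmod (fourier (V N \<epsilon> t) \<xi>) \<le> B * (1 + \<bar>(\<xi> - N) / N powr - \<sigma>\<bar>) powr - k"
      if "1 \<le> N" "\<epsilon> \<in> {0..1}" for N \<epsilon> t \<xi>
      using that B(2)[of \<epsilon> "(\<xi> - N) / N powr - \<sigma>"]
      by (simp add: V_def fourier_pulse G_def norm_mult)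
    obtain \<eta> \<delta> \<epsilon>0 N0 where low: "0 < \<eta>" "0 < \<delta>" "0 < \<epsilon>0" "1 \<le> N0"
      "\<forall>N\<ge>N0. \<forall>\<epsilon>\<in>{0..\<epsilon>0}. \<forall>f \<alpha>1 \<alpha>2 \<beta> \<kappa>.
      integrable lborel (\<lambda>\<xi>. jap \<xi> powr \<sigma> * cmod (f \<xi>) powr q) \<longrightarrow>
      (\<forall>z. f (N + N powr - \<sigma> * z) = cis (\<alpha>1 z) * G z - cis (\<alpha>2 z) * G (z - \<epsilon>)) \<longrightarrow>
      (\<forall>z. \<alpha>1 z - \<alpha>2 z = \<beta> - \<kappa> * z) \<longrightarrow> 4 / \<delta> \<le> \<bar>\<kappa>\<bar> \<longrightarrow>
      \<eta> \<le> (LINT \<xi>|lborel. jap \<xi> powr \<sigma> * cmod (f \<xi>) powr q)"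
      using weighted_integral_ge[OF G \<sigma>(1) q] by (elim exE conjE) (rule that)
    \<comment> \<open>A single bounded set contains the data for all N, since N is picked only after
      the modulus of continuity on the set is known.\<close>
    define D where "D = {fun_tdist (V N \<epsilon> 0) | N \<epsilon>. 1 \<le> N \<and> \<epsilon> \<in> {0..1}}"
    have "hat_H_bounded r s D"
    proof -
      have "u \<in> hat_H r s \<and> hat_H_norm r s u \<le> (A * B powr q) powr (1 / q)" if "u \<in> D" for u
      proof -
        obtain N \<epsilon> where u: "u = fun_tdist (V N \<epsilon> 0)" and N: "1 \<le> N" and \<epsilon>: "\<epsilon> \<in> {0..1}"
          using \<open>u \<in> D\<close> unfolding D_def by blast
        have *: "integrable lborel (\<lambda>\<xi>. jap \<xi> powr \<sigma> * cmod (fourier (V N \<epsilon> 0) \<xi>) powr q)"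
          "(LINT \<xi>|lborel. jap \<xi> powr \<sigma> * cmod (fourier (V N \<epsilon> 0) \<xi>) powr q) \<le> A * B powr q"
          using Ak[OF N _ meas[OF N] Vb[OF N \<epsilon>]] B(1) by auto
        have "u \<in> hat_H r s"
          unfolding hat_H_def u hat_H_weight using hf[OF N] *(1) unfolding q_def \<sigma>_def by blast
        moreover have "hat_H_norm r s u \<le> (A * B powr q) powr (1 / q)"
          unfolding u norm[OF hf[OF N]] using * q by (intro powr_mono2 integral_nonneg_AE) auto
        ultimately show ?thesis by blast
      qed
      then show ?thesis unfolding hat_H_bounded_def by blast
    qed
    then have ucD: "uniformly_continuous_into r s NX D S" using uc by blast
    obtain K where K: "\<And>u t. u \<in> X \<Longrightarrow> t \<in> {0..T} \<Longrightarrow> hat_H_norm r s (u t) \<le> K * NX u"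
      using emb unfolding embedded_in_C_def by blast
    \<comment> \<open>The embedding constant \<open>K\<close> might not be positive;
      \<open>max K 1\<close> is, and it still bounds because \<open>NX\<close> is
      nonnegative.\<close>
    have "0 < \<eta> powr (1 / q) / max K 1" using low(1) by simp
    then obtain d where d: "0 < d" "\<And>v w. v \<in> D \<Longrightarrow> w \<in> D \<Longrightarrow> hat_H_norm r s (v - w) < d \<Longrightarrow>
        NX (\<lambda>t. S v t - S w t) < \<eta> powr (1 / q) / max K 1"
      using ucD unfolding uniformly_continuous_into_def by metis
    \<comment> \<open>The last entry makes the data at most d/2 apart, the first keeps the shift
      within the range of the decay bounds, and \<epsilon>0 serves the lower bound at time
      T.\<close>
    define \<epsilon> where "\<epsilon> = Min {1, \<epsilon>0, d / (2 * A powr (1 / q) * B)}"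
    have \<epsilon>: "0 < \<epsilon>" "\<epsilon> \<le> 1" "\<epsilon> \<le> \<epsilon>0" "\<epsilon> \<le> d / (2 * A powr (1 / q) * B)"
      using low(3) d(1) A(1) B(1) by (auto simp: \<epsilon>_def)
    \<comment> \<open>\<open>N1\<close> depends on \<epsilon>, whereas \<eta>, \<delta> and
      \<open>N0\<close> were fixed before it; this makes the contradiction possible.\<close>
    obtain N1 where N1: "1 \<le> N1" "\<And>N. N1 \<le> N \<Longrightarrow> \<exists>\<beta> \<kappa>. 4 / \<delta> \<le> \<bar>\<kappa>\<bar> \<and>
        (\<forall>z. pulse_phase j \<sigma> N 0 T z - pulse_phase j \<sigma> N \<epsilon> T z = \<beta> - \<kappa> * z)"
      using pulse_phase_diff[OF assms(3) \<sigma> T \<epsilon>(1), of "4 / \<delta>"] by blast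
    define N where "N = max N0 N1"
    have N: "1 \<le> N" "N0 \<le> N" "N1 \<le> N" using low(4) by (auto simp: N_def)
    let ?v = "fun_tdist (V N 0 0)" and ?w = "fun_tdist (V N \<epsilon> 0)"
    have "fun_tdist (V N \<epsilon>' 0) \<in> D" if "\<epsilon>' \<in> {0..1}" for \<epsilon>'
      unfolding D_def using N(1) that by blast
    then have vD: "?v \<in> D" "?w \<in> D"
      using \<epsilon> by auto
    have vH: "?v \<in> hat_H r s" "?w \<in> hat_H r s"
      using vD \<open>hat_H_bounded r s D\<close> unfolding hat_H_bounded_def by auto
    have "hat_H_norm r s (?v - ?w) < d"
    proof -
      have "cmod (fourier (V N 0 0) \<xi> - fourier (V N \<epsilon> 0) \<xi>) \<le>
          (\<epsilon> * B) * (1 + \<bar>(\<xi> - N) / N powr - \<sigma>\<bar>) powr - k" for \<xi>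
        using B(3)[of \<epsilon> "(\<xi> - N) / N powr - \<sigma>"] N(1) \<epsilon>
        by (simp add: V_def fourier_pulse_0 G_def)
      then have *: "(LINT \<xi>|lborel. jap \<xi> powr \<sigma> * cmod (fourier (V N 0 0) \<xi> - fourier (V N \<epsilon> 0) \<xi>) powr q) \<le>
          A * (\<epsilon> * B) powr q"
        using Ak[OF N(1), of "\<epsilon> * B" "\<lambda>\<xi>. fourier (V N 0 0) \<xi> - fourier (V N \<epsilon> 0) \<xi>"] \<epsilon>(1) B(1)
          borel_measurable_diff[OF meas[OF N(1)] meas[OF N(1)]] by simp
      have "hat_H_norm r s (?v - ?w) \<le> (A * (\<epsilon> * B) powr q) powr (1 / q)"
        unfolding norm[OF hfd[OF N(1)]] using * q by (intro powr_mono2 integral_nonneg_AE) auto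
      also have "\<dots> = A powr (1 / q) * B * \<epsilon>"
        using A(1) B(1) \<epsilon>(1) q by (simp add: powr_mult powr_powr)
      also have "\<dots> \<le> A powr (1 / q) * B * (d / (2 * A powr (1 / q) * B))"
        using A(1) B(1) \<epsilon>(4) by (intro mult_left_mono) auto
      also have "\<dots> = d / 2" using A(1) B(1) by simp
      finally show ?thesis using d(1) by linarith
    qed
    then have small: "NX (\<lambda>t. S ?v t - S ?w t) < \<eta> powr (1 / q) / max K 1"
      by (rule d(2)[OF vD])
    have SX: "S ?v \<in> X" "S ?w \<in> X"
      using S vH unfolding solution_map_def by auto
    have diffX: "(\<lambda>t. S ?v t - S ?w t) \<in> X"
    proof -
      have "(\<lambda>t. (-1) *\<^sub>R S ?w t) \<in> X"
        using X SX(2) unfolding normed_curve_space_def by blast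
      moreover have "(\<lambda>t. u t + w t) \<in> X" if "u \<in> X" "w \<in> X" for u w
        using X that unfolding normed_curve_space_def by blast
      ultimately have "(\<lambda>t. S ?v t + (-1) *\<^sub>R S ?w t) \<in> X"
        using SX(1) by blast
      then show ?thesis by simp
    qed
    have "0 \<le> NX (\<lambda>t. S ?v t - S ?w t)"
      using X diffX unfolding normed_curve_space_def by blast
    then have "hat_H_norm r s (S ?v T - S ?w T) \<le> max K 1 * NX (\<lambda>t. S ?v t - S ?w t)"
      using K[OF diffX, of T] T by (smt (verit, best) atLeastAtMost_iff mult_right_mono)
    also have "\<dots> < \<eta> powr (1 / q)"
      using small by (simp add: field_simps)
    finally have up: "hat_H_norm r s (S ?v T - S ?w T) < \<eta> powr (1 / q)" .
    have ST: "S (fun_tdist (V N \<epsilon>' 0)) T = fun_tdist (V N \<epsilon>' T)" for \<epsilon>'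
      using S sol[OF N(1), of \<epsilon>'] T unfolding solution_map_def by auto
    obtain \<beta> \<kappa> where \<kappa>: "4 / \<delta> \<le> \<bar>\<kappa>\<bar>"
      "\<forall>z. pulse_phase j \<sigma> N 0 T z - pulse_phase j \<sigma> N \<epsilon> T z = \<beta> - \<kappa> * z"
      using N1(2)[OF N(3)] by blast
    let ?f = "\<lambda>\<xi>. fourier (V N 0 T) \<xi> - fourier (V N \<epsilon> T) \<xi>"
    \<comment> \<open>Phases do not affect moduli, so the bounds at time 0 persist. They give the
      integrability that the lower bound asks for.\<close>
    have "cmod (?f \<xi>) \<le> (2 * B) * (1 + \<bar>(\<xi> - N) / N powr - \<sigma>\<bar>) powr - k" for \<xi>
      using norm_triangle_ineq4[of "fourier (V N 0 T) \<xi>" "fourier (V N \<epsilon> T) \<xi>"]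
        Vb[OF N(1), of 0 T \<xi>] Vb[OF N(1), of \<epsilon> T \<xi>] \<epsilon> by simp
    then have "integrable lborel (\<lambda>\<xi>. jap \<xi> powr \<sigma> * cmod (?f \<xi>) powr q)"
      using Ak[OF N(1), of "2 * B" ?f] B(1)
        borel_measurable_diff[OF meas[OF N(1)] meas[OF N(1)]] by simp
    moreover have "\<forall>z. ?f (N + N powr - \<sigma> * z) =
        cis (pulse_phase j \<sigma> N 0 T z) * G z - cis (pulse_phase j \<sigma> N \<epsilon> T z) * G (z - \<epsilon>)"
      using N(1) by (simp add: V_def fourier_pulse G_def)
    ultimately have "\<eta> \<le> (LINT \<xi>|lborel. jap \<xi> powr \<sigma> * cmod (?f \<xi>) powr q)"
      using \<kappa> bspec[OF low(5)[THEN spec, THEN mp, OF N(2)], of \<epsilon>, THEN spec[of _ ?f],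
          THEN spec[of _ "pulse_phase j \<sigma> N 0 T"], THEN spec[of _ "pulse_phase j \<sigma> N \<epsilon> T"],
          THEN spec[of _ \<beta>], THEN spec[of _ \<kappa>]] \<epsilon>
      by simp
    then have "\<eta> powr (1 / q) \<le> hat_H_norm r s (S ?v T - S ?w T)"
      unfolding ST norm[OF hfd[OF N(1)]] using low(1) q by (intro powr_mono2) auto
    with up show False by simp
  qed
qed

end
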